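(* Let $n>d\ge 1$ and $m\ge 1$. Consider the $d$-dimensional multivariate normal model in which $\mathbf{y}_1,\dots,\mathbf{y}_n,\mathbf{y}_1^*,\dots,\mathbf{y}_m^*$ are i.i.d. $\mathcal{N}(\boldsymbol\mu,UU^T)$, with parameter $\theta=(U,\boldsymbol\mu)\in\Theta$, where $\Theta$ is the set of pairs of an upper triangular $U\in\mathbb{R}^{d\times d}$ with positive diagonal and a vector $\boldsymbol\mu\in\mathbb{R}^d$. Then the Bayesian posterior predictive distribution of $\mathbf{y}^*_{1:m}$ given $\mathbf{y}_{1:n}$ with improper prior $$\mu_R(U,\boldsymbol\mu)\propto\prod_{i=1}^d(U_{i,i})^{-i}\,dU_{1,1}\,dU_{1,2}\cdots dU_{d,d}\,d\boldsymbol\mu$$ is an optimal predictive procedure in the sense that it maximizes, among all predictive procedures $q$, $$\min_{\theta^*\in\Theta}\ \mathbb{E}_{(\mathbf{y}_{1:n},\mathbf{y}^*_{1:m})\sim p(\cdot\mid\theta^* )}\left[\log q(\mathbf{y}^*_{1:m};\mathbf{y}_{1:n})-\log p(\mathbf{y}^*_{1:m}\mid\mathbf{y}_{1:n},\theta^* )\right].$$ Additionally, this predictive procedure is invariant under $G_{\mathcal N}$.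
   Context: $G_{\mathcal N}$ is the group of pairs $(V,\mathbf{m})$ with $V\in\mathbb{R}^{d\times d}$ upper triangular with positive diagonal and $\mathbf{m}\in\mathbb{R}^d$, with operation $(V_2,\mathbf{m}_2)\cdot(V_1,\mathbf{m}_1)=(V_2V_1,V_2\mathbf{m}_1+\mathbf{m}_2)$. It acts on $\mathbb{R}^d$ by $(V,\mathbf{m})\cdot\mathbf{y}=V\mathbf{y}+\mathbf{m}$ and element-wise on $(\mathbb{R}^d)^n$ and $(\mathbb{R}^d)^m$. A predictive procedure is a (measurable) function $q$ assigning to each $\mathbf{y}_{1:n}\in(\mathbb{R}^d)^n$ a probability measure $q(\cdot\,;\mathbf{y}_{1:n})$ on $(\mathbb{R}^d)^m$; it may be defined for almost every $\mathbf{y}_{1:n}$ only. In the objective, $\log q(\mathbf{y}^*_{1:m};\mathbf{y}_{1:n})$ refers to its density, and the negative of the expectation is the expected KL divergence $\mathbb{E}_{\mathbf{y}_{1:n}\sim p(\cdot\mid\theta^* )}[D_{KL}(p(\cdot\mid\mathbf{y}_{1:n},\theta^* )\parallel q(\cdot\,;\mathbf{y}_{1:n}))]$, where $D_{KL}(\mu\parallel\nu)=-\int\log(d\nu/d\mu)\,d\mu$ if $\nu\ll\mu$ and $\infty$ otherwise. The procedure $q$ is invariant under $G_{\mathcal N}$ if $q(A;\mathbf{y}_{1:n})=q(gA;g\mathbf{y}_{1:n})$ for all $g\in G_{\mathcal N}$, all $\mathbf{y}_{1:n}$ and all Borel $A$. The posterior predictive with prior $\mu_R$ has Lebesgue density in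 $\mathbf{y}^*_{1:m}$ proportional to $\int_\Theta p(\mathbf{y}^*_{1:m}\mid\theta)\,p(\mathbf{y}_{1:n}\mid\theta)\,d\mu_R(\theta)$. *)

theory Defs
  imports "HOL-Probability.Probability" "HOL-Algebra.Group"
begin

section \<open>Extended-real integrals and the Kullback--Leibler divergence\<close>

definition ext_ln :: "ennreal \<Rightarrow> ereal" where
  "ext_ln x = (if x = 0 then -\<infinity> else if x = \<infinity> then \<infinity> else ereal (ln (enn2real x)))"

text \<open>
  \<^const>\<open>e2ennreal\<close> truncates negative arguments to 0, so the two terms are the integrals of the
  positive and of the negative part. (The Bochner integral would return 0 for
  non-integrable functions.)
\<close>

definition ext_integral :: "'a measure \<Rightarrow> ('a \<Rightarrow> ereal) \<Rightarrow> ereal" where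
  "ext_integral M f =
     enn2ereal (\<integral>\<^sup>+ x. e2ennreal (f x) \<partial>M) - enn2ereal (\<integral>\<^sup>+ x. e2ennreal (- f x) \<partial>M)"

text \<open>
  \<^term>\<open>absolutely_continuous \<mu> \<nu>\<close> says that \<open>\<nu>\<close> is absolutely continuous with respect to \<open>\<mu>\<close>, and
  \<^term>\<open>RN_deriv \<mu> \<nu>\<close> is the density of \<open>\<nu>\<close> with respect to \<open>\<mu>\<close>. The integral is well defined
  for probability measures, since the positive part of the logarithm is then integrable.
\<close>

definition KL :: "'a measure \<Rightarrow> 'a measure \<Rightarrow> ereal" where
  "KL \<mu> \<nu> = (if absolutely_continuous \<mu> \<nu>
             then - ext_integral \<mu> (\<lambda>x. ext_ln (RN_deriv \<mu> \<nu> x)) else \<infinity>)"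


section \<open>The parameter space and the group\<close>

text \<open>
  Coordinates are indexed by a finite well-ordered type \<^typ>\<open>'d\<close> with \<open>CARD('d) = d\<close>, standing for
  \<open>{1..d}\<close>; the coordinate \<open>i\<close> corresponds to the number \<^term>\<open>card {..i}\<close>. The types \<^typ>\<open>'n\<close> and
  \<^typ>\<open>'m\<close> index the observed and the future data points; a sample is a vector whose entries
  are the data points.
\<close>

type_synonym 'd affine = "(real^'d^'d) \<times> (real^'d)"

definition Theta :: "('d::{finite,wellorder} affine) set" where
  "Theta = {(U, \<mu>). (\<forall>i j. j < i \<longrightarrow> U $ i $ j = 0) \<and> (\<forall>i. 0 < U $ i $ i)}"

definition G_N :: "('d::{finite,wellorder} affine) monoid" where
  "G_N = \<lparr>carrier = Theta,
          monoid.mult = (\<lambda>(V2, m2) (V1, m1). (V2 ** V1, V2 *v m1 + m2)),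
          one = (mat 1, 0)\<rparr>"

definition act :: "'d::finite affine \<Rightarrow> real^'d \<Rightarrow> real^'d" where
  "act g y = fst g *v y + snd g"

definition act_all :: "'d::finite affine \<Rightarrow> real^'d^'k \<Rightarrow> real^'d^'k" where
  "act_all g ys = (\<chi> i. act g (ys $ i))"


section \<open>The multivariate normal model\<close>

definition mvn_density :: "real^'d \<Rightarrow> real^'d^'d \<Rightarrow> real^'d \<Rightarrow> real" where
  "mvn_density \<mu> \<Sigma> y =
     exp (- (1/2) * ((y - \<mu>) \<bullet> (matrix_inv \<Sigma> *v (y - \<mu>)))) / sqrt ((2 * pi) ^ CARD('d) * det \<Sigma>)"

definition iid_density :: "'d::finite affine \<Rightarrow> real^'d^'k \<Rightarrow> real" where
  "iid_density \<theta> ys = (\<Prod>i\<in>UNIV. mvn_density (snd \<theta>) (fst \<theta> ** transpose (fst \<theta>)) (ys $ i))"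

definition joint_density ::
  "'d::finite affine \<Rightarrow> real^'d^'n \<Rightarrow> real^'d^'m \<Rightarrow> real" where
  "joint_density \<theta> y ys = iid_density \<theta> y * iid_density \<theta> ys"

definition cond_density ::
  "'d::finite affine \<Rightarrow> real^'d^'n \<Rightarrow> real^'d^'m \<Rightarrow> real" where
  "cond_density \<theta> y ys = joint_density \<theta> y ys / iid_density \<theta> y"

definition data_law :: "'d::finite affine \<Rightarrow> (real^'d^'n) measure" where
  "data_law \<theta> = density lborel (\<lambda>y. ennreal (iid_density \<theta> y))"

definition cond_law ::
  "'d::finite affine \<Rightarrow> real^'d^'n \<Rightarrow> (real^'d^'m) measure" where
  "cond_law \<theta> y = density lborel (\<lambda>ys. ennreal (cond_density \<theta> y ys))"


section \<open>Predictive procedures\<close>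

text \<open>
  \<^term>\<open>None\<close> means ``undefined''. A predictive procedure is a Markov kernel that is defined for
  Lebesgue-almost every value of the observed data.
\<close>

type_synonym ('d, 'n, 'm) procedure = "real^'d^'n \<Rightarrow> (real^'d^'m) measure option"

definition predictive_procedure :: "('d::finite, 'n::finite, 'm::finite) procedure \<Rightarrow> bool" where
  "predictive_procedure q \<longleftrightarrow>
     (AE y in lborel. y \<in> dom q) \<and>
     (\<lambda>y. the (q y)) \<in> restrict_space borel (dom q) \<rightarrow>\<^sub>M prob_algebra borel"

definition invariant_procedure :: "('d::{finite,wellorder}, 'n::finite, 'm::finite) procedure \<Rightarrow> bool" where
  "invariant_procedure q \<longleftrightarrow>
     (\<forall>g\<in>carrier G_N. \<forall>y\<in>dom q. act_all g y \<in> dom q \<and>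
        (\<forall>A\<in>sets borel. emeasure (the (q y)) A =
                          emeasure (the (q (act_all g y))) (act_all g ` A)))"

text \<open>
  The expectation of \<open>log q(y*; y) - log p(y* | y, \<theta>)\<close>, understood as the negative of the expected
  divergence of \<open>q(\<cdot>; y)\<close> from \<open>p(\<cdot> | y, \<theta>)\<close>. The value of \<open>the (q y)\<close> outside \<open>dom q\<close> is
  immaterial, because the law of the data is absolutely continuous.
\<close>

definition expected_log_ratio ::
  "('d::finite, 'n::finite, 'm::finite) procedure \<Rightarrow> 'd::finite affine \<Rightarrow> ereal" where
  "expected_log_ratio q \<theta> = ext_integral (data_law \<theta>) (\<lambda>y. - KL (cond_law \<theta> y) (the (q y)))"

definition worst_case :: "('d::{finite,wellorder}, 'n::finite, 'm::finite) procedure \<Rightarrow> ereal" where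
  "worst_case q = (INF \<theta>\<in>Theta. expected_log_ratio q \<theta>)"

definition optimal_procedure :: "('d::{finite,wellorder}, 'n::finite, 'm::finite) procedure \<Rightarrow> bool" where
  "optimal_procedure q \<longleftrightarrow> is_arg_max worst_case predictive_procedure q"


section \<open>The prior and the posterior predictive distribution\<close>

text \<open>
  The measure \<open>dU\<^sub>1\<^sub>1 dU\<^sub>1\<^sub>2 \<dots> dU\<^sub>d\<^sub>d\<close>: product Lebesgue measure over the entries on and above the
  diagonal, transported to matrices by filling in zeros below the diagonal.
\<close>

definition upper_lborel :: "(real^'d::{finite,wellorder}^'d::{finite,wellorder}) measure" where
  "upper_lborel =
     distr (\<Pi>\<^sub>M p\<in>{(i, j). i \<le> j}. lborel) borel
       (\<lambda>u. \<chi> i j. if i \<le> j then u (i, j) else 0)"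

text \<open>
  The prior is only specified up to a constant, which is the parameter \<open>c\<close>.
\<close>

definition prior :: "real \<Rightarrow> ('d::{finite,wellorder} affine) measure" where
  "prior c = density (upper_lborel \<Otimes>\<^sub>M lborel)
     (\<lambda>\<theta>. ennreal (c * indicator Theta \<theta> *
            (\<Prod>i\<in>UNIV. (fst \<theta> $ i $ i) powr (- real (card {..i})))))"

definition predictive_weight ::
  "real \<Rightarrow> real^'d::{finite,wellorder}^'n \<Rightarrow> real^'d::{finite,wellorder}^'m \<Rightarrow> ennreal" where
  "predictive_weight c y ys =
     (\<integral>\<^sup>+ \<theta>. ennreal (iid_density \<theta> ys * iid_density \<theta> y) \<partial>prior c)"

text \<open>
  The posterior predictive is undefined where the weight cannot be normalised (for example when
  all observations coincide).
\<close>

definition posterior_predictive :: "real \<Rightarrow> ('d::{finite,wellorder}, 'n::finite, 'm::finite) procedure" where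
  "posterior_predictive c y =
     (let Z = (\<integral>\<^sup>+ ys. predictive_weight c y ys \<partial>(lborel :: (real^'d::{finite,wellorder}^'m) measure))
      in if 0 < Z \<and> Z < \<infinity> then Some (density lborel (\<lambda>ys. predictive_weight c y ys / Z))
         else None)"

end

theory Submission
  imports Defs
begin

text \<open>
  Write \<open>p\<^sub>\<theta>\<close> for the density of a sample, \<open>\<mu>\<close> for the prior, \<open>Z(y) = \<integral> p\<^sub>\<theta>(y) d\<mu>(\<theta>)\<close> for the evidence
  and \<open>W(y, y') = \<integral> p\<^sub>\<theta>(y) p\<^sub>\<theta>(y') d\<mu>(\<theta>)\<close>, so that the posterior predictive distribution \<open>q'\<close> has
  the density \<open>W / Z\<close>. The parameter set is a group that acts on the samples, and \<open>p\<^sub>\<theta>\<close> is the law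
  of \<open>\<theta> z\<close> for a standard normal sample \<open>z\<close>.

  \<^bold>\<open>Invariance.\<close> Left translations are linear on the space of upper triangular affine maps, so they
  multiply \<open>\<mu>\<close> by constants (\<open>prior_left_mult\<close>). The constants cancel in \<open>W / Z\<close>; hence \<open>q'\<close> is
  invariant and has the same risk \<open>R\<close> at every parameter.

  \<^bold>\<open>Lower bound.\<close> Let \<open>q\<close> be a procedure whose risk is at most \<open>\<rho>\<close> everywhere, and let \<open>F\<close> be a set of
  parameters with \<open>0 < \<mu>(F) < \<infinity>\<close>. Gibbs' variational inequality
  \<open>KL(P, Q) \<ge> \<integral> ln E dP + 1 - \<integral> E dQ\<close> (\<open>KL_variational\<close>) is applied to \<open>P = p\<^sub>\<theta>\<close>, \<open>Q = q(y)\<close> and the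
  density ratio \<open>E\<close> of \<open>p\<^sub>\<theta>\<close> and \<open>q'(y)\<close>, and averaged over \<open>\<theta>\<close> uniform on \<open>F\<close> and \<open>y\<close> drawn from \<open>p\<^sub>\<theta>\<close>,
  with the posterior probability \<open>v(y)\<close> of \<open>F\<close> given \<open>y\<close> as an additional weight. Whatever \<open>q\<close> is, the
  average of \<open>\<integral> E dQ\<close> is at most 1, because integrating \<open>p\<^sub>\<theta>(y) p\<^sub>\<theta>(y')\<close> over \<open>\<theta>\<close> gives \<open>W\<close>, which \<open>E\<close>
  divides out. So the average of \<open>v (KL(p\<^sub>\<theta>, q'(y)) + 1)\<close> is at most \<open>\<rho> + 1\<close> (\<open>bayes_risk_bound\<close>). In the
  coordinates \<open>y = \<theta> z\<close> the divergence depends on \<open>z\<close> only, and \<open>v\<close> becomes the probability that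
  \<open>\<theta> k \<in> F\<close> for a parameter \<open>k\<close> drawn from the posterior given \<open>z\<close>. The left-hand side is therefore the
  expectation of \<open>(KL + 1) \<cdot> \<mu>{\<theta> \<in> F. \<theta> k \<in> F} / \<mu>(F)\<close> over \<open>z\<close> and \<open>k\<close> (\<open>bayes_risk_bound_orbit\<close>).

  \<^bold>\<open>Foelner sets.\<close> The measure \<open>\<mu>\<close> is a right Haar measure of a solvable, hence amenable group: there
  are boxes \<open>F\<^sub>N\<close> for which the last ratio tends to 1 for every fixed \<open>k\<close> (\<open>foelner_limit\<close>). Fatou's
  lemma turns the bounds for \<open>F\<^sub>N\<close> into \<open>R + 1 \<le> \<rho> + 1\<close>.

  \<^bold>\<open>Existence.\<close> It remains to see that \<open>Z\<close> is finite almost everywhere if there are more than \<open>d\<close>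
  observations. Let \<open>S\<close> be a bounded set of samples whose first \<open>d + 1\<close> points span a simplex of volume
  bounded below, and let \<open>I(y) = \<mu>{\<theta>. \<theta> y \<in> S}\<close>, which is finite for samples in general position. Right
  translations do not decrease \<open>\<mu>\<close>, so \<open>I(\<theta> z) \<ge> I(z)\<close>, and therefore
  \<open>\<integral>\<^sub>S Z / (I + 1) \<le> \<integral> p\<^sub>1(z) I(z) / (I(z) + 1) dz \<le> 1\<close> (\<open>AE_evidence_finite\<close>).
\<close>

section \<open>Translation invariant measures on a subspace\<close>

text \<open>
  Lebesgue measure on a linear subspace \<open>W\<close>, described by its invariance. Both Lebesgue measure on
  samples and \<open>dU d\<mu>\<close> on the parameters have this form; the latter lives on a space of matrices in
  which the upper triangular ones form a proper subspace.
\<close>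

locale subspace_lebesgue =
  fixes W :: "'a::euclidean_space set" and M :: "'a measure"
  assumes sets_eq [measurable_cong]: "sets M = sets borel"
    and subspace: "subspace W"
    and AE_subspace: "AE x in M. x \<in> W"
    and translate: "\<And>w f. w \<in> W \<Longrightarrow> f \<in> borel_measurable borel \<Longrightarrow>
          (\<integral>\<^sup>+x. f (x + w) \<partial>M) = (\<integral>\<^sup>+x. f x \<partial>M)"
    and reflect: "\<And>f. f \<in> borel_measurable borel \<Longrightarrow> (\<integral>\<^sup>+x. f (- x) \<partial>M) = (\<integral>\<^sup>+x. f x \<partial>M)"
    and finite_ball: "\<And>r. emeasure M (ball 0 r) < \<infinity>"
    and pos_ball: "\<And>r. 0 < r \<Longrightarrow> 0 < emeasure M (ball 0 r)"
begin

lemma space_eq [simp]: "space M = UNIV"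
  using sets_eq_imp_space_eq[OF sets_eq] by simp

lemma sigma_finite: "sigma_finite_measure M"
proof
  have "(\<Union>n. ball 0 (real n)) = (UNIV :: 'a set)"
    using reals_Archimedean2 by (auto simp: dist_norm)
  then show "\<exists>A. countable A \<and> A \<subseteq> sets M \<and> \<Union>A = space M \<and> (\<forall>a\<in>A. emeasure M a \<noteq> \<infinity>)"
    using finite_ball by (intro exI[of _ "range (\<lambda>n. ball 0 (real n))"]) (auto simp: sets_eq less_top)
qed

text \<open>
  Uniqueness of Haar measure, in the form that is needed here: a linear automorphism scales the
  measure. With an auxiliary function \<open>h\<close>, the integral of \<open>f (T x) * h y\<close> over both variables becomes
  that of \<open>f y * h (T x)\<close> after a translation of \<open>y\<close> by \<open>T x\<close>, one of \<open>x\<close>, and a reflection. This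
  avoids determinants, which are awkward on a subspace of matrices.
\<close>

lemma linear_scaling:
  assumes T: "linear T" "inj T" "T ` W \<subseteq> W"
  obtains C where "0 < C" "C < \<infinity>"
    "\<And>f. f \<in> borel_measurable borel \<Longrightarrow> (\<integral>\<^sup>+x. f (T x) \<partial>M) = C * (\<integral>\<^sup>+x. f x \<partial>M)"
proof -
  interpret sigma_finite_measure M by (rule sigma_finite)
  interpret MM: pair_sigma_finite M M ..
  have Tm [measurable]: "T \<in> borel_measurable borel"
    using T(1) by (simp add: borel_measurable_continuous_onI linear_continuous_on linear_conv_bounded_linear)
  have TW: "T ` W = W"
  proof (rule subspace_dim_equal)
    show "subspace (T ` W)" by (rule linear_subspace_image[OF T(1) subspace])
    show "dim W \<le> dim (T ` W)"
      using dim_image_eq[OF T(1) inj_on_subset[OF T(2)]] by simp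
  qed (use subspace T in auto)
  define h :: "'a \<Rightarrow> ennreal" where "h = indicator (ball 0 1)"
  have hm [measurable]: "h \<in> borel_measurable borel" unfolding h_def by (simp add: borel_measurable_indicator)
  have Mh: "(\<integral>\<^sup>+x. h x \<partial>M) = emeasure M (ball 0 1)" unfolding h_def by (simp add: sets_eq)
  define \<nu> where "\<nu> = (\<integral>\<^sup>+x. h (T x) \<partial>M)"
  have \<nu>: "\<nu> = emeasure M {x. norm (T x) < 1}"
  proof -
    have "\<nu> = (\<integral>\<^sup>+x. indicator {x. norm (T x) < 1} x \<partial>M)"
      unfolding \<nu>_def h_def by (intro nn_integral_cong) (auto simp: indicator_def)
    then show ?thesis by (subst (asm) nn_integral_indicator) (auto simp: sets_eq)
  qed
  obtain b where b: "b > 0" "\<And>x. b * norm x \<le> norm (T x)"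
    using linear_inj_bounded_below_pos[OF T(1,2)] by blast
  obtain B where B: "B > 0" "\<And>x. norm (T x) \<le> B * norm x"
    using linear_bounded_pos[OF T(1)] by (auto simp: mult.commute)
  have "\<nu> \<le> emeasure M (ball 0 (1 / b))"
    unfolding \<nu>
  proof (rule emeasure_mono)
    show "{x. norm (T x) < 1} \<subseteq> ball 0 (1 / b)"
    proof
      fix x assume "x \<in> {x. norm (T x) < 1}"
      then have "b * norm x < 1" using b(2)[of x] by simp
      then show "x \<in> ball 0 (1 / b)" using b(1) by (simp add: field_simps)
    qed
  qed (simp add: sets_eq)
  then have \<nu>_fin: "\<nu> < \<infinity>" using finite_ball[of "1 / b"] by (auto intro: le_less_trans)
  have "emeasure M (ball 0 (1 / B)) \<le> \<nu>"
    unfolding \<nu>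
  proof (rule emeasure_mono)
    show "ball 0 (1 / B) \<subseteq> {x. norm (T x) < 1}"
    proof
      fix x :: 'a assume "x \<in> ball 0 (1 / B)"
      then have "B * norm x < 1" using B(1) by (simp add: field_simps)
      then show "x \<in> {x. norm (T x) < 1}" using B(2)[of x] by simp
    qed
  qed (simp add: sets_eq)
  then have \<nu>_pos: "0 < \<nu>" using pos_ball[of "1 / B"] B(1) by (auto intro: less_le_trans)
  have key: "(\<integral>\<^sup>+x. f (T x) \<partial>M) * emeasure M (ball 0 1) = \<nu> * (\<integral>\<^sup>+x. f x \<partial>M)"
    if f [measurable]: "f \<in> borel_measurable borel" for f
  proof -
    have "(\<integral>\<^sup>+x. f (T x) \<partial>M) * emeasure M (ball 0 1) = (\<integral>\<^sup>+x. (\<integral>\<^sup>+y. f (T x) * h y \<partial>M) \<partial>M)"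
      by (simp add: Mh[symmetric] nn_integral_cmult nn_integral_multc)
    also have "\<dots> = (\<integral>\<^sup>+x. (\<integral>\<^sup>+y. f (T x) * h (y + T x) \<partial>M) \<partial>M)"
    proof (rule nn_integral_cong_AE)
      show "AE x in M. (\<integral>\<^sup>+y. f (T x) * h y \<partial>M) = (\<integral>\<^sup>+y. f (T x) * h (y + T x) \<partial>M)"
        using AE_subspace
      proof eventually_elim
        case (elim x)
        then have "T x \<in> W" using T by auto
        from translate[OF this, of "\<lambda>y. f (T x) * h y"] show ?case by simp
      qed
    qed
    also have "\<dots> = (\<integral>\<^sup>+y. (\<integral>\<^sup>+x. f (T x) * h (y + T x) \<partial>M) \<partial>M)"
      by (subst MM.Fubini') simp_all
    also have "\<dots> = (\<integral>\<^sup>+y. (\<integral>\<^sup>+x. f (T x - y) * h (T x) \<partial>M) \<partial>M)"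
    proof (rule nn_integral_cong_AE)
      show "AE y in M. (\<integral>\<^sup>+x. f (T x) * h (y + T x) \<partial>M) = (\<integral>\<^sup>+x. f (T x - y) * h (T x) \<partial>M)"
        using AE_subspace
      proof eventually_elim
        case (elim y)
        then obtain w where w: "w \<in> W" "y = T w" using TW by auto
        from translate[OF w(1), of "\<lambda>x. f (T x - y) * h (T x)"] show ?case
          by (simp add: linear_add[OF T(1)] w(2) add.commute)
      qed
    qed
    also have "\<dots> = (\<integral>\<^sup>+x. (\<integral>\<^sup>+y. f (T x - y) * h (T x) \<partial>M) \<partial>M)"
      by (subst MM.Fubini') simp_all
    also have "\<dots> = (\<integral>\<^sup>+x. (\<integral>\<^sup>+y. f y * h (T x) \<partial>M) \<partial>M)"
    proof (rule nn_integral_cong_AE)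
      show "AE x in M. (\<integral>\<^sup>+y. f (T x - y) * h (T x) \<partial>M) = (\<integral>\<^sup>+y. f y * h (T x) \<partial>M)"
        using AE_subspace
      proof eventually_elim
        case (elim x)
        then have "T x \<in> W" using T by auto
        from translate[OF this, of "\<lambda>y. f y * h (T x)"]
          reflect[of "\<lambda>y. f (y + T x) * h (T x)"] show ?case by simp
      qed
    qed
    also have "\<dots> = \<nu> * (\<integral>\<^sup>+x. f x \<partial>M)"
      by (simp add: nn_integral_multc nn_integral_cmult \<nu>_def mult.commute)
    finally show ?thesis .
  qed
  define C where "C = \<nu> / emeasure M (ball 0 1)"
  have m: "0 < emeasure M (ball 0 1)" "emeasure M (ball 0 1) < \<infinity>"
    using pos_ball[of 1] finite_ball[of 1] by auto
  show thesis
  proof (rule that)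
    show "0 < C" using \<nu>_pos m unfolding C_def by (auto simp: ennreal_zero_less_divide)
    show "C < \<infinity>" using \<nu>_fin m unfolding C_def by (auto simp: ennreal_divide_eq_top_iff less_top[symmetric])
    fix f :: "'a \<Rightarrow> ennreal" assume "f \<in> borel_measurable borel"
    from key[OF this]
    have "(\<integral>\<^sup>+x. f (T x) \<partial>M) * emeasure M (ball 0 1) / emeasure M (ball 0 1) =
      \<nu> * (\<integral>\<^sup>+x. f x \<partial>M) / emeasure M (ball 0 1)" by simp
    then show "(\<integral>\<^sup>+x. f (T x) \<partial>M) = C * (\<integral>\<^sup>+x. f x \<partial>M)"
      using m by (subst (asm) ennreal_mult_divide_eq) (auto simp: C_def ennreal_times_divide mult.commute)
  qed
qed

end

lemma subspace_lebesgue_lborel: "subspace_lebesgue UNIV (lborel :: 'a::euclidean_space measure)"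
proof
  fix w :: 'a and f :: "'a \<Rightarrow> ennreal"
  assume [measurable]: "f \<in> borel_measurable borel"
  have "(\<integral>\<^sup>+x. f x \<partial>lborel) = (\<integral>\<^sup>+x. f x \<partial>distr lborel borel ((+) w))"
    by (simp add: lborel_distr_plus)
  also have "\<dots> = (\<integral>\<^sup>+x. f (x + w) \<partial>lborel)"
    by (subst nn_integral_distr) (auto simp: add.commute)
  finally show "(\<integral>\<^sup>+x. f (x + w) \<partial>lborel) = (\<integral>\<^sup>+x. f x \<partial>lborel)" ..
next
  fix f :: "'a \<Rightarrow> ennreal"
  assume [measurable]: "f \<in> borel_measurable borel"
  have "(\<integral>\<^sup>+x. f x \<partial>lborel) = (\<integral>\<^sup>+x. f (- x) \<partial>lborel)"
    by (subst lborel_affine[of "-1" 0]) (auto simp: nn_integral_density nn_integral_distr)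
  then show "(\<integral>\<^sup>+x. f (- x) \<partial>lborel) = (\<integral>\<^sup>+x. f x \<partial>lborel)" ..
next
  fix r :: real
  show "emeasure lborel (ball (0::'a) r) < \<infinity>"
    using emeasure_lborel_ball_finite by auto
  assume "0 < r"
  have "0 < measure lborel (ball (0::'a) r)"
    by (rule content_ball_pos[OF \<open>0 < r\<close>])
  then show "0 < emeasure lborel (ball (0::'a) r)"
    unfolding measure_def by (simp add: enn2real_positive_iff)
qed auto

lemma subspace_lebesgue_pair:
  assumes "subspace_lebesgue W M" "subspace_lebesgue W' M'"
  shows "subspace_lebesgue (W \<times> W') (M \<Otimes>\<^sub>M M')"
proof -
  interpret A: subspace_lebesgue W M by fact
  interpret B: subspace_lebesgue W' M' by fact
  interpret A': sigma_finite_measure M by (rule A.sigma_finite)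
  interpret B': sigma_finite_measure M' by (rule B.sigma_finite)
  interpret AB: pair_sigma_finite M M' ..
  have sets: "sets (M \<Otimes>\<^sub>M M') = sets borel"
    using sets_pair_measure_cong[OF A.sets_eq B.sets_eq] by (metis borel_prod)
  have pair_borel: "f \<in> borel_measurable (borel \<Otimes>\<^sub>M borel)" if "f \<in> borel_measurable borel"
    for f :: "'a \<times> 'b \<Rightarrow> ennreal"
    using that by (subst borel_prod)
  have Wm [measurable]: "W \<in> sets borel" "W' \<in> sets borel"
    using closed_subspace[OF A.subspace] closed_subspace[OF B.subspace] by auto
  show ?thesis
  proof
    show "sets (M \<Otimes>\<^sub>M M') = sets borel" by (rule sets)
    show "subspace (W \<times> W')" by (rule subspace_Times[OF A.subspace B.subspace])
    show "AE x in M \<Otimes>\<^sub>M M'. x \<in> W \<times> W'"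
    proof (rule AB.AE_pair_measure[where P = "\<lambda>x. x \<in> W \<times> W'"])
      have "W \<times> W' \<in> sets (M \<Otimes>\<^sub>M M')" by (intro pair_measureI) (auto simp: A.sets_eq B.sets_eq)
      then show "{x \<in> space (M \<Otimes>\<^sub>M M'). x \<in> W \<times> W'} \<in> sets (M \<Otimes>\<^sub>M M')"
        by (metis Collect_mem_eq Int_def sets.Int_space_eq1)
      show "AE x in M. AE y in M'. (x, y) \<in> W \<times> W'"
        using A.AE_subspace B.AE_subspace by auto
    qed
    fix w and f :: "'a \<times> 'b \<Rightarrow> ennreal" assume w: "w \<in> W \<times> W'" and f: "f \<in> borel_measurable borel"
    note fm [measurable] = pair_borel[OF f]
    obtain w1 w2 where w': "w = (w1, w2)" "w1 \<in> W" "w2 \<in> W'" using w by auto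
    have "(\<integral>\<^sup>+x. f (x + w) \<partial>(M \<Otimes>\<^sub>M M')) = (\<integral>\<^sup>+x. (\<integral>\<^sup>+y. f ((x, y) + w) \<partial>M') \<partial>M)"
      using B'.nn_integral_fst[of "\<lambda>(x, y). f (x + w1, y + w2)" M]
      by (simp add: w' case_prod_beta' plus_prod_def)
    also have "\<dots> = (\<integral>\<^sup>+x. (\<integral>\<^sup>+y. f (x + w1, y) \<partial>M') \<partial>M)"
    proof (rule nn_integral_cong)
      fix x show "(\<integral>\<^sup>+y. f ((x, y) + w) \<partial>M') = (\<integral>\<^sup>+y. f (x + w1, y) \<partial>M')"
        using B.translate[OF w'(3), of "\<lambda>y. f (x + w1, y)"] by (simp add: w')
    qed
    also have "\<dots> = (\<integral>\<^sup>+x. (\<integral>\<^sup>+y. f (x, y) \<partial>M') \<partial>M)"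
      using A.translate[OF w'(2), of "\<lambda>x. \<integral>\<^sup>+y. f (x, y) \<partial>M'"] by simp
    also have "\<dots> = (\<integral>\<^sup>+x. f x \<partial>(M \<Otimes>\<^sub>M M'))" by (rule B'.nn_integral_fst) simp
    finally show "(\<integral>\<^sup>+x. f (x + w) \<partial>(M \<Otimes>\<^sub>M M')) = (\<integral>\<^sup>+x. f x \<partial>(M \<Otimes>\<^sub>M M'))" .
  next
    fix f :: "'a \<times> 'b \<Rightarrow> ennreal" assume f: "f \<in> borel_measurable borel"
    note fm [measurable] = pair_borel[OF f]
    have "(\<integral>\<^sup>+x. f (- x) \<partial>(M \<Otimes>\<^sub>M M')) = (\<integral>\<^sup>+x. (\<integral>\<^sup>+y. f (- x, - y) \<partial>M') \<partial>M)"
      using B'.nn_integral_fst[of "\<lambda>(x, y). f (- x, - y)" M]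
      by (simp add: case_prod_beta' uminus_prod_def)
    also have "\<dots> = (\<integral>\<^sup>+x. (\<integral>\<^sup>+y. f (- x, y) \<partial>M') \<partial>M)"
      by (intro nn_integral_cong B.reflect[where f = "\<lambda>y. f (- x, y)" for x]) simp
    also have "\<dots> = (\<integral>\<^sup>+x. (\<integral>\<^sup>+y. f (x, y) \<partial>M') \<partial>M)"
      using A.reflect[of "\<lambda>x. \<integral>\<^sup>+y. f (x, y) \<partial>M'"] by simp
    also have "\<dots> = (\<integral>\<^sup>+x. f x \<partial>(M \<Otimes>\<^sub>M M'))" by (rule B'.nn_integral_fst) simp
    finally show "(\<integral>\<^sup>+x. f (- x) \<partial>(M \<Otimes>\<^sub>M M')) = (\<integral>\<^sup>+x. f x \<partial>(M \<Otimes>\<^sub>M M'))" .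
  next
    fix r :: real
    have box: "emeasure (M \<Otimes>\<^sub>M M') (ball 0 s \<times> ball 0 s) = emeasure M (ball 0 s) * emeasure M' (ball 0 s)" for s
      by (rule B'.emeasure_pair_measure_Times) (auto simp: A.sets_eq B.sets_eq)
    have "ball (0::'a\<times>'b) r \<subseteq> ball 0 r \<times> ball 0 r"
    proof
      fix x assume "x \<in> ball (0::'a\<times>'b) r"
      then show "x \<in> ball 0 r \<times> ball 0 r"
        using norm_fst_le[of "fst x" "snd x"] norm_snd_le[of "snd x" "fst x"]
        by (cases x) (auto intro: le_less_trans)
    qed
    then have "emeasure (M \<Otimes>\<^sub>M M') (ball 0 r) \<le> emeasure (M \<Otimes>\<^sub>M M') (ball 0 r \<times> ball 0 r)"
      by (intro emeasure_mono) (auto simp: A.sets_eq B.sets_eq)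
    also have "\<dots> < \<infinity>" unfolding box using A.finite_ball[of r] B.finite_ball[of r]
      by (simp add: ennreal_mult_less_top)
    finally show "emeasure (M \<Otimes>\<^sub>M M') (ball 0 r) < \<infinity>" .
    assume r: "0 < r"
    have "ball 0 (r/2) \<times> ball 0 (r/2) \<subseteq> ball (0::'a\<times>'b) r"
    proof
      fix x assume "x \<in> ball (0::'a) (r/2) \<times> ball (0::'b) (r/2)"
      then have "norm (fst x) < r/2" "norm (snd x) < r/2" by auto
      then show "x \<in> ball 0 r" using norm_Pair_le[of "fst x" "snd x"] by (simp add: norm_Pair)
    qed
    then have "emeasure (M \<Otimes>\<^sub>M M') (ball 0 (r/2) \<times> ball 0 (r/2)) \<le> emeasure (M \<Otimes>\<^sub>M M') (ball 0 r)"
      by (intro emeasure_mono) (auto simp: sets)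
    moreover have "0 < emeasure (M \<Otimes>\<^sub>M M') (ball 0 (r/2) \<times> ball 0 (r/2))"
      unfolding box using A.pos_ball[of "r/2"] B.pos_ball[of "r/2"] r by (simp add: ennreal_zero_less_mult_iff)
    ultimately show "0 < emeasure (M \<Otimes>\<^sub>M M') (ball 0 r)" by (rule less_le_trans[rotated])
  qed
qed

lemma borel_measurable_vec_lambda [measurable (raw)]:
  fixes f :: "'x \<Rightarrow> 'n::finite \<Rightarrow> 'a::euclidean_space"
  assumes "\<And>i. (\<lambda>x. f x i) \<in> borel_measurable M"
  shows "(\<lambda>x. \<chi> i. f x i) \<in> borel_measurable M"
  using assms by (subst borel_measurable_euclidean_space) (auto simp: Basis_vec_def inner_axis)

lemma borel_measurable_vec_nth [measurable (raw)]:
  fixes f :: "'x \<Rightarrow> 'a::euclidean_space^'n"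
  assumes "f \<in> borel_measurable M"
  shows "(\<lambda>x. f x $ i) \<in> borel_measurable M"
  by (rule borel_measurable_continuous_on[OF _ assms]) (intro continuous_intros)

text \<open>
  A vector of vectors carries the product of the Lebesgue measures of its entries. This makes
  independent data points factor out of integrals.
\<close>

lemma lborel_vec:
  "(lborel :: ('a::euclidean_space^'n::finite) measure) = distr (\<Pi>\<^sub>M i\<in>UNIV. lborel) borel (\<lambda>u. \<chi> i. u i)"
proof (rule lborel_eqI)
  fix l u :: "'a^'n" assume le: "\<And>b. b \<in> Basis \<Longrightarrow> l \<bullet> b \<le> u \<bullet> b"
  have le': "(l $ i) \<bullet> b \<le> (u $ i) \<bullet> b" if "b \<in> Basis" for i b
    using le[of "axis i b"] that by (auto simp: Basis_vec_def inner_axis)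
  interpret product_sigma_finite "\<lambda>_::'n. lborel :: 'a measure" ..
  have box: "(\<lambda>u. \<chi> i. u i) -` box l u \<inter> space (\<Pi>\<^sub>M i\<in>UNIV. lborel) = (\<Pi>\<^sub>E i\<in>UNIV. box (l $ i) (u $ i))"
    by (auto simp: box_def Basis_vec_def inner_axis space_PiM)
  have "(\<Prod>b\<in>(Basis :: ('a^'n) set). (u - l) \<bullet> b) = (\<Prod>(i, b)\<in>UNIV \<times> Basis. (u - l) \<bullet> axis i b)"
  proof (rule prod.reindex_bij_witness[symmetric, where j = "\<lambda>(i, b). axis i b"
        and i = "\<lambda>v. SOME p. snd p \<in> Basis \<and> v = axis (fst p) (snd p)"])
    fix a :: "'n \<times> 'a" assume a: "a \<in> UNIV \<times> Basis"
    show "(SOME p. snd p \<in> Basis \<and> (case a of (i, b) \<Rightarrow> axis i b) = axis (fst p) (snd p)) = a"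
      using a by (intro some_equality) (auto simp: axis_eq_axis)
    show "(case a of (i, b) \<Rightarrow> axis i b) \<in> Basis" using a by (auto simp: Basis_vec_def)
    show "(u - l) \<bullet> (case a of (i, b) \<Rightarrow> axis i b) = (case a of (i, b) \<Rightarrow> (u - l) \<bullet> axis i b)"
      by (auto split: prod.split)
  next
    fix b :: "'a^'n" assume "b \<in> Basis"
    then have ex: "\<exists>p. snd p \<in> Basis \<and> b = axis (fst p) (snd p)" by (auto simp: Basis_vec_def)
    from someI_ex[OF ex] show "(case SOME p. snd p \<in> Basis \<and> b = axis (fst p) (snd p) of (i, b) \<Rightarrow> axis i b) = b"
      by (auto split: prod.split)
    from someI_ex[OF ex] show "(SOME p. snd p \<in> Basis \<and> b = axis (fst p) (snd p)) \<in> UNIV \<times> Basis"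
      by (auto simp: mem_Times_iff)
  qed
  also have "\<dots> = (\<Prod>i\<in>UNIV. \<Prod>b\<in>Basis. (u $ i - l $ i) \<bullet> b)"
    by (subst prod.cartesian_product[symmetric]) (simp add: inner_axis)
  finally have prod: "(\<Prod>b\<in>(Basis :: ('a^'n) set). (u - l) \<bullet> b) = (\<Prod>i\<in>UNIV. \<Prod>b\<in>Basis. (u $ i - l $ i) \<bullet> b)" .
  have "emeasure (distr (\<Pi>\<^sub>M i\<in>UNIV. lborel) borel (\<lambda>u. \<chi> i. u i)) (box l u)
      = emeasure (\<Pi>\<^sub>M i\<in>UNIV. lborel) (\<Pi>\<^sub>E i\<in>UNIV. box (l $ i) (u $ i))"
    by (subst emeasure_distr) (auto simp: box)
  also have "\<dots> = (\<Prod>i\<in>UNIV. emeasure lborel (box (l $ i) (u $ i)))"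
    by (rule emeasure_PiM) auto
  also have "\<dots> = ennreal (\<Prod>i\<in>UNIV. \<Prod>b\<in>Basis. (u $ i - l $ i) \<bullet> b)"
    using le' by (simp add: prod_ennreal emeasure_lborel_box inner_diff_left prod_nonneg)
  also have "\<dots> = (\<Prod>b\<in>Basis. (u - l) \<bullet> b)" by (simp only: prod)
  finally show "emeasure (distr (\<Pi>\<^sub>M i\<in>UNIV. lborel) borel (\<lambda>u. \<chi> i. u i)) (box l u) = (\<Prod>b\<in>Basis. (u - l) \<bullet> b)" .
qed simp

lemma nn_integral_lborel_vec_prod:
  fixes f :: "'n::finite \<Rightarrow> 'a::euclidean_space \<Rightarrow> ennreal"
  assumes [measurable]: "\<And>i. f i \<in> borel_measurable borel"
  shows "(\<integral>\<^sup>+y. (\<Prod>i\<in>UNIV. f i (y $ i)) \<partial>lborel) = (\<Prod>i\<in>UNIV. \<integral>\<^sup>+x. f i x \<partial>lborel)"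
proof -
  interpret product_sigma_finite "\<lambda>_::'n. lborel :: 'a measure" ..
  show ?thesis
    by (subst lborel_vec) (simp add: nn_integral_distr product_nn_integral_prod)
qed

section \<open>Lebesgue measure on vectors and on upper triangular matrices\<close>

text \<open>
  These synonyms leave the sort of the index type open, unlike the notation for real vectors.
\<close>

type_synonym 'd rvec = "(real, 'd) vec"
type_synonym 'd sqmat = "('d rvec, 'd) vec"
type_synonym ('d, 'k) sample = "('d rvec, 'k) vec"

definition upper :: "('d::{finite,wellorder} sqmat) set" where
  "upper = {U. \<forall>i j. j < i \<longrightarrow> U $ i $ j = 0}"

abbreviation upper_pairs :: "('d::{finite,wellorder} \<times> 'd::{finite,wellorder}) set" where
  "upper_pairs \<equiv> {(i, j). i \<le> j}"

definition upper_fill :: "('d::{finite,wellorder} \<times> 'd::{finite,wellorder} \<Rightarrow> real) \<Rightarrow> 'd::{finite,wellorder} sqmat" where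
  "upper_fill u = (\<chi> i j. if i \<le> j then u (i, j) else 0)"

lemma upper_fill_nth: "upper_fill u $ i $ j = (if i \<le> j then u (i, j) else 0)"
  by (simp add: upper_fill_def)

lemma upper_fill_measurable [measurable]: "upper_fill \<in> borel_measurable (\<Pi>\<^sub>M p\<in>upper_pairs. lborel)"
  unfolding upper_fill_def[abs_def]
proof (intro borel_measurable_vec_lambda)
  fix i j :: 'a
  show "(\<lambda>u. if i \<le> j then u (i, j) else 0) \<in> borel_measurable (\<Pi>\<^sub>M p\<in>upper_pairs. lborel)"
    by (cases "i \<le> j") (auto intro: measurable_component_singleton)
qed

lemma upper_lborel_eq: "upper_lborel = distr (\<Pi>\<^sub>M p\<in>upper_pairs. lborel) borel upper_fill"
  unfolding upper_lborel_def upper_fill_def[abs_def] by simp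

lemma nn_integral_upper_lborel:
  "f \<in> borel_measurable borel \<Longrightarrow>
    (\<integral>\<^sup>+U. f U \<partial>upper_lborel) = (\<integral>\<^sup>+u. f (upper_fill u) \<partial>(\<Pi>\<^sub>M p\<in>upper_pairs. lborel))"
  unfolding upper_lborel_eq by (rule nn_integral_distr) auto

lemma affine_preimage_borel:
  fixes s a :: real
  assumes "A \<in> sets borel"
  shows "{x. s * x + a \<in> A} \<in> sets borel"
proof -
  have "(\<lambda>x. s * x + a) -` A \<in> sets borel"
    using assms by (intro measurable_sets_borel[where M = borel]) simp_all
  then show ?thesis by (simp add: vimage_def)
qed

lemma emeasure_real_reflect_translate:
  fixes s a :: real
  assumes s: "\<bar>s\<bar> = 1" and A: "A \<in> sets borel"
  shows "emeasure lborel {x. s * x + a \<in> A} = emeasure lborel A"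
proof -
  have "emeasure lborel A = (\<integral>\<^sup>+x. indicator A x \<partial>lborel)" using A by simp
  also have "\<dots> = (\<integral>\<^sup>+x. indicator A (a + s * x) \<partial>lborel)"
    using A s by (subst nn_integral_real_affine[where c = s and t = a]) auto
  also have "\<dots> = (\<integral>\<^sup>+x. indicator {x. s * x + a \<in> A} x \<partial>lborel)"
    by (intro nn_integral_cong) (auto simp: indicator_def add.commute)
  also have "\<dots> = emeasure lborel {x. s * x + a \<in> A}"
    using A by (intro nn_integral_indicator) (auto intro!: affine_preimage_borel)
  finally show ?thesis ..
qed

lemma PiM_reflect_translate:
  fixes s :: real and a :: "'i \<Rightarrow> real"
  assumes s: "\<bar>s\<bar> = 1" and I: "finite I" and g: "g \<in> borel_measurable (\<Pi>\<^sub>M p\<in>I. lborel)"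
  shows "(\<integral>\<^sup>+u. g (\<lambda>p\<in>I. s * u p + a p) \<partial>(\<Pi>\<^sub>M p\<in>I. lborel)) = (\<integral>\<^sup>+u. g u \<partial>(\<Pi>\<^sub>M p\<in>I. lborel))"
proof -
  interpret product_sigma_finite "\<lambda>_::'i. lborel :: real measure" ..
  let ?P = "\<Pi>\<^sub>M p\<in>I. (lborel :: real measure)"
  let ?T = "\<lambda>u. \<lambda>p\<in>I. s * u p + a p"
  have T [measurable]: "?T \<in> ?P \<rightarrow>\<^sub>M ?P" by measurable
  have "distr ?P ?P ?T = ?P"
  proof (rule PiM_eqI[OF I])
    fix A :: "'i \<Rightarrow> real set" assume A: "\<And>i. i \<in> I \<Longrightarrow> A i \<in> sets lborel"
    have pre: "?T -` (Pi\<^sub>E I A) \<inter> space ?P = (\<Pi>\<^sub>E p\<in>I. {x. s * x + a p \<in> A p})"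
      by (auto simp: space_PiM PiE_def Pi_def)
    have "emeasure (distr ?P ?P ?T) (Pi\<^sub>E I A) = emeasure ?P (\<Pi>\<^sub>E p\<in>I. {x. s * x + a p \<in> A p})"
      using A I by (subst emeasure_distr[OF T]) (auto simp: pre intro!: sets_PiM_I_finite)
    also have "\<dots> = (\<Prod>p\<in>I. emeasure lborel {x. s * x + a p \<in> A p})"
      using A I by (intro emeasure_PiM) (auto intro!: affine_preimage_borel)
    also have "\<dots> = (\<Prod>p\<in>I. emeasure lborel (A p))"
      using A by (intro prod.cong refl emeasure_real_reflect_translate s) auto
    finally show "emeasure (distr ?P ?P ?T) (Pi\<^sub>E I A) = (\<Prod>i\<in>I. emeasure lborel (A i))" .
  qed simp
  then have "(\<integral>\<^sup>+u. g u \<partial>?P) = (\<integral>\<^sup>+u. g u \<partial>distr ?P ?P ?T)" by simp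
  also have "\<dots> = (\<integral>\<^sup>+u. g (?T u) \<partial>?P)" by (rule nn_integral_distr[OF T]) (simp add: g)
  finally show ?thesis ..
qed

lemma norm_matrix_le_sum:
  fixes A :: "real^'n^'m"
  shows "norm A \<le> (\<Sum>i\<in>UNIV. \<Sum>j\<in>UNIV. \<bar>A $ i $ j\<bar>)"
proof -
  have "norm A \<le> (\<Sum>i\<in>UNIV. norm (A $ i))" unfolding norm_vec_def by (rule L2_set_le_sum) simp
  also have "\<dots> \<le> (\<Sum>i\<in>UNIV. \<Sum>j\<in>UNIV. \<bar>A $ i $ j\<bar>)" by (intro sum_mono norm_le_l1_cart)
  finally show ?thesis .
qed

lemma entry_le_norm: "\<bar>(A :: real^'n^'m) $ i $ j\<bar> \<le> norm A"
  using component_le_norm_cart[of "A $ i" j] Finite_Cartesian_Product.norm_nth_le[of A i] by linarith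

lemma subspace_lebesgue_upper: "subspace_lebesgue upper (upper_lborel :: ('d::{finite,wellorder} sqmat) measure)"
proof
  let ?I = "upper_pairs :: ('d \<times> 'd) set"
  let ?P = "\<Pi>\<^sub>M p\<in>?I. (lborel :: real measure)"
  interpret product_sigma_finite "\<lambda>_::'d\<times>'d. lborel :: real measure" ..
  show "sets (upper_lborel :: ('d sqmat) measure) = sets borel" by (simp add: upper_lborel_eq)
  show "subspace (upper :: ('d sqmat) set)" by (auto simp: subspace_def upper_def)
  then have [measurable]: "(upper :: ('d sqmat) set) \<in> sets borel" by (simp add: closed_subspace)
  show "AE U in upper_lborel. U \<in> (upper :: ('d sqmat) set)"
    unfolding upper_lborel_eq by (subst AE_distr_iff) (auto simp: upper_def upper_fill_nth)
  {
    fix w :: "'d sqmat" and f :: "'d sqmat \<Rightarrow> ennreal" assume w: "w \<in> upper" and f: "f \<in> borel_measurable borel"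
    have [measurable]: "(\<lambda>u. f (upper_fill u)) \<in> borel_measurable ?P"
      by (rule measurable_compose[OF upper_fill_measurable f])
    have "(\<integral>\<^sup>+x. f (x + w) \<partial>upper_lborel) = (\<integral>\<^sup>+u. f (upper_fill u + w) \<partial>?P)"
      using f by (intro nn_integral_upper_lborel) simp
    also have "\<dots> = (\<integral>\<^sup>+u. f (upper_fill (\<lambda>p\<in>?I. 1 * u p + w $ fst p $ snd p)) \<partial>?P)"
    proof (intro nn_integral_cong arg_cong[where f = f])
      fix u :: "'d \<times> 'd \<Rightarrow> real" show "upper_fill u + w = upper_fill (\<lambda>p\<in>?I. 1 * u p + w $ fst p $ snd p)"
        using w by (auto simp: vec_eq_iff upper_fill_nth upper_def)
    qed
    also have "\<dots> = (\<integral>\<^sup>+u. f (upper_fill u) \<partial>?P)" by (rule PiM_reflect_translate) auto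
    finally show "(\<integral>\<^sup>+x. f (x + w) \<partial>upper_lborel) = (\<integral>\<^sup>+x. f x \<partial>upper_lborel)"
      using f by (simp add: nn_integral_upper_lborel)
  }
  {
    fix f :: "'d sqmat \<Rightarrow> ennreal" assume f: "f \<in> borel_measurable borel"
    have [measurable]: "(\<lambda>u. f (upper_fill u)) \<in> borel_measurable ?P"
      by (rule measurable_compose[OF upper_fill_measurable f])
    have "(\<integral>\<^sup>+x. f (- x) \<partial>upper_lborel) = (\<integral>\<^sup>+u. f (- upper_fill u) \<partial>?P)"
      using f by (intro nn_integral_upper_lborel) simp
    also have "\<dots> = (\<integral>\<^sup>+u. f (upper_fill (\<lambda>p\<in>?I. (-1) * u p + 0)) \<partial>?P)"
      by (intro nn_integral_cong arg_cong[where f = f]) (auto simp: vec_eq_iff upper_fill_nth)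
    also have "\<dots> = (\<integral>\<^sup>+u. f (upper_fill u) \<partial>?P)" by (rule PiM_reflect_translate) auto
    finally show "(\<integral>\<^sup>+x. f (- x) \<partial>upper_lborel) = (\<integral>\<^sup>+x. f x \<partial>upper_lborel)"
      using f by (simp add: nn_integral_upper_lborel)
  }
  fix r :: real
  have em: "emeasure upper_lborel (ball (0::'d sqmat) r) = emeasure ?P (upper_fill -` ball 0 r \<inter> space ?P)"
    unfolding upper_lborel_eq by (rule emeasure_distr) auto
  have "upper_fill -` ball 0 r \<inter> space ?P \<subseteq> (\<Pi>\<^sub>E p\<in>?I. {-r..r})"
  proof
    fix u assume u: "u \<in> upper_fill -` ball (0::'d sqmat) r \<inter> space ?P"
    have "\<bar>u (i, j)\<bar> \<le> r" if "i \<le> j" for i j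
      using entry_le_norm[of "upper_fill u" i j] u that by (simp add: upper_fill_nth)
    then show "u \<in> (\<Pi>\<^sub>E p\<in>?I. {-r..r})" using u by (auto simp: space_PiM PiE_def Pi_def abs_le_iff) (smt (verit))
  qed
  then have "emeasure upper_lborel (ball (0::'d sqmat) r) \<le> emeasure ?P (\<Pi>\<^sub>E p\<in>?I. {-r..r})"
    unfolding em by (intro emeasure_mono) (auto intro!: sets_PiM_I_finite)
  also have "\<dots> = (\<Prod>p\<in>?I. emeasure lborel {-r..r})" by (intro emeasure_PiM) auto
  also have "\<dots> < \<infinity>" by (simp add: power_less_top_ennreal emeasure_lborel_Icc_eq)
  finally show "emeasure upper_lborel (ball (0::'d sqmat) r) < \<infinity>" .
  assume r: "0 < r"
  define k where "k = real CARD('d) * real CARD('d)"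
  define e where "e = r / (k + 1)"
  have "0 \<le> k" unfolding k_def by simp
  then have e: "0 < e" and "(k + 1) * e = r" using r unfolding e_def by simp_all
  then have ke: "k * e + e = r" by (simp add: algebra_simps)
  have "(\<Pi>\<^sub>E p\<in>?I. {-e..e}) \<subseteq> upper_fill -` ball (0::'d sqmat) r \<inter> space ?P"
  proof
    fix u assume u: "u \<in> (\<Pi>\<^sub>E p\<in>?I. {-e..e})"
    have "\<bar>upper_fill u $ i $ j\<bar> \<le> e" for i j
      using u e by (auto simp: upper_fill_nth PiE_def Pi_def abs_le_iff) (smt (verit))+
    then have "norm (upper_fill u) \<le> (\<Sum>i\<in>(UNIV::'d set). \<Sum>j\<in>(UNIV::'d set). e)"
      by (intro order_trans[OF norm_matrix_le_sum] sum_mono)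
    also have "\<dots> < r"
      using ke e by (simp add: k_def)
    finally show "u \<in> upper_fill -` ball 0 r \<inter> space ?P" using u by (auto simp: space_PiM PiE_def)
  qed
  then have "emeasure ?P (\<Pi>\<^sub>E p\<in>?I. {-e..e}) \<le> emeasure upper_lborel (ball (0::'d sqmat) r)"
    unfolding em by (intro emeasure_mono) auto
  moreover have "emeasure ?P (\<Pi>\<^sub>E p\<in>?I. {-e..e}) = (\<Prod>p\<in>?I. emeasure lborel {-e..e})"
    by (intro emeasure_PiM) auto
  moreover have "\<dots> > 0" using e by (auto simp: zero_less_iff_neq_zero)
  ultimately show "0 < emeasure upper_lborel (ball (0::'d sqmat) r)" by auto
qed

lemma borel_measurable_fst_prod [measurable (raw)]:
  fixes f :: "'x \<Rightarrow> 'a::second_countable_topology \<times> 'b::second_countable_topology"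
  assumes "f \<in> borel_measurable M"
  shows "(\<lambda>x. fst (f x)) \<in> borel_measurable M"
  by (rule borel_measurable_continuous_on[OF _ assms]) (intro continuous_intros)

lemma borel_measurable_snd_prod [measurable (raw)]:
  fixes f :: "'x \<Rightarrow> 'a::second_countable_topology \<times> 'b::second_countable_topology"
  assumes "f \<in> borel_measurable M"
  shows "(\<lambda>x. snd (f x)) \<in> borel_measurable M"
  by (rule borel_measurable_continuous_on[OF _ assms]) (intro continuous_intros)

lemma borel_measurable_det [measurable (raw)]:
  fixes f :: "'x \<Rightarrow> ((real, 'n::finite) vec, 'n) vec"
  assumes [measurable]: "f \<in> borel_measurable M"
  shows "(\<lambda>x. det (f x)) \<in> borel_measurable M"
  unfolding det_def by measurable

lemma borel_measurable_matrix_vector_mult [measurable (raw)]: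
  fixes f :: "'x \<Rightarrow> ((real, 'n::finite) vec, 'm::finite) vec"
  assumes [measurable]: "f \<in> borel_measurable M" "g \<in> borel_measurable M"
  shows "(\<lambda>x. f x *v g x) \<in> borel_measurable M"
  unfolding matrix_vector_mult_def by measurable

lemma borel_measurable_matrix_matrix_mult [measurable (raw)]:
  fixes f :: "'x \<Rightarrow> ((real, 'n::finite) vec, 'm::finite) vec" and g :: "'x \<Rightarrow> ((real, 'k::finite) vec, 'n::finite) vec"
  assumes [measurable]: "f \<in> borel_measurable M" "g \<in> borel_measurable M"
  shows "(\<lambda>x. f x ** g x) \<in> borel_measurable M"
  unfolding matrix_matrix_mult_def by measurable

lemma borel_measurable_transpose [measurable (raw)]:
  fixes f :: "'x \<Rightarrow> ((real, 'n::finite) vec, 'm::finite) vec"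
  assumes [measurable]: "f \<in> borel_measurable M"
  shows "(\<lambda>x. transpose (f x)) \<in> borel_measurable M"
  unfolding transpose_def by measurable

lemma matrix_inv_right:
  fixes A :: "((real, 'n::finite) vec, 'm::finite) vec"
  assumes "invertible A"
  shows "A ** matrix_inv A = mat 1"
  using someI_ex[OF assms[unfolded invertible_def]] unfolding matrix_inv_def by blast

section \<open>The group of upper triangular affine maps\<close>

text \<open>
  Multiplication and unit of the group \<^const>\<open>G_N\<close>, as plain functions.
\<close>

definition gmul :: "'d::{finite,wellorder} affine \<Rightarrow> 'd affine \<Rightarrow> 'd affine" where
  "gmul g h = (fst g ** fst h, fst g *v snd h + snd g)"

definition gunit :: "'d::{finite,wellorder} affine" where
  "gunit = (mat 1, 0)"

lemma Theta_iff: "\<theta> \<in> Theta \<longleftrightarrow> fst \<theta> \<in> upper \<and> (\<forall>i. 0 < fst \<theta> $ i $ i)"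
  by (auto simp: Theta_def upper_def)

lemma gunit_Theta [simp]: "gunit \<in> Theta"
  by (auto simp: Theta_iff gunit_def upper_def mat_def)

lemma det_Theta: "\<theta> \<in> Theta \<Longrightarrow> det (fst \<theta>) = (\<Prod>i\<in>UNIV. fst \<theta> $ i $ i)"
  by (rule det_upperdiagonal) (auto simp: Theta_def)

lemma det_Theta_pos: "\<theta> \<in> Theta \<Longrightarrow> 0 < det (fst \<theta>)"
  by (simp add: det_Theta Theta_iff prod_pos)

lemma upper_mult:
  assumes "U \<in> upper" "V \<in> upper"
  shows "U ** V \<in> upper"
  unfolding upper_def
proof (intro CollectI allI impI)
  fix i j :: 'a assume ij: "j < i"
  have "U $ i $ k * V $ k $ j = 0" for k
  proof (cases "k < i")
    case False
    then have "j < k" using ij by simp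
    then show ?thesis using assms by (simp add: upper_def)
  qed (use assms in \<open>simp add: upper_def\<close>)
  then show "(U ** V) $ i $ j = 0" unfolding matrix_matrix_mult_def by (simp only: vec_lambda_beta sum.neutral_const)
qed

text \<open>
  Only the indices between \<open>i\<close> and \<open>j\<close> contribute, so column \<open>j\<close> of a product depends on the columns
  up to \<open>j\<close> of the left factor; the Foelner boxes are built on this.
\<close>

lemma upper_mult_nth:
  assumes "U \<in> upper" "V \<in> upper"
  shows "(U ** V) $ i $ j = (\<Sum>l\<in>{i..j}. U $ i $ l * V $ l $ j)"
proof -
  have "(U ** V) $ i $ j = (\<Sum>l\<in>UNIV. U $ i $ l * V $ l $ j)"
    by (simp add: matrix_matrix_mult_def)
  also have "\<dots> = (\<Sum>l\<in>{i..j}. U $ i $ l * V $ l $ j)"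
  proof (rule sum.mono_neutral_right)
    show "\<forall>l\<in>UNIV - {i..j}. U $ i $ l * V $ l $ j = 0"
      using assms by (auto simp: upper_def not_le)
  qed auto
  finally show ?thesis .
qed

lemma upper_mult_diag:
  assumes "U \<in> upper" "V \<in> upper"
  shows "(U ** V) $ i $ i = U $ i $ i * V $ i $ i"
  by (simp add: upper_mult_nth[OF assms])

lemma gmul_Theta: "g \<in> Theta \<Longrightarrow> h \<in> Theta \<Longrightarrow> gmul g h \<in> Theta"
  by (simp add: Theta_iff gmul_def upper_mult upper_mult_diag)

lemma act_gmul: "act (gmul g h) y = act g (act h y)"
  by (simp add: act_def gmul_def matrix_vector_mul_assoc matrix_vector_right_distrib add.assoc)

lemma act_all_gmul: "act_all (gmul g h) y = act_all g (act_all h y)"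
  by (simp add: act_all_def act_gmul)

lemma act_all_nth: "act_all g y $ i = fst g *v (y $ i) + snd g"
  by (simp add: act_all_def act_def)

lemma Theta_invertible: "g \<in> Theta \<Longrightarrow> invertible (fst g)"
  using det_Theta_pos[of g] by (simp add: invertible_det_nz)

lemma act_all_surj:
  assumes "g \<in> Theta"
  obtains z where "y = act_all g z"
proof
  let ?B = "matrix_inv (fst g)"
  have eq: "fst g ** ?B = mat 1" by (rule matrix_inv_right[OF Theta_invertible[OF assms]])
  show "y = act_all g (\<chi> i. ?B *v (y $ i - snd g))"
    by (subst vec_eq_iff) (simp add: act_all_nth matrix_vector_mul_assoc eq)
qed

lemma act_all_inj:
  assumes "g \<in> Theta"
  shows "inj (act_all g)"
proof (rule injI)
  fix x y assume eq: "act_all g x = act_all g y"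
  have "x $ i = y $ i" for i
  proof -
    have "fst g *v (x $ i) = fst g *v (y $ i)"
      using arg_cong[OF eq, of "\<lambda>v. v $ i"] by (simp add: act_all_nth)
    then show ?thesis
      using inj_matrix_vector_mult[OF Theta_invertible[OF assms]] by (simp add: inj_eq)
  qed
  then show "x = y" by (simp add: vec_eq_iff)
qed

lemma borel_measurable_act_all [measurable (raw)]:
  fixes f :: "'x \<Rightarrow> 'd::{finite,wellorder} affine" and g :: "'x \<Rightarrow> ('d, 'k::finite) sample"
  assumes [measurable]: "f \<in> borel_measurable M" "g \<in> borel_measurable M"
  shows "(\<lambda>x. act_all (f x) (g x)) \<in> borel_measurable M"
  unfolding act_all_def act_def by measurable

lemma borel_measurable_gmul [measurable (raw)]:
  fixes f :: "'x \<Rightarrow> 'd::{finite,wellorder} affine"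
  assumes [measurable]: "f \<in> borel_measurable M" "g \<in> borel_measurable M"
  shows "(\<lambda>x. gmul (f x) (g x)) \<in> borel_measurable M"
  unfolding gmul_def by measurable

lemma Theta_borel [measurable]: "(Theta :: ('d::{finite,wellorder} affine) set) \<in> sets borel"
proof -
  have "(Theta :: ('d affine) set) = {\<theta>\<in>space borel. (\<forall>i j. j < i \<longrightarrow> fst \<theta> $ i $ j = 0) \<and> (\<forall>i. 0 < fst \<theta> $ i $ i)}"
    by (auto simp: Theta_def)
  also have "\<dots> \<in> sets borel" by measurable
  finally show ?thesis .
qed

section \<open>The likelihood\<close>

definition stdnormal :: "('d::finite) rvec \<Rightarrow> real" where
  "stdnormal z = exp (- (1/2) * (z \<bullet> z)) / sqrt ((2 * pi) ^ CARD('d))"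

text \<open>
  The quadratic form is evaluated without inverting \<open>\<Sigma> = U U\<^sup>T\<close> explicitly: if \<open>x\<close> solves
  \<open>\<Sigma> x = U z\<close>, then \<open>U\<^sup>T x = z\<close>, and so \<open>(U z) \<bullet> x = z \<bullet> z\<close>.
\<close>

lemma mvn_density_act:
  assumes "\<theta> \<in> Theta"
  shows "mvn_density (snd \<theta>) (fst \<theta> ** transpose (fst \<theta>)) (act \<theta> z) = stdnormal z / det (fst \<theta>)"
proof -
  let ?U = "fst \<theta>" let ?S = "?U ** transpose ?U"
  have d: "0 < det ?U" by (rule det_Theta_pos[OF assms])
  have detS: "det ?S = det ?U * det ?U" by (simp add: det_mul)
  then have inv: "invertible ?S" using d by (simp add: invertible_det_nz)
  define x where "x = matrix_inv ?S *v (?U *v z)"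
  have "?S *v x = ?U *v z"
    unfolding x_def matrix_vector_mul_assoc[of ?S] matrix_inv_right[OF inv] by simp
  then have "?U *v (transpose ?U *v x) = ?U *v z" by (simp only: matrix_vector_mul_assoc)
  then have tx: "transpose ?U *v x = z"
    using inj_matrix_vector_mult[OF Theta_invertible[OF assms]] by (simp add: inj_eq)
  have "(?U *v z) \<bullet> x = z \<bullet> (transpose ?U *v x)" 
    by (metis dot_lmul_matrix inner_commute transpose_matrix_vector)
  then have quad: "(?U *v z) \<bullet> x = z \<bullet> z" by (simp only: tx)
  have "sqrt ((2 * pi) ^ CARD('a) * det ?S) = sqrt ((2 * pi) ^ CARD('a)) * det ?U"
    using d by (simp add: detS real_sqrt_mult)
  then show ?thesis
    unfolding mvn_density_def stdnormal_def act_def using quad d by (simp add: x_def)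
qed

lemma iid_density_gunit_pos: "0 < iid_density gunit (z :: ('d::{finite,wellorder}, 'k::finite) sample)"
proof -
  have "mvn_density (0 :: 'd rvec) (mat 1) x > 0" for x
    by (simp add: mvn_density_def)
  then show ?thesis by (simp add: iid_density_def gunit_def prod_pos)
qed

lemma stdnormal_eq: "mvn_density 0 (mat 1) (z :: ('d::{finite,wellorder}) rvec) = stdnormal z"
  using mvn_density_act[of gunit z] by (simp add: gunit_def[symmetric]) (simp add: gunit_def act_def)

lemma iid_density_gunit: "iid_density gunit z = (\<Prod>i\<in>UNIV. stdnormal (z $ i))"
  by (simp add: iid_density_def gunit_def stdnormal_eq)

lemma iid_density_act:
  fixes z :: "('d::{finite,wellorder}, 'k::finite) sample"
  assumes "\<theta> \<in> Theta"
  shows "iid_density \<theta> (act_all \<theta> z) = iid_density gunit z / det (fst \<theta>) ^ CARD('k)"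
  unfolding iid_density_gunit
  by (simp add: iid_density_def act_all_def mvn_density_act[OF assms] prod_dividef)

text \<open>
  The model is equivariant. Writing \<open>y = \<theta> z\<close> reduces both sides to the standard normal density.
\<close>

lemma iid_density_gmul:
  fixes y :: "('d::{finite,wellorder}, 'k::finite) sample"
  assumes g: "g \<in> Theta" and \<theta>: "\<theta> \<in> Theta"
  shows "iid_density (gmul g \<theta>) (act_all g y) = iid_density \<theta> y / det (fst g) ^ CARD('k)"
proof -
  obtain z where y: "y = act_all \<theta> z" by (rule act_all_surj[OF \<theta>])
  have "iid_density (gmul g \<theta>) (act_all (gmul g \<theta>) z) = iid_density gunit z / det (fst (gmul g \<theta>)) ^ CARD('k)"
    by (rule iid_density_act[OF gmul_Theta[OF g \<theta>]])
  moreover have "iid_density \<theta> y = iid_density gunit z / det (fst \<theta>) ^ CARD('k)"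
    unfolding y by (rule iid_density_act[OF \<theta>])
  moreover have "det (fst (gmul g \<theta>)) = det (fst g) * det (fst \<theta>)" by (simp add: gmul_def det_mul)
  ultimately show ?thesis
    by (simp add: y act_all_gmul power_mult_distrib mult.commute)
qed

lemma iid_density_pos:
  assumes "\<theta> \<in> Theta"
  shows "0 < iid_density \<theta> y"
proof -
  obtain z where y: "y = act_all \<theta> z" by (rule act_all_surj[OF assms])
  show ?thesis unfolding y iid_density_act[OF assms]
    using det_Theta_pos[OF assms] by (simp add: iid_density_gunit_pos)
qed

text \<open>
  The density is cut off outside \<^const>\<open>Theta\<close>, where the covariance may be singular, to make it
  jointly measurable in the parameter and the sample.
\<close>

definition lik :: "'d::{finite,wellorder} affine \<Rightarrow> ('d, 'k::finite) sample \<Rightarrow> real" where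
  "lik \<theta> y = indicator Theta \<theta> * iid_density \<theta> y"

lemma lik_Theta [simp]: "\<theta> \<in> Theta \<Longrightarrow> lik \<theta> y = iid_density \<theta> y"
  by (simp add: lik_def)

lemma lik_nonneg [simp]: "0 \<le> lik \<theta> y"
  by (cases "\<theta> \<in> Theta") (auto simp: lik_def less_imp_le[OF iid_density_pos])

lemma borel_measurable_lik [measurable (raw)]:
  fixes f :: "'x \<Rightarrow> 'd::{finite,wellorder} affine" and g :: "'x \<Rightarrow> ('d, 'k::finite) sample"
  assumes [measurable]: "f \<in> borel_measurable M" "g \<in> borel_measurable M"
  shows "(\<lambda>x. lik (f x) (g x)) \<in> borel_measurable M"
proof -
  (* Cramer's rule expresses the inverse of the covariance by determinants, which are
     measurable functions of the parameter. *)
  define S :: "'d affine \<Rightarrow> 'd sqmat" where "S = (\<lambda>\<theta>. fst \<theta> ** transpose (fst \<theta>))"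
  define v :: "'d affine \<Rightarrow> 'd rvec \<Rightarrow> 'd rvec"
    where "v = (\<lambda>\<theta> y. \<chi> k. det (\<chi> i j. if j = k then (y - snd \<theta>) $ i else S \<theta> $ i $ j) / det (S \<theta>))"
  have v: "matrix_inv (S \<theta>) *v (y - snd \<theta>) = v \<theta> y" if "\<theta> \<in> Theta" for \<theta> y
  proof -
    have nz: "det (S \<theta>) \<noteq> 0" using det_Theta_pos[OF that] by (simp add: S_def det_mul)
    then have "S \<theta> *v (matrix_inv (S \<theta>) *v (y - snd \<theta>)) = y - snd \<theta>"
      by (simp add: matrix_vector_mul_assoc matrix_inv_right invertible_det_nz)
    then show ?thesis unfolding cramer[OF nz] v_def .
  qed
  have [measurable]: "(\<lambda>x. S (f x)) \<in> borel_measurable M"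
    unfolding S_def by measurable
  have [measurable]: "(\<lambda>x. v (f x) (g x $ i)) \<in> borel_measurable M" for i
    unfolding v_def
  proof (intro borel_measurable_vec_lambda borel_measurable_divide borel_measurable_det)
    fix k a b show "(\<lambda>x. if b = k then (g x $ i - snd (f x)) $ a else S (f x) $ a $ b) \<in> borel_measurable M"
      by (cases "b = k") simp_all
  qed simp
  have "(\<lambda>x. indicator Theta (f x) * (\<Prod>i\<in>UNIV. exp (- (1/2) * ((g x $ i - snd (f x)) \<bullet> v (f x) (g x $ i))) /
     sqrt ((2 * pi) ^ CARD('d) * det (S (f x))))) \<in> borel_measurable M"
    by measurable
  also have "(\<lambda>x. indicator Theta (f x) * (\<Prod>i\<in>UNIV. exp (- (1/2) * ((g x $ i - snd (f x)) \<bullet> v (f x) (g x $ i))) /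
     sqrt ((2 * pi) ^ CARD('d) * det (S (f x))))) = (\<lambda>x. lik (f x) (g x))"
    by (auto simp: fun_eq_iff lik_def iid_density_def mvn_density_def v[symmetric] S_def split: split_indicator)
  finally show ?thesis .
qed

lemma iid_density_borel:
  "\<theta> \<in> Theta \<Longrightarrow> iid_density \<theta> \<in> borel_measurable borel"
  using borel_measurable_lik[of "\<lambda>_. \<theta>" borel "\<lambda>y. y"] by simp

lemma nn_integral_stdnormal: "(\<integral>\<^sup>+x. ennreal (stdnormal (x :: ('d::finite) rvec)) \<partial>lborel) = 1"
proof -
  have "stdnormal x = (\<Prod>i\<in>UNIV. std_normal_density (x $ i))" for x :: "'d rvec"
    by (simp add: stdnormal_def normal_density_def prod.distrib exp_sum[symmetric] inner_vec_def
      sum_divide_distrib sum_negf power2_eq_square real_sqrt_power[symmetric] power_divide prod_dividef)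
  then have "(\<integral>\<^sup>+x. ennreal (stdnormal (x :: 'd rvec)) \<partial>lborel)
      = (\<integral>\<^sup>+x. (\<Prod>i\<in>UNIV. ennreal (std_normal_density ((x :: 'd rvec) $ i))) \<partial>lborel)"
    by (simp add: prod_ennreal)
  also have "\<dots> = (\<Prod>i\<in>(UNIV :: 'd set). \<integral>\<^sup>+x. ennreal (std_normal_density x) \<partial>lborel)"
    by (rule nn_integral_lborel_vec_prod) simp
  also have "(\<integral>\<^sup>+x. ennreal (std_normal_density x) \<partial>lborel) = 1"
    using prob_space.emeasure_space_1[OF prob_space_normal_density[of 1 0]]
    by (simp add: emeasure_density)
  finally show ?thesis by simp
qed

lemma nn_integral_act_all:
  fixes \<theta> :: "'d::{finite,wellorder} affine"
  assumes \<theta>: "\<theta> \<in> Theta"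
  obtains C where "0 < C" "C < \<infinity>"
    "\<And>f. f \<in> borel_measurable borel \<Longrightarrow>
      (\<integral>\<^sup>+z. f (act_all \<theta> (z :: ('d, 'k::finite) sample)) \<partial>lborel) = C * (\<integral>\<^sup>+y. f y \<partial>lborel)"
proof -
  define T :: "('d, 'k) sample \<Rightarrow> ('d, 'k) sample" where "T = (\<lambda>y. \<chi> i. fst \<theta> *v (y $ i))"
  define m :: "('d, 'k) sample" where "m = (\<chi> i. snd \<theta>)"
  have act: "act_all \<theta> y = T y + m" for y
    by (simp add: T_def m_def vec_eq_iff act_all_nth)
  interpret subspace_lebesgue UNIV "lborel :: ('d, 'k) sample measure"
    by (rule subspace_lebesgue_lborel)
  have lin: "linear T"
    by (rule linearI) (simp_all add: T_def vec_eq_iff matrix_vector_right_distrib matrix_vector_mult_scaleR)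
  then have [measurable]: "T \<in> borel_measurable borel"
    by (simp add: borel_measurable_continuous_onI linear_continuous_on linear_conv_bounded_linear)
  have "inj T"
  proof (rule injI)
    fix x y assume "T x = T y"
    then have "act_all \<theta> x = act_all \<theta> y" by (simp add: act)
    then show "x = y" by (rule injD[OF act_all_inj[OF \<theta>]])
  qed
  then obtain C where C: "0 < C" "C < \<infinity>"
      "\<And>f. f \<in> borel_measurable borel \<Longrightarrow> (\<integral>\<^sup>+x. f (T x) \<partial>lborel) = C * (\<integral>\<^sup>+x. f x \<partial>lborel)"
    using linear_scaling[OF lin] by auto
  show thesis
  proof (rule that[OF C(1,2)])
    fix f :: "('d, 'k) sample \<Rightarrow> ennreal" assume [measurable]: "f \<in> borel_measurable borel"
    have "(\<integral>\<^sup>+z. f (act_all \<theta> z) \<partial>lborel) = C * (\<integral>\<^sup>+x. f (x + m) \<partial>lborel)"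
      unfolding act by (rule C(3)[where f = "\<lambda>x. f (x + m)"]) simp
    then show "(\<integral>\<^sup>+z. f (act_all \<theta> z) \<partial>lborel) = C * (\<integral>\<^sup>+y. f y \<partial>lborel)"
      by (simp add: translate)
  qed
qed

text \<open>
  The scaling constant on a single data point is read off from the volume of the image of a ball.
\<close>

lemma nn_integral_act_single:
  fixes \<theta> :: "'d::{finite,wellorder} affine"
  assumes \<theta>: "\<theta> \<in> Theta" and f: "f \<in> borel_measurable borel"
  shows "(\<integral>\<^sup>+z. f (act \<theta> z) \<partial>lborel) * ennreal (det (fst \<theta>)) = (\<integral>\<^sup>+y. f y \<partial>lborel)"
proof -
  interpret subspace_lebesgue UNIV "lborel :: 'd rvec measure"
    by (rule subspace_lebesgue_lborel)
  define T :: "'d rvec \<Rightarrow> 'd rvec" where "T = (\<lambda>y. fst \<theta> *v y)"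
  have lin: "linear T" unfolding T_def by (rule matrix_vector_mul_linear)
  have inj: "inj T" unfolding T_def by (rule inj_matrix_vector_mult[OF Theta_invertible[OF \<theta>]])
  obtain C where C: "0 < C" "C < \<infinity>"
      "\<And>f. f \<in> borel_measurable borel \<Longrightarrow> (\<integral>\<^sup>+x. f (T x) \<partial>lborel) = C * (\<integral>\<^sup>+x. f x \<partial>lborel)"
    using linear_scaling[OF lin inj] by auto
  have d: "0 < det (fst \<theta>)" by (rule det_Theta_pos[OF \<theta>])
  let ?B = "cball (0 :: 'd rvec) 1"
  have cT: "compact (T ` ?B)"
    using lin by (intro compact_continuous_image linear_continuous_on) (simp_all add: linear_conv_bounded_linear)
  have "measure lebesgue (T ` ?B) = \<bar>det (matrix T)\<bar> * measure lebesgue ?B"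
    by (rule measure_linear_image[OF lin]) simp
  then have "measure lborel (T ` ?B) = det (fst \<theta>) * measure lborel ?B"
    using d cT by (simp add: T_def borel_compact)
  moreover have "emeasure lborel (T ` ?B) = ennreal (measure lborel (T ` ?B))"
    using emeasure_compact_finite[OF cT] by (intro emeasure_eq_ennreal_measure) auto
  moreover have B: "emeasure lborel ?B = ennreal (measure lborel ?B)"
    using emeasure_lborel_cball_finite[of "0 :: 'd rvec" 1] by (intro emeasure_eq_ennreal_measure) (simp add: less_top)
  ultimately have em: "emeasure lborel (T ` ?B) = ennreal (det (fst \<theta>)) * emeasure lborel ?B"
    using d by (simp add: ennreal_mult)
  have Bpos: "0 < measure lborel ?B" by (rule content_cball_pos) simp
  have TB [measurable]: "T ` ?B \<in> sets borel" using cT by (rule borel_compact)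
  have "emeasure lborel ?B = (\<integral>\<^sup>+x. indicator ?B x \<partial>lborel)" by simp
  also have "\<dots> = (\<integral>\<^sup>+x. indicator (T ` ?B) (T x) \<partial>lborel)"
    using inj by (intro nn_integral_cong) (simp add: indicator_def inj_image_mem_iff)
  also have "\<dots> = C * emeasure lborel (T ` ?B)"
    by (subst C(3)) simp_all
  finally have "emeasure lborel ?B * 1 = emeasure lborel ?B * (C * ennreal (det (fst \<theta>)))"
    by (simp add: em mult_ac)
  then have Cd: "C * ennreal (det (fst \<theta>)) = 1"
    using Bpos by (subst (asm) ennreal_mult_cancel_left) (simp add: B)
  have "(\<integral>\<^sup>+z. f (act \<theta> z) \<partial>lborel) = C * (\<integral>\<^sup>+x. f (x + snd \<theta>) \<partial>lborel)"
    unfolding act_def using C(3)[of "\<lambda>x. f (x + snd \<theta>)"] f by (simp add: T_def)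
  also have "\<dots> = C * (\<integral>\<^sup>+x. f x \<partial>lborel)" using f by (simp add: translate)
  finally have eq: "(\<integral>\<^sup>+z. f (act \<theta> z) \<partial>lborel) = C * (\<integral>\<^sup>+x. f x \<partial>lborel)" .
  have "C * (\<integral>\<^sup>+x. f x \<partial>lborel) * ennreal (det (fst \<theta>)) = C * ennreal (det (fst \<theta>)) * (\<integral>\<^sup>+x. f x \<partial>lborel)"
    by (simp only: mult_ac)
  then show ?thesis by (simp add: eq Cd)
qed

lemma nn_integral_iid_density:
  fixes \<theta> :: "'d::{finite,wellorder} affine"
  assumes \<theta>: "\<theta> \<in> Theta"
  shows "(\<integral>\<^sup>+y. ennreal (iid_density \<theta> (y :: ('d, 'k::finite) sample)) \<partial>lborel) = 1"
proof -
  let ?p = "mvn_density (snd \<theta>) (fst \<theta> ** transpose (fst \<theta>))"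
  have d: "0 < det (fst \<theta>)" by (rule det_Theta_pos[OF \<theta>])
  have nn: "0 \<le> ?p y" for y
    by (simp add: mvn_density_def det_mul)
  have [measurable]: "?p \<in> borel_measurable borel"
    unfolding mvn_density_def by measurable
  have "(\<integral>\<^sup>+y. ennreal (?p y) \<partial>lborel) = (\<integral>\<^sup>+z. ennreal (?p (act \<theta> z)) \<partial>lborel) * ennreal (det (fst \<theta>))"
    by (rule nn_integral_act_single[OF \<theta>, symmetric]) simp
  also have "\<dots> = (\<integral>\<^sup>+z. ennreal (stdnormal (z :: 'd rvec)) \<partial>lborel)"
    using d by (subst nn_integral_multc[symmetric])
      (simp_all add: mvn_density_act[OF \<theta>] ennreal_mult''[symmetric] stdnormal_def)
  also have "\<dots> = 1" by (rule nn_integral_stdnormal)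
  finally have 1: "(\<integral>\<^sup>+y. ennreal (?p y) \<partial>lborel) = 1" .
  have "(\<integral>\<^sup>+y. ennreal (iid_density \<theta> (y :: ('d, 'k) sample)) \<partial>lborel)
      = (\<integral>\<^sup>+y. (\<Prod>i\<in>UNIV. ennreal (?p ((y :: ('d, 'k) sample) $ i))) \<partial>lborel)"
    by (simp add: iid_density_def prod_ennreal nn)
  also have "\<dots> = (\<Prod>i\<in>(UNIV :: 'k set). \<integral>\<^sup>+y. ennreal (?p y) \<partial>lborel)"
    by (rule nn_integral_lborel_vec_prod) simp
  finally show ?thesis by (simp add: 1)
qed

text \<open>
  On samples the constant follows by integrating the density of the model itself, which has total
  mass 1 both before and after the substitution.
\<close>

lemma nn_integral_act_all_det:
  fixes \<theta> :: "'d::{finite,wellorder} affine" and f :: "('d, 'k::finite) sample \<Rightarrow> ennreal"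
  assumes \<theta>: "\<theta> \<in> Theta" and f: "f \<in> borel_measurable borel"
  shows "(\<integral>\<^sup>+z. f (act_all \<theta> z) \<partial>lborel) * ennreal (det (fst \<theta>) ^ CARD('k)) = (\<integral>\<^sup>+y. f y \<partial>lborel)"
proof -
  let ?D = "det (fst \<theta>) ^ CARD('k)"
  obtain C where C: "0 < C" "C < \<infinity>"
    "\<And>f. f \<in> borel_measurable borel \<Longrightarrow>
      (\<integral>\<^sup>+z. f (act_all \<theta> (z :: ('d, 'k) sample)) \<partial>lborel) = C * (\<integral>\<^sup>+y. f y \<partial>lborel)"
    using nn_integral_act_all[OF \<theta>, where 'k = 'k] by blast
  have D: "0 < ?D" using det_Theta_pos[OF \<theta>] by simp
  have [measurable]: "iid_density gunit \<in> borel_measurable (borel :: ('d, 'k) sample measure)"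
    "iid_density \<theta> \<in> borel_measurable (borel :: ('d, 'k) sample measure)"
    by (simp_all add: iid_density_borel \<theta>)
  have "(\<integral>\<^sup>+z. ennreal (iid_density \<theta> (act_all \<theta> (z :: ('d, 'k) sample))) \<partial>lborel) = C"
    by (subst C(3)) (simp_all add: nn_integral_iid_density[OF \<theta>])
  moreover have "(\<integral>\<^sup>+z. ennreal (iid_density \<theta> (act_all \<theta> (z :: ('d, 'k) sample))) \<partial>lborel)
      = (\<integral>\<^sup>+z. ennreal (iid_density gunit (z :: ('d, 'k) sample)) * ennreal (inverse ?D) \<partial>lborel)"
    using D by (simp add: iid_density_act[OF \<theta>] ennreal_mult''[symmetric] divide_inverse)
  ultimately have "C = ennreal (inverse ?D)"
    by (simp add: nn_integral_multc nn_integral_iid_density)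
  moreover have "ennreal (inverse ?D) * ennreal ?D = 1"
    using det_Theta_pos[OF \<theta>] by (simp add: ennreal_mult''[symmetric])
  ultimately have "C * ennreal ?D = 1" by simp
  moreover have "C * (\<integral>\<^sup>+y. f y \<partial>lborel) * ennreal ?D = C * ennreal ?D * (\<integral>\<^sup>+y. f y \<partial>lborel)"
    by (simp only: mult_ac)
  ultimately show ?thesis by (simp add: C(3)[OF f])
qed

text \<open>
  The law of the data under \<open>\<theta>\<close> is the image under \<open>\<theta>\<close> of the standard normal law.
\<close>

lemma nn_integral_iid_density_act:
  fixes \<theta> :: "'d::{finite,wellorder} affine" and f :: "('d, 'k::finite) sample \<Rightarrow> ennreal"
  assumes \<theta>: "\<theta> \<in> Theta" and f [measurable]: "f \<in> borel_measurable borel"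
  shows "(\<integral>\<^sup>+y. ennreal (iid_density \<theta> y) * f y \<partial>lborel)
    = (\<integral>\<^sup>+z. ennreal (iid_density gunit z) * f (act_all \<theta> z) \<partial>lborel)"
proof -
  let ?D = "det (fst \<theta>) ^ CARD('k)"
  have D: "0 < ?D" using det_Theta_pos[OF \<theta>] by simp
  have [measurable]: "iid_density \<theta> \<in> borel_measurable (borel :: ('d, 'k) sample measure)"
    "iid_density gunit \<in> borel_measurable (borel :: ('d, 'k) sample measure)"
    by (simp_all add: iid_density_borel \<theta>)
  have "(\<integral>\<^sup>+y. ennreal (iid_density \<theta> y) * f y \<partial>lborel)
     = (\<integral>\<^sup>+z. ennreal (iid_density \<theta> (act_all \<theta> z)) * f (act_all \<theta> z) \<partial>lborel) * ennreal ?D"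
    by (rule nn_integral_act_all_det[OF \<theta>, symmetric]) simp
  also have "\<dots> = (\<integral>\<^sup>+z. ennreal (iid_density \<theta> (act_all \<theta> z)) * ennreal ?D * f (act_all \<theta> z) \<partial>lborel)"
    by (subst nn_integral_multc[symmetric]) (simp_all add: mult_ac)
  also have "\<dots> = (\<integral>\<^sup>+z. ennreal (iid_density gunit z) * f (act_all \<theta> z) \<partial>lborel)"
    using det_Theta_pos[OF \<theta>] by (simp add: iid_density_act[OF \<theta>] ennreal_mult''[symmetric])
  finally show ?thesis .
qed

section \<open>The right Haar measure\<close>

abbreviation affine_lborel :: "('d::{finite,wellorder} affine) measure" where
  "affine_lborel \<equiv> upper_lborel \<Otimes>\<^sub>M lborel"

abbreviation upper_affine :: "('d::{finite,wellorder} affine) set" where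
  "upper_affine \<equiv> upper \<times> UNIV"

text \<open>
  The number in \<open>{1..d}\<close> that corresponds to a coordinate.
\<close>

abbreviation coord_no :: "'d::{finite,wellorder} \<Rightarrow> nat" where
  "coord_no i \<equiv> card {..i}"

definition haar_density :: "'d::{finite,wellorder} affine \<Rightarrow> real" where
  "haar_density \<theta> = indicator Theta \<theta> * (\<Prod>i\<in>UNIV. (fst \<theta> $ i $ i) powr (- real (coord_no i)))"

lemma subspace_lebesgue_affine: "subspace_lebesgue upper_affine (affine_lborel :: ('d::{finite,wellorder} affine) measure)"
  by (rule subspace_lebesgue_pair[OF subspace_lebesgue_upper subspace_lebesgue_lborel])

lemma haar_density_nonneg [simp]: "0 \<le> haar_density \<theta>"
  by (simp add: haar_density_def prod_nonneg)

lemma haar_density_borel [measurable]: "haar_density \<in> borel_measurable (borel :: ('d::{finite,wellorder} affine) measure)"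
  unfolding haar_density_def[abs_def] by measurable

lemma prior_eq: "prior c = density affine_lborel (\<lambda>\<theta>. ennreal (c * haar_density \<theta>))"
  by (simp add: prior_def haar_density_def mult.assoc)

lemma sets_affine_lborel [measurable_cong]: "sets (affine_lborel :: ('d::{finite,wellorder} affine) measure) = sets borel"
  by (rule subspace_lebesgue.sets_eq[OF subspace_lebesgue_affine])

lemma sets_prior [measurable_cong]: "sets (prior c :: ('d::{finite,wellorder} affine) measure) = sets borel"
  by (simp only: prior_eq sets_density sets_affine_lborel)

lemma space_prior [simp]: "space (prior c) = UNIV"
  using sets_eq_imp_space_eq[OF sets_prior] by simp

lemma nn_integral_prior:
  fixes f :: "'d::{finite,wellorder} affine \<Rightarrow> ennreal"
  assumes [measurable]: "f \<in> borel_measurable borel"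
  shows "(\<integral>\<^sup>+\<theta>. f \<theta> \<partial>prior c) = (\<integral>\<^sup>+\<theta>. ennreal (c * haar_density \<theta>) * f \<theta> \<partial>affine_lborel)"
  unfolding prior_eq by (rule nn_integral_density) measurable

lemma sigma_finite_prior: "sigma_finite_measure (prior c :: ('d::{finite,wellorder} affine) measure)"
proof -
  interpret sigma_finite_measure "affine_lborel :: ('d affine) measure"
    by (rule subspace_lebesgue.sigma_finite[OF subspace_lebesgue_affine])
  show ?thesis unfolding prior_eq
    by (subst sigma_finite_iff_density_finite) auto
qed

lemma AE_prior_Theta: "AE \<theta> in prior c. \<theta> \<in> (Theta :: ('d::{finite,wellorder} affine) set)"
  unfolding prior_eq by (subst AE_density) (auto simp: haar_density_def split: split_indicator)

text \<open>
  Left and right translations of the group are restrictions of affine maps and multiply the density of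
  the prior by constants, so both scale the prior.
\<close>

lemma prior_affine_scaling:
  fixes T :: "'d::{finite,wellorder} affine \<Rightarrow> 'd affine"
  assumes T: "linear T" "inj T" "T ` upper_affine \<subseteq> upper_affine" and m: "m \<in> upper_affine"
    and k: "0 < k" "\<And>\<theta>. \<theta> \<in> upper_affine \<Longrightarrow> haar_density (T \<theta> + m) = k * haar_density \<theta>"
    and c: "0 < c"
  obtains C where "0 < C" "C < \<infinity>"
    "\<And>f. f \<in> borel_measurable borel \<Longrightarrow> (\<integral>\<^sup>+\<theta>. f (T \<theta> + m) \<partial>prior c) = C * (\<integral>\<^sup>+\<theta>. f \<theta> \<partial>prior c)"
proof -
  interpret subspace_lebesgue upper_affine "affine_lborel :: ('d affine) measure"
    by (rule subspace_lebesgue_affine)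
  obtain C where C: "0 < C" "C < \<infinity>"
    "\<And>f. f \<in> borel_measurable borel \<Longrightarrow> (\<integral>\<^sup>+x. f (T x) \<partial>affine_lborel) = C * (\<integral>\<^sup>+x. f x \<partial>affine_lborel)"
    using linear_scaling[OF T] by blast
  have [measurable]: "T \<in> borel_measurable borel"
    using T(1) by (simp add: borel_measurable_continuous_onI linear_continuous_on linear_conv_bounded_linear)
  show thesis
  proof (rule that)
    show "0 < ennreal (inverse k) * C" using k C by (simp add: ennreal_zero_less_mult_iff)
    show "ennreal (inverse k) * C < \<infinity>" using C by (simp add: ennreal_mult_less_top)
    fix f :: "'d affine \<Rightarrow> ennreal" assume [measurable]: "f \<in> borel_measurable borel"
    have "(\<integral>\<^sup>+\<theta>. f (T \<theta> + m) \<partial>prior c)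
        = (\<integral>\<^sup>+\<theta>. ennreal (c * haar_density \<theta>) * f (T \<theta> + m) \<partial>affine_lborel)"
      by (rule nn_integral_prior) simp
    also have "\<dots> = (\<integral>\<^sup>+\<theta>. ennreal (inverse k) * (ennreal (c * haar_density (T \<theta> + m)) * f (T \<theta> + m)) \<partial>affine_lborel)"
    proof (rule nn_integral_cong_AE)
      show "AE \<theta> in affine_lborel. ennreal (c * haar_density \<theta>) * f (T \<theta> + m)
          = ennreal (inverse k) * (ennreal (c * haar_density (T \<theta> + m)) * f (T \<theta> + m))"
        using AE_subspace
      proof eventually_elim
        case (elim \<theta>)
        have "ennreal (inverse k) * ennreal (c * haar_density (T \<theta> + m)) = ennreal (c * haar_density \<theta>)"
          using k c by (simp add: k(2)[OF elim] ennreal_mult''[symmetric])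
        then show ?case by (simp add: mult.assoc[symmetric])
      qed
    qed
    also have "\<dots> = ennreal (inverse k) * (C * (\<integral>\<^sup>+\<theta>. ennreal (c * haar_density (\<theta> + m)) * f (\<theta> + m) \<partial>affine_lborel))"
      by (subst nn_integral_cmult, measurable)
        (subst C(3)[where f = "\<lambda>\<theta>. ennreal (c * haar_density (\<theta> + m)) * f (\<theta> + m)"], simp_all)
    also have "(\<integral>\<^sup>+\<theta>. ennreal (c * haar_density (\<theta> + m)) * f (\<theta> + m) \<partial>affine_lborel)
        = (\<integral>\<^sup>+\<theta>. ennreal (c * haar_density \<theta>) * f \<theta> \<partial>affine_lborel)"
      by (rule translate[OF m, where f = "\<lambda>\<theta>. ennreal (c * haar_density \<theta>) * f \<theta>"]) measurable
    also have "\<dots> = (\<integral>\<^sup>+\<theta>. f \<theta> \<partial>prior c)" by (rule nn_integral_prior[symmetric]) simp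
    finally show "(\<integral>\<^sup>+\<theta>. f (T \<theta> + m) \<partial>prior c) = ennreal (inverse k) * C * (\<integral>\<^sup>+\<theta>. f \<theta> \<partial>prior c)"
      by (simp add: mult.assoc)
  qed
qed

lemma haar_density_mult:
  fixes V U :: "'d::{finite,wellorder} sqmat"
  assumes V: "V \<in> upper" "\<And>i. 0 < V $ i $ i" and U: "U \<in> upper" "W \<in> upper"
    and W: "\<And>i. W $ i $ i = V $ i $ i * U $ i $ i"
  shows "haar_density (W, m') = (\<Prod>i\<in>UNIV. (V $ i $ i) powr (- real (coord_no i))) * haar_density (U, m)"
proof -
  have "0 < W $ i $ i \<longleftrightarrow> 0 < U $ i $ i" for i
    unfolding W using V(2)[of i] by (auto simp: zero_less_mult_iff)
  then have "(W, m') \<in> Theta \<longleftrightarrow> (U, m) \<in> Theta"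
    using U by (simp add: Theta_iff)
  moreover have "(\<Prod>i\<in>UNIV. (W $ i $ i) powr (- real (coord_no i)))
     = (\<Prod>i\<in>UNIV. (V $ i $ i) powr (- real (coord_no i))) * (\<Prod>i\<in>UNIV. (U $ i $ i) powr (- real (coord_no i)))"
    if "(U, m) \<in> Theta"
    unfolding prod.distrib[symmetric] W using that V(2)
    by (auto simp: Theta_iff powr_mult less_imp_le intro!: prod.cong)
  ultimately show ?thesis by (auto simp: haar_density_def split: split_indicator)
qed

lemma invertible_cancel_left:
  fixes V :: "((real, 'n::finite) vec, 'n) vec"
  assumes "invertible V" "V ** A = V ** B" shows "A = B"
proof -
  obtain V' where "V' ** V = mat 1" using assms(1) by (auto simp: invertible_def)
  then show ?thesis using assms(2) by (metis matrix_mul_assoc matrix_mul_lid)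
qed

lemma invertible_cancel_right:
  fixes V :: "((real, 'n::finite) vec, 'n) vec"
  assumes "invertible V" "A ** V = B ** V" shows "A = B"
proof -
  obtain V' where "V ** V' = mat 1" using assms(1) by (auto simp: invertible_def)
  then show ?thesis using assms(2) by (metis matrix_mul_assoc matrix_mul_rid)
qed

lemma prior_left_mult:
  fixes g :: "'d::{finite,wellorder} affine"
  assumes g: "g \<in> Theta" and c: "0 < c"
  obtains C where "0 < C" "C < \<infinity>"
    "\<And>f. f \<in> borel_measurable borel \<Longrightarrow> (\<integral>\<^sup>+\<theta>. f (gmul g \<theta>) \<partial>prior c) = C * (\<integral>\<^sup>+\<theta>. f \<theta> \<partial>prior c)"
proof -
  define T :: "'d affine \<Rightarrow> 'd affine" where "T = (\<lambda>\<theta>. (fst g ** fst \<theta>, fst g *v snd \<theta>))"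
  have g': "fst g \<in> upper" "\<And>i. 0 < fst g $ i $ i" using g by (auto simp: Theta_iff)
  have eq: "gmul g \<theta> = T \<theta> + (0, snd g)" for \<theta> by (simp add: gmul_def T_def)
  have 1: "linear T"
    by (rule linearI) (auto simp: T_def matrix_add_ldistrib matrix_vector_right_distrib
        matrix_vector_mult_scaleR matrix_scalar_ac scalar_mult_eq_scaleR vec_eq_iff matrix_matrix_mult_def
        algebra_simps sum.distrib sum_distrib_left)
  have 2: "inj T"
    using inj_matrix_vector_mult[OF Theta_invertible[OF g]]
    by (intro injI) (auto simp: T_def prod_eq_iff inj_eq dest: invertible_cancel_left[OF Theta_invertible[OF g]])
  have 3: "T ` upper_affine \<subseteq> upper_affine"
    using g' by (auto simp: T_def upper_mult)
  have 4: "(0, snd g) \<in> (upper_affine :: 'd affine set)" by (simp add: upper_def)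
  have 5: "0 < (\<Prod>i\<in>UNIV. (fst g $ i $ i) powr (- real (coord_no i)))"
    by (intro prod_pos) (simp add: less_imp_neq[OF g'(2), symmetric])
  have 6: "haar_density (T \<theta> + (0, snd g)) = (\<Prod>i\<in>UNIV. (fst g $ i $ i) powr (- real (coord_no i))) * haar_density \<theta>"
    if "\<theta> \<in> upper_affine" for \<theta>
    using that g' by (cases \<theta>) (auto simp: T_def upper_mult upper_mult_diag intro!: haar_density_mult)
  show thesis
    using prior_affine_scaling[OF 1 2 3 4 5 6 c] that unfolding eq by blast
qed

lemma prior_right_mult:
  fixes h :: "'d::{finite,wellorder} affine"
  assumes h: "h \<in> Theta" and c: "0 < c"
  obtains C where "0 < C" "C < \<infinity>"
    "\<And>f. f \<in> borel_measurable borel \<Longrightarrow> (\<integral>\<^sup>+\<theta>. f (gmul \<theta> h) \<partial>prior c) = C * (\<integral>\<^sup>+\<theta>. f \<theta> \<partial>prior c)"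
proof -
  define T :: "'d affine \<Rightarrow> 'd affine" where "T = (\<lambda>\<theta>. (fst \<theta> ** fst h, fst \<theta> *v snd h + snd \<theta>))"
  have h': "fst h \<in> upper" "\<And>i. 0 < fst h $ i $ i" using h by (auto simp: Theta_iff)
  have eq: "gmul \<theta> h = T \<theta> + 0" for \<theta> by (simp add: gmul_def T_def)
  have 1: "linear T"
    by (rule linearI) (auto simp: T_def vec_eq_iff matrix_matrix_mult_def matrix_vector_mult_def
        algebra_simps sum.distrib sum_distrib_left)
  have 2: "inj T"
    by (intro injI) (auto simp: T_def prod_eq_iff dest!: invertible_cancel_right[OF Theta_invertible[OF h]])
  have 3: "T ` upper_affine \<subseteq> upper_affine"
    using h' by (auto simp: T_def upper_mult)
  have 4: "0 \<in> (upper_affine :: 'd affine set)" by (simp add: upper_def zero_prod_def)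
  have 5: "0 < (\<Prod>i\<in>UNIV. (fst h $ i $ i) powr (- real (coord_no i)))"
    by (intro prod_pos) (simp add: less_imp_neq[OF h'(2), symmetric])
  have 6: "haar_density (T \<theta> + 0) = (\<Prod>i\<in>UNIV. (fst h $ i $ i) powr (- real (coord_no i))) * haar_density \<theta>"
    if "\<theta> \<in> upper_affine" for \<theta>
    using that h' by (cases \<theta>) (auto simp: T_def upper_mult upper_mult_diag intro!: haar_density_mult)
  show thesis
    using prior_affine_scaling[OF 1 2 3 4 5 6 c] that unfolding eq by blast
qed

section \<open>Foelner boxes\<close>

text \<open>
  A box in the coordinates \<open>ln U\<^sub>j\<^sub>j\<close>, \<open>U\<^sub>i\<^sub>j / U\<^sub>j\<^sub>j\<close> (for \<open>i < j\<close>) and \<open>m\<^sub>i\<close> of a parameter \<open>(U, m)\<close>. In these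
  coordinates the prior is a multiple of Lebesgue measure.
\<close>

definition box_set :: "real \<Rightarrow> ('d::{finite,wellorder} \<Rightarrow> real) \<Rightarrow> real \<Rightarrow> 'd affine set" where
  "box_set a b r = {\<theta> \<in> Theta.
     (\<forall>i. exp (- a) \<le> fst \<theta> $ i $ i \<and> fst \<theta> $ i $ i \<le> exp a) \<and>
     (\<forall>i j. i < j \<longrightarrow> \<bar>fst \<theta> $ i $ j\<bar> \<le> b j * fst \<theta> $ j $ j) \<and>
     (\<forall>i. \<bar>snd \<theta> $ i\<bar> \<le> r)}"

lemma box_set_borel [measurable]: "(box_set a b r :: ('d::{finite,wellorder} affine) set) \<in> sets borel"
proof -
  have "(box_set a b r :: 'd affine set) = {\<theta>\<in>space borel. \<theta> \<in> Theta \<and>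
     (\<forall>i. exp (- a) \<le> fst \<theta> $ i $ i \<and> fst \<theta> $ i $ i \<le> exp a) \<and>
     (\<forall>i j. i < j \<longrightarrow> \<bar>fst \<theta> $ i $ j\<bar> \<le> b j * fst \<theta> $ j $ j) \<and>
     (\<forall>i. \<bar>snd \<theta> $ i\<bar> \<le> r)}"
    by (auto simp: box_set_def)
  also have "\<dots> \<in> sets borel" by measurable
  finally show ?thesis .
qed

lemma coord_no_eq: "coord_no (j :: 'd::{finite,wellorder}) = Suc (card {..<j})"
proof -
  have "{..j} = insert j {..<j}" by auto
  then show ?thesis by simp
qed

lemma nn_integral_inverse_log:
  assumes "0 \<le> a"
  shows "(\<integral>\<^sup>+t. ennreal (indicator {exp (- a)..exp a} t / t) \<partial>lborel) = ennreal (2 * a)"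
proof -
  have "(\<integral>\<^sup>+t. ennreal (indicator {exp (- a)..exp a} t / t) \<partial>lborel)
      = (\<integral>\<^sup>+t. ennreal (inverse t) * indicator {exp (- a)..exp a} t \<partial>lborel)"
    by (intro nn_integral_cong) (auto simp: divide_inverse split: split_indicator)
  also have "\<dots> = ennreal (ln (exp a) - ln (exp (- a)))"
  proof (rule nn_integral_FTC_Icc)
    fix t assume t: "t \<in> {exp (- a)..exp a}"
    have "0 < exp (- a)" by simp
    then have t0: "0 < t" using t by (auto simp del: exp_gt_zero intro: less_le_trans)
    show "0 \<le> inverse t" using t0 by simp
    show "(ln has_real_derivative inverse t) (at t)" by (rule DERIV_ln[OF t0])
  qed (use assms in simp_all)
  finally show ?thesis by simp
qed

lemma nn_integral_abs_le:
  fixes s :: real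
  shows "(\<integral>\<^sup>+t. ennreal (indicator {x. \<bar>x\<bar> \<le> s} t) \<partial>lborel) = ennreal (2 * s)"
proof -
  have "{x. \<bar>x\<bar> \<le> s} = {- s..s}" by auto
  then show ?thesis by (auto simp: ennreal_indicator emeasure_lborel_Icc_eq ennreal_neg)
qed

lemma prod_off_diagonal:
  fixes g :: "'d::{finite,wellorder} \<Rightarrow> 'a::comm_monoid_mult"
  shows "(\<Prod>p\<in>{(i, j). i < j}. g (snd p)) = (\<Prod>j\<in>UNIV. g j ^ card {..<j})"
proof -
  have "(\<Prod>p\<in>{(i, j). i < j}. g (snd p)) = (\<Prod>p\<in>prod.swap ` Sigma UNIV (\<lambda>j. {..<j}). g (snd p))"
    by (intro prod.cong) auto
  also have "\<dots> = (\<Prod>(j, i)\<in>Sigma UNIV (\<lambda>j. {..<j}). g j)"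
    by (subst prod.reindex) (auto simp: case_prod_beta intro: inj_onI)
  also have "\<dots> = (\<Prod>j\<in>UNIV. \<Prod>i\<in>{..<j}. g j)"
    by (rule prod.Sigma[symmetric]) auto
  finally show ?thesis by simp
qed

definition upper_box_density :: "real \<Rightarrow> ('d::{finite,wellorder} \<Rightarrow> real) \<Rightarrow> 'd sqmat \<Rightarrow> real" where
  "upper_box_density a b U =
     (\<Prod>i\<in>UNIV. indicator {exp (- a)..exp a} (U $ i $ i) * (U $ i $ i) powr (- real (coord_no i))) *
     (\<Prod>p\<in>{(i, j). i < j}. indicator {U. \<bar>U $ fst p $ snd p\<bar> \<le> b (snd p) * U $ snd p $ snd p} U)"

lemma borel_measurable_upper_box_density [measurable]:
  "upper_box_density a b \<in> borel_measurable borel"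
  unfolding upper_box_density_def[abs_def] by measurable

text \<open>
  For fixed diagonal, the \<open>j - 1\<close> entries above the diagonal of column \<open>j\<close> contribute
  \<open>(2 b\<^sub>j U\<^sub>j\<^sub>j)\<^bsup>j-1\<^esup>\<close>; together with the prior density \<open>U\<^sub>j\<^sub>j\<^bsup>-j\<^esup>\<close> this leaves \<open>dU\<^sub>j\<^sub>j / U\<^sub>j\<^sub>j\<close>, whose integral
  over the logarithmic interval is \<open>2 a\<close>.
\<close>

lemma nn_integral_upper_box:
  fixes b :: "'d::{finite,wellorder} \<Rightarrow> real"
  assumes a: "0 \<le> a" and b: "\<And>j. 0 \<le> b j"
  shows "(\<integral>\<^sup>+U. ennreal (upper_box_density a b U) \<partial>upper_lborel)
     = ennreal (\<Prod>j\<in>UNIV. (2 * b j) ^ card {..<j} * (2 * a))"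
proof -
  let ?D = "{p :: 'd \<times> 'd. fst p = snd p}" let ?O = "{(i :: 'd, j :: 'd). i < j}"
  interpret product_sigma_finite "\<lambda>_::'d\<times>'d. lborel :: real measure" ..
  let ?P = "\<lambda>I. \<Pi>\<^sub>M p\<in>I. (lborel :: real measure)"
  define h where "h = (\<lambda>(i :: 'd) t. indicator {exp (- a)..exp a} t * t powr (- real (coord_no i)) :: real)"
  have h0: "0 \<le> h i t" for i t by (simp add: h_def)
  have hm [measurable]: "h i \<in> borel_measurable borel" for i unfolding h_def by measurable
  have U: "upper_pairs = ?D \<union> ?O" by auto
  have disj: "?D \<inter> ?O = {}" by auto
  let ?F = "\<lambda>u. ennreal ((\<Prod>p\<in>?D. h (fst p) (u p)) * (\<Prod>p\<in>?O. indicator {x. \<bar>x\<bar> \<le> b (snd p) * u (snd p, snd p)} (u p)))"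
  have comp [measurable]: "(\<lambda>u. u p) \<in> borel_measurable (?P (?D \<union> ?O))" if "p \<in> ?D \<union> ?O" for p
    using measurable_component_singleton[OF that, of "\<lambda>_. lborel :: real measure"] by simp
  have ind: "(\<lambda>u. indicator {x. \<bar>x\<bar> \<le> b (snd p) * u (snd p, snd p)} (u p) :: real) \<in> borel_measurable (?P (?D \<union> ?O))"
    if "p \<in> ?O" for p
  proof -
    have [measurable]: "(\<lambda>u. u p) \<in> borel_measurable (?P (?D \<union> ?O))"
      "(\<lambda>u. u (snd p, snd p)) \<in> borel_measurable (?P (?D \<union> ?O))"
      using that by (auto intro!: comp)
    have "(\<lambda>u. if \<bar>u p\<bar> \<le> b (snd p) * u (snd p, snd p) then 1 else 0 :: real) \<in> borel_measurable (?P (?D \<union> ?O))"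
      by measurable
    then show ?thesis by (simp add: indicator_def of_bool_def)
  qed
  have Fm: "?F \<in> borel_measurable (?P (?D \<union> ?O))"
    by (intro measurable_compose[OF _ measurable_ennreal] borel_measurable_times borel_measurable_prod
        measurable_compose[OF comp hm] ind) auto
  have diag: "(\<Prod>p\<in>?D. f (fst p) (u p)) = (\<Prod>i\<in>UNIV. f i (u (i, i)))" for f :: "'d \<Rightarrow> real \<Rightarrow> real" and u
    by (rule prod.reindex_bij_witness[of _ "\<lambda>i. (i, i)" fst]) auto
  have "(\<integral>\<^sup>+U. ennreal (upper_box_density a b U) \<partial>upper_lborel)
      = (\<integral>\<^sup>+u. ennreal (upper_box_density a b (upper_fill u)) \<partial>?P upper_pairs)"
    by (rule nn_integral_upper_lborel) measurable
  also have "\<dots> = (\<integral>\<^sup>+u. ?F u \<partial>?P (?D \<union> ?O))"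
  proof -
    have "(\<Prod>p\<in>?O. indicator {U. \<bar>U $ fst p $ snd p\<bar> \<le> b (snd p) * U $ snd p $ snd p} (upper_fill u) :: real)
        = (\<Prod>p\<in>?O. indicator {x. \<bar>x\<bar> \<le> b (snd p) * u (snd p, snd p)} (u p))" for u
      by (intro prod.cong) (auto simp: upper_fill_nth indicator_def)
    then show ?thesis unfolding diag U upper_box_density_def by (simp add: upper_fill_nth h_def)
  qed
  also have "\<dots> = (\<integral>\<^sup>+x. (\<integral>\<^sup>+y. ?F (merge ?D ?O (x, y)) \<partial>?P ?O) \<partial>?P ?D)"
    using disj Fm by (intro product_nn_integral_fold) auto
  also have "\<dots> = (\<integral>\<^sup>+x. (\<Prod>p\<in>?D. ennreal ((2 * b (fst p)) ^ card {..<fst p} * (indicator {exp (- a)..exp a} (x p) / x p))) \<partial>?P ?D)"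
  proof (rule nn_integral_cong)
    fix x :: "'d \<times> 'd \<Rightarrow> real"
    let ?g = "\<lambda>j. b j * x (j, j)"
    have mD: "merge ?D ?O (x, y) (i, i) = x (i, i)" for y i by (simp add: merge_def)
    have mO: "merge ?D ?O (x, y) p = y p" if "p \<in> ?O" for y p using that by (auto simp: merge_def)
    have "(\<integral>\<^sup>+y. ?F (merge ?D ?O (x, y)) \<partial>?P ?O)
       = (\<integral>\<^sup>+y. ennreal (\<Prod>i\<in>UNIV. h i (x (i, i))) * (\<Prod>p\<in>?O. ennreal (indicator {x. \<bar>x\<bar> \<le> ?g (snd p)} (y p))) \<partial>?P ?O)"
      unfolding diag by (intro nn_integral_cong) (simp add: mD mO prod_ennreal ennreal_mult'' prod_nonneg h0)
    also have "\<dots> = ennreal (\<Prod>i\<in>UNIV. h i (x (i, i))) * (\<integral>\<^sup>+y. (\<Prod>p\<in>?O. ennreal (indicator {x. \<bar>x\<bar> \<le> ?g (snd p)} (y p))) \<partial>?P ?O)"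
    proof (rule nn_integral_cmult)
      show "(\<lambda>y. \<Prod>p\<in>?O. ennreal (indicator {x. \<bar>x\<bar> \<le> ?g (snd p)} (y p))) \<in> borel_measurable (?P ?O)"
      proof (rule borel_measurable_prod_ennreal)
        fix p :: "'d \<times> 'd" assume p: "p \<in> ?O"
        have [measurable]: "(\<lambda>y. y p) \<in> borel_measurable (?P ?O)"
          using measurable_component_singleton[OF p, of "\<lambda>_. lborel :: real measure"] by simp
        show "(\<lambda>y. ennreal (indicator {x. \<bar>x\<bar> \<le> ?g (snd p)} (y p))) \<in> borel_measurable (?P ?O)"
          by measurable
      qed
    qed
    also have "(\<integral>\<^sup>+y. (\<Prod>p\<in>?O. ennreal (indicator {x. \<bar>x\<bar> \<le> ?g (snd p)} (y p))) \<partial>?P ?O)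
       = (\<Prod>p\<in>?O. \<integral>\<^sup>+t. ennreal (indicator {x. \<bar>x\<bar> \<le> ?g (snd p)} t) \<partial>lborel)"
      by (rule product_nn_integral_prod) auto
    also have "\<dots> = (\<Prod>p\<in>?O. ennreal (2 * ?g (snd p)))"
      by (simp only: nn_integral_abs_le)
    also have "\<dots> = (\<Prod>j\<in>UNIV. ennreal (2 * ?g j) ^ card {..<j})" by (rule prod_off_diagonal)
    also have "ennreal (\<Prod>i\<in>UNIV. h i (x (i, i))) * (\<Prod>j\<in>UNIV. ennreal (2 * ?g j) ^ card {..<j})
       = (\<Prod>j\<in>UNIV. ennreal (h j (x (j, j))) * ennreal (2 * ?g j) ^ card {..<j})"
      by (simp add: prod.distrib prod_ennreal h0)
    also have "\<dots> = (\<Prod>j\<in>UNIV. ennreal ((2 * b j) ^ card {..<j} * (indicator {exp (- a)..exp a} (x (j, j)) / x (j, j))))"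
    proof (intro prod.cong refl)
      fix j :: 'd
      show "ennreal (h j (x (j, j))) * ennreal (2 * ?g j) ^ card {..<j}
          = ennreal ((2 * b j) ^ card {..<j} * (indicator {exp (- a)..exp a} (x (j, j)) / x (j, j)))"
      proof (cases "x (j, j) \<in> {exp (- a)..exp a}")
        case True
        have "0 < exp (- a)" by simp
        then have x0: "0 < x (j, j)" using True by (simp del: exp_gt_zero)
        have "x (j, j) powr (- real (coord_no j)) * x (j, j) ^ card {..<j} = 1 / x (j, j)"
        proof -
          have "x (j, j) powr (- real (coord_no j)) = inverse (x (j, j) ^ coord_no j)"
            using x0 by (simp only: powr_minus powr_realpow)
          then show ?thesis using x0 by (simp only: coord_no_eq) (simp add: field_simps)
        qed
        then have "h j (x (j, j)) * (2 * ?g j) ^ card {..<j} = (2 * b j) ^ card {..<j} * (1 / x (j, j))"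
          using True by (simp add: h_def power_mult_distrib mult_ac)
        then show ?thesis using True x0 b h0
          by (simp add: ennreal_power ennreal_mult''[symmetric])
      qed (simp add: h_def)
    qed
    also have "\<dots> = (\<Prod>p\<in>?D. ennreal ((2 * b (fst p)) ^ card {..<fst p} * (indicator {exp (- a)..exp a} (x p) / x p)))"
      by (rule prod.reindex_bij_witness[of _ fst "\<lambda>i. (i, i)"]) auto
    finally show "(\<integral>\<^sup>+y. ?F (merge ?D ?O (x, y)) \<partial>?P ?O)
       = (\<Prod>p\<in>?D. ennreal ((2 * b (fst p)) ^ card {..<fst p} * (indicator {exp (- a)..exp a} (x p) / x p)))" .
  qed
  also have "\<dots> = (\<Prod>p\<in>?D. \<integral>\<^sup>+t. ennreal ((2 * b (fst p)) ^ card {..<fst p} * (indicator {exp (- a)..exp a} t / t)) \<partial>lborel)"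
    by (rule product_nn_integral_prod) auto
  also have "\<dots> = (\<Prod>p\<in>?D. ennreal ((2 * b (fst p)) ^ card {..<fst p} * (2 * a)))"
  proof (intro prod.cong refl)
    fix p :: "'d \<times> 'd"
    have "0 \<le> indicator {exp (- a)..exp a} t / t" for t :: real
      using exp_gt_zero[of "- a"] by (auto simp: indicator_def simp del: exp_gt_zero)
    then show "(\<integral>\<^sup>+t. ennreal ((2 * b (fst p)) ^ card {..<fst p} * (indicator {exp (- a)..exp a} t / t)) \<partial>lborel)
       = ennreal ((2 * b (fst p)) ^ card {..<fst p} * (2 * a))"
      using b a by (simp add: ennreal_mult'' ennreal_mult nn_integral_cmult nn_integral_inverse_log del: times_divide_eq_right)
  qed
  also have "\<dots> = (\<Prod>j\<in>UNIV. ennreal ((2 * b j) ^ card {..<j} * (2 * a)))"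
    by (rule prod.reindex_bij_witness[of _ "\<lambda>i. (i, i)" fst]) auto
  also have "\<dots> = ennreal (\<Prod>j\<in>UNIV. (2 * b j) ^ card {..<j} * (2 * a))"
    using a b by (intro prod_ennreal) simp
  finally show ?thesis .
qed

lemma emeasure_prior_box:
  fixes b :: "'d::{finite,wellorder} \<Rightarrow> real"
  assumes a: "0 \<le> a" and b: "\<And>j. 0 \<le> b j" and r: "0 \<le> r" and c: "0 < c"
  shows "emeasure (prior c) (box_set a b r)
    = ennreal (c * (\<Prod>j\<in>UNIV. (2 * b j) ^ card {..<j} * (2 * a)) * (2 * r) ^ CARD('d))"
proof -
  let ?G = "upper_box_density a b"
  define H :: "'d rvec \<Rightarrow> real" where "H = (\<lambda>\<mu>. \<Prod>i\<in>UNIV. indicator {x. \<bar>x\<bar> \<le> r} (\<mu> $ i))"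
  interpret U: subspace_lebesgue upper "upper_lborel :: 'd sqmat measure" by (rule subspace_lebesgue_upper)
  have H0: "0 \<le> H m" for m unfolding H_def by (intro prod_nonneg) auto
  have Hm [measurable]: "H \<in> borel_measurable borel" unfolding H_def by measurable
  have eq: "haar_density (U, m) * indicator (box_set a b r) (U, m) = ?G U * H m" if "U \<in> upper" for U m
  proof (cases "(U, m) \<in> box_set a b r")
    case True
    then have "?G U = (\<Prod>i\<in>UNIV. (U $ i $ i) powr (- real (coord_no i)))" "H m = 1" "(U, m) \<in> Theta"
      by (auto simp: box_set_def upper_box_density_def H_def intro!: prod.neutral)
    then show ?thesis using True by (simp add: haar_density_def)
  next
    case False
    have pos: "0 < U $ i $ i" if "exp (- a) \<le> U $ i $ i" for i
      using that exp_gt_zero[of "- a"] by linarith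
    have "?G U * H m = 0"
    proof (rule ccontr)
      assume "?G U * H m \<noteq> 0"
      then have "\<forall>i. U $ i $ i \<in> {exp (- a)..exp a}" "\<forall>i j. i < j \<longrightarrow> \<bar>U $ i $ j\<bar> \<le> b j * U $ j $ j"
        "\<forall>i. \<bar>m $ i\<bar> \<le> r"
        by (auto simp: upper_box_density_def H_def indicator_def)
      then have "(U, m) \<in> box_set a b r" using \<open>U \<in> upper\<close> pos by (auto simp: box_set_def Theta_iff)
      then show False using False by simp
    qed
    then show ?thesis using False by simp
  qed
  have "emeasure (prior c) (box_set a b r) = (\<integral>\<^sup>+\<theta>. indicator (box_set a b r) \<theta> \<partial>prior c)"
    by (simp add: sets_prior)
  also have "\<dots> = (\<integral>\<^sup>+\<theta>. ennreal (c * haar_density \<theta>) * indicator (box_set a b r) \<theta> \<partial>affine_lborel)"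
    by (rule nn_integral_prior) simp
  also have "\<dots> = (\<integral>\<^sup>+\<theta>. (case \<theta> of (U, m) \<Rightarrow> ennreal (c * ?G U) * ennreal (H m)) \<partial>affine_lborel)"
  proof (rule nn_integral_cong_AE)
    show "AE \<theta> in affine_lborel. ennreal (c * haar_density \<theta>) * indicator (box_set a b r) \<theta>
        = (case \<theta> of (U, m) \<Rightarrow> ennreal (c * ?G U) * ennreal (H m))"
      using subspace_lebesgue.AE_subspace[OF subspace_lebesgue_affine]
    proof eventually_elim
      case (elim \<theta>)
      obtain U m where \<theta>: "\<theta> = (U, m)" "U \<in> upper" using elim by auto
      have "ennreal (c * haar_density \<theta>) * indicator (box_set a b r) \<theta>
          = ennreal (c * (haar_density (U, m) * indicator (box_set a b r) (U, m)))"
        by (simp add: \<theta> split: split_indicator)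
      also have "\<dots> = ennreal (c * ?G U) * ennreal (H m)"
        unfolding eq[OF \<theta>(2)] by (simp add: ennreal_mult''[symmetric] H0 mult.assoc)
      finally show ?case by (simp add: \<theta>)
    qed
  qed
  also have "\<dots> = (\<integral>\<^sup>+U. (\<integral>\<^sup>+m. ennreal (c * ?G U) * ennreal (H m) \<partial>lborel) \<partial>upper_lborel)"
    using lborel.nn_integral_fst[of "\<lambda>(U, m). ennreal (c * ?G U) * ennreal (H m)" upper_lborel] by simp
  also have "\<dots> = ennreal c * (\<integral>\<^sup>+U. ennreal (?G U) \<partial>upper_lborel) * (\<integral>\<^sup>+m. ennreal (H m) \<partial>lborel)"
    using c by (simp add: nn_integral_cmult nn_integral_multc ennreal_mult' mult.assoc)
  also have "(\<integral>\<^sup>+m. ennreal (H m) \<partial>lborel) = (\<Prod>i\<in>(UNIV :: 'd set). \<integral>\<^sup>+x. ennreal (indicator {x. \<bar>x\<bar> \<le> r} x) \<partial>lborel)"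
    unfolding H_def by (subst nn_integral_lborel_vec_prod[symmetric]) (auto simp: prod_ennreal)
  also have "\<dots> = ennreal ((2 * r) ^ CARD('d))"
    using r by (simp only: nn_integral_abs_le) (simp add: ennreal_power)
  also have "(\<integral>\<^sup>+U. ennreal (?G U) \<partial>upper_lborel) = ennreal (\<Prod>j\<in>UNIV. (2 * b j) ^ card {..<j} * (2 * a))"
    by (rule nn_integral_upper_box[OF a b])
  finally show ?thesis
    using a b r c by (simp add: ennreal_mult''[symmetric] prod_nonneg)
qed

text \<open>
  The bound on \<open>U\<^sub>i\<^sub>j / U\<^sub>j\<^sub>j\<close> grows by the factor \<open>exp (3 N)\<close> from each column to the next. A right
  translation by \<open>k\<close> shifts \<open>ln U\<^sub>j\<^sub>j\<close> by a constant and adds to \<open>U\<^sub>i\<^sub>j / U\<^sub>j\<^sub>j\<close> multiples of entries of earlier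
  columns, with coefficients of size at most \<open>exp (2 N)\<close> coming from the diagonal. So each side of the
  box is moved by a vanishing fraction of its length. The translation part \<open>m\<close> plays the role of column
  \<open>d + 1\<close>.
\<close>

definition foelner :: "nat \<Rightarrow> ('d::{finite,wellorder} affine) set" where
  "foelner N = box_set (real N) (\<lambda>j. exp (3 * real N * real (coord_no j))) (exp (3 * real N * (real CARD('d) + 1)))"

lemma foelner_borel [measurable]: "(foelner N :: ('d::{finite,wellorder} affine) set) \<in> sets borel"
  unfolding foelner_def by measurable

lemma foelner_Theta: "foelner N \<subseteq> Theta"
  by (auto simp: foelner_def box_set_def)

lemma coord_no_less:
  assumes "i < (j :: 'd::{finite,wellorder})" shows "real (coord_no i) + 1 \<le> real (coord_no j)"
proof -
  have "{..i} \<subset> {..j}" using assms by auto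
  then have "coord_no i < coord_no j" by (intro psubset_card_mono) auto
  then show ?thesis by linarith
qed

lemma coord_no_le_card: "real (coord_no (i :: 'd::{finite,wellorder})) \<le> real CARD('d)"
  by (simp add: card_mono)

text \<open>
  If the box is shrunk by \<open>M\<close> in the coordinates \<open>ln U\<^sub>j\<^sub>j\<close> and by the factor \<open>1 - M exp (- N)\<close> in the
  others, then it stays inside the Foelner box after right translation by \<open>k\<close>.
\<close>

lemma foelner_shift:
  fixes k :: "'d::{finite,wellorder} affine"
  assumes k: "k \<in> Theta"
  obtains M where "0 < M"
    "\<And>N \<theta>. \<theta> \<in> box_set (real N - M) (\<lambda>j. exp (3 * real N * real (coord_no j)) * (1 - M * exp (- real N)))
             (exp (3 * real N * (real CARD('d) + 1)) * (1 - M * exp (- real N)))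
       \<Longrightarrow> \<theta> \<in> foelner N \<and> gmul \<theta> k \<in> foelner N"
proof -
  let ?K = "fst k" let ?d = "real CARD('d)"
  have K: "?K \<in> upper" "\<And>i. 0 < ?K $ i $ i" using k by (auto simp: Theta_iff)
  (* The three sums bound the shift of the logarithms, the relative size of the entries of K in a
     column, and the translation part. *)
  define M where "M = 1 + (\<Sum>i\<in>UNIV. \<bar>ln (?K $ i $ i)\<bar>) + (\<Sum>l\<in>UNIV. \<Sum>j\<in>UNIV. ?d * \<bar>?K $ l $ j\<bar> / ?K $ j $ j)
     + (\<Sum>l\<in>UNIV. ?d * \<bar>snd k $ l\<bar>)"
  have n1: "0 \<le> (\<Sum>i\<in>UNIV. \<bar>ln (?K $ i $ i)\<bar>)" and n3: "0 \<le> (\<Sum>l\<in>UNIV. ?d * \<bar>snd k $ l\<bar>)"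
    by (auto intro!: sum_nonneg)
  have n2': "0 \<le> ?d * \<bar>?K $ l $ j\<bar> / ?K $ j $ j" for l j
    using K(2)[of j] by simp
  then have n2: "0 \<le> (\<Sum>l\<in>UNIV. \<Sum>j\<in>UNIV. ?d * \<bar>?K $ l $ j\<bar> / ?K $ j $ j)"
    by (intro sum_nonneg) auto
  have M0: "0 < M" using n1 n2 n3 unfolding M_def by linarith
  have M1: "\<bar>ln (?K $ i $ i)\<bar> \<le> M" for i
  proof -
    have "\<bar>ln (?K $ i $ i)\<bar> \<le> (\<Sum>i\<in>UNIV. \<bar>ln (?K $ i $ i)\<bar>)" by (rule member_le_sum) auto
    then show ?thesis using n2 n3 unfolding M_def by linarith
  qed
  have M2: "?d * \<bar>?K $ l $ j\<bar> \<le> M * ?K $ j $ j" for l j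
  proof -
    have "?d * \<bar>?K $ l $ j\<bar> / ?K $ j $ j \<le> (\<Sum>j\<in>UNIV. ?d * \<bar>?K $ l $ j\<bar> / ?K $ j $ j)"
      using n2' by (intro member_le_sum) auto
    also have "\<dots> \<le> (\<Sum>l\<in>UNIV. \<Sum>j\<in>UNIV. ?d * \<bar>?K $ l $ j\<bar> / ?K $ j $ j)"
      using n2' by (intro member_le_sum[of l UNIV "\<lambda>l. \<Sum>j\<in>UNIV. ?d * \<bar>?K $ l $ j\<bar> / ?K $ j $ j"] sum_nonneg) auto
    also have "\<dots> \<le> M" using n1 n3 unfolding M_def by linarith
    finally show ?thesis using K(2)[of j] by (simp add: field_simps)
  qed
  have M3: "?d * \<bar>snd k $ l\<bar> \<le> M" for l
  proof -
    have "?d * \<bar>snd k $ l\<bar> \<le> (\<Sum>l\<in>UNIV. ?d * \<bar>snd k $ l\<bar>)" by (rule member_le_sum) auto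
    then show ?thesis using n1 n2 unfolding M_def by linarith
  qed
  show thesis
  proof (rule that[OF M0], intro conjI)
    fix N :: nat and \<theta> :: "'d affine"
    define n where "n = real N"
    define \<delta> where "\<delta> = M * exp (- n)"
    define b where "b = (\<lambda>j :: 'd. exp (3 * n * real (coord_no j)))"
    define r where "r = exp (3 * n * (?d + 1))"
    let ?U = "fst \<theta>"
    assume "\<theta> \<in> box_set (real N - M) (\<lambda>j. exp (3 * real N * real (coord_no j)) * (1 - M * exp (- real N)))
             (exp (3 * real N * (real CARD('d) + 1)) * (1 - M * exp (- real N)))"
    then have th: "\<theta> \<in> box_set (n - M) (\<lambda>j. b j * (1 - \<delta>)) (r * (1 - \<delta>))"
      unfolding n_def b_def \<delta>_def r_def .
    have fo: "foelner N = box_set n b r" by (simp add: foelner_def n_def b_def r_def)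
    have n0: "0 \<le> n" by (simp add: n_def)
    have d0: "0 \<le> \<delta>" using M0 by (simp add: \<delta>_def)
    have U: "?U \<in> upper" "\<And>i. 0 < ?U $ i $ i" using th by (auto simp: box_set_def Theta_iff)
    have U1: "exp (- (n - M)) \<le> ?U $ i $ i" "?U $ i $ i \<le> exp (n - M)" for i
      using th by (auto simp: box_set_def)
    have U2: "\<bar>?U $ i $ j\<bar> \<le> b j * (1 - \<delta>) * ?U $ j $ j" if "i < j" for i j
      using th that by (auto simp: box_set_def)
    have U3: "\<bar>snd \<theta> $ i\<bar> \<le> r * (1 - \<delta>)" for i
      using th by (auto simp: box_set_def)
    have U1': "exp (- n) \<le> ?U $ i $ i" "?U $ i $ i \<le> exp n" for i
      using order_trans[of "exp (- n)", OF _ U1(1)[of i]] order_trans[OF U1(2)[of i], of "exp n"] M0 by auto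
    have b1: "1 \<le> b j" for j using n0 by (simp add: b_def)
    have r0: "0 < r" by (simp add: r_def)
    have U2': "\<bar>?U $ i $ j\<bar> \<le> b j * ?U $ j $ j" if "i < j" for i j
    proof -
      have "b j * (1 - \<delta>) * ?U $ j $ j \<le> b j * 1 * ?U $ j $ j"
        using d0 b1[of j] U(2)[of j] by (intro mult_right_mono mult_left_mono) auto
      then show ?thesis using U2[OF that] by simp
    qed
    have "r * (1 - \<delta>) \<le> r * 1" using d0 r0 by (intro mult_left_mono) auto
    then have U3': "\<bar>snd \<theta> $ i\<bar> \<le> r" for i using U3[of i] by simp
    show "\<theta> \<in> foelner N"
      unfolding fo box_set_def using th U1' U2' U3' by (auto simp: box_set_def)
    have Ub: "\<bar>?U $ i $ l\<bar> \<le> b l * exp n" for i l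
    proof (cases i l rule: linorder_cases)
      case less
      have "\<bar>?U $ i $ l\<bar> \<le> b l * ?U $ l $ l" by (rule U2'[OF less])
      also have "\<dots> \<le> b l * exp n" using b1[of l] U1'(2)[of l] by (intro mult_left_mono) auto
      finally show ?thesis .
    next
      case equal
      have "?U $ i $ i \<le> 1 * exp n" using U1'(2)[of i] by simp
      also have "\<dots> \<le> b i * exp n" using b1[of i] by (intro mult_right_mono) auto
      finally show ?thesis using equal U(2)[of i] by simp
    next
      case greater
      then have "?U $ i $ l = 0" using U(1) by (simp add: upper_def)
      then show ?thesis using b1[of l] by simp
    qed
    have UK: "fst (gmul \<theta> k) $ i $ j = (\<Sum>l\<in>{i..j}. ?U $ i $ l * ?K $ l $ j)" for i j
      by (simp add: gmul_def upper_mult_nth[OF U(1) K(1)])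
    have t1: "gmul \<theta> k \<in> Theta" using th k by (auto intro!: gmul_Theta simp: box_set_def)
    have t2: "exp (- n) \<le> fst (gmul \<theta> k) $ i $ i \<and> fst (gmul \<theta> k) $ i $ i \<le> exp n" for i
    proof -
      have e: "exp (- M) \<le> ?K $ i $ i" "?K $ i $ i \<le> exp M"
        using M1[of i] K(2)[of i] by (auto simp: abs_le_iff ln_ge_iff ln_le_cancel_iff minus_le_iff) (metis exp_le_cancel_iff exp_ln)
      have "exp (- n) = exp (- (n - M)) * exp (- M)" by (simp add: mult_exp_exp)
      also have "\<dots> \<le> ?U $ i $ i * ?K $ i $ i"
        using U1(1)[of i] e U(2)[of i] by (intro mult_mono) auto
      finally have 1: "exp (- n) \<le> ?U $ i $ i * ?K $ i $ i" .
      have "?U $ i $ i * ?K $ i $ i \<le> exp (n - M) * exp M"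
        using U1(2)[of i] e K(2)[of i] by (intro mult_mono) auto
      also have "\<dots> = exp n" by (simp add: mult_exp_exp)
      finally show ?thesis using 1 by (simp add: UK)
    qed
    have t3: "\<bar>fst (gmul \<theta> k) $ i $ j\<bar> \<le> b j * fst (gmul \<theta> k) $ j $ j" if ij: "i < j" for i j
    proof -
      have split: "{i..j} = insert j {i..<j}" using ij by auto
      have "\<bar>\<Sum>l\<in>{i..<j}. ?U $ i $ l * ?K $ l $ j\<bar> \<le> (\<Sum>l\<in>{i..<j}. \<bar>?U $ i $ l * ?K $ l $ j\<bar>)"
        by (rule sum_abs)
      also have "\<dots> \<le> (\<Sum>l\<in>{i..<j}. b j * exp (- 2 * n) * (M * ?K $ j $ j / ?d))"
      proof (rule sum_mono)
        fix l assume l: "l \<in> {i..<j}"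
        have "\<bar>?U $ i $ l\<bar> \<le> b l * exp n" by (rule Ub)
        also have "\<dots> \<le> b j * exp (- 2 * n)"
        proof -
          have "3 * n * (real (coord_no l) + 1) \<le> 3 * n * real (coord_no j)"
            using l n0 by (intro mult_left_mono coord_no_less) auto
          then show ?thesis by (simp add: b_def mult_exp_exp algebra_simps)
        qed
        finally have 1: "\<bar>?U $ i $ l\<bar> \<le> b j * exp (- 2 * n)" .
        have 2: "\<bar>?K $ l $ j\<bar> \<le> M * ?K $ j $ j / ?d"
          using M2[of l j] by (simp add: field_simps)
        show "\<bar>?U $ i $ l * ?K $ l $ j\<bar> \<le> b j * exp (- 2 * n) * (M * ?K $ j $ j / ?d)"
          unfolding abs_mult using 1 2 by (rule mult_mono) (use b1[of j] in auto)
      qed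
      also have "\<dots> \<le> ?d * (b j * exp (- 2 * n) * (M * ?K $ j $ j / ?d))"
      proof -
        have "0 \<le> b j * exp (- 2 * n) * (M * ?K $ j $ j / ?d)"
          using b1[of j] M0 K(2)[of j] by (intro mult_nonneg_nonneg) auto
        moreover have "real (card {i..<j}) \<le> ?d" by (simp add: card_mono)
        ultimately have "real (card {i..<j}) * (b j * exp (- 2 * n) * (M * ?K $ j $ j / ?d)) \<le> ?d * (b j * exp (- 2 * n) * (M * ?K $ j $ j / ?d))"
          by (rule mult_right_mono[rotated])
        then show ?thesis by simp
      qed
      also have "\<dots> = b j * \<delta> * exp (- n) * ?K $ j $ j"
        by (simp add: \<delta>_def mult_exp_exp field_simps)
      also have "\<dots> \<le> b j * \<delta> * ?U $ j $ j * ?K $ j $ j"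
        using b1[of j] d0 U1'(1)[of j] K(2)[of j] by (intro mult_right_mono mult_left_mono) auto
      finally have s: "\<bar>\<Sum>l\<in>{i..<j}. ?U $ i $ l * ?K $ l $ j\<bar> \<le> b j * \<delta> * ?U $ j $ j * ?K $ j $ j" .
      have "\<bar>?U $ i $ j * ?K $ j $ j\<bar> \<le> b j * (1 - \<delta>) * ?U $ j $ j * ?K $ j $ j"
        unfolding abs_mult using U2[OF ij] K(2)[of j] by (intro mult_mono) auto
      then have "\<bar>?U $ i $ j * ?K $ j $ j + (\<Sum>l\<in>{i..<j}. ?U $ i $ l * ?K $ l $ j)\<bar> \<le> b j * (?U $ j $ j * ?K $ j $ j)"
        using s abs_triangle_ineq[of "?U $ i $ j * ?K $ j $ j" "\<Sum>l\<in>{i..<j}. ?U $ i $ l * ?K $ l $ j"]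
        by (simp add: algebra_simps)
      then show ?thesis by (simp add: UK split)
    qed
    have t4: "\<bar>snd (gmul \<theta> k) $ i\<bar> \<le> r" for i
    proof -
      have "\<bar>\<Sum>l\<in>UNIV. ?U $ i $ l * snd k $ l\<bar> \<le> (\<Sum>l\<in>UNIV. \<bar>?U $ i $ l * snd k $ l\<bar>)"
        by (rule sum_abs)
      also have "\<dots> \<le> (\<Sum>l\<in>(UNIV :: 'd set). r * exp (- 2 * n) * (M / ?d))"
      proof (rule sum_mono)
        fix l :: 'd
        have "\<bar>?U $ i $ l\<bar> \<le> b l * exp n" by (rule Ub)
        also have "\<dots> \<le> r * exp (- 2 * n)"
        proof -
          have "3 * n * real (coord_no l) \<le> 3 * n * ?d"
            using n0 coord_no_le_card[of l] by (intro mult_left_mono) auto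
          then show ?thesis by (simp add: b_def r_def mult_exp_exp algebra_simps)
        qed
        finally have 1: "\<bar>?U $ i $ l\<bar> \<le> r * exp (- 2 * n)" .
        have 2: "\<bar>snd k $ l\<bar> \<le> M / ?d" using M3[of l] by (simp add: field_simps)
        show "\<bar>?U $ i $ l * snd k $ l\<bar> \<le> r * exp (- 2 * n) * (M / ?d)"
          unfolding abs_mult using 1 2 by (rule mult_mono) (use r0 in auto)
      qed
      also have "\<dots> = r * M * exp (- 2 * n)" by simp
      also have "\<dots> \<le> r * M * exp (- n)" using r0 M0 n0 by (intro mult_left_mono) auto
      finally have "\<bar>\<Sum>l\<in>UNIV. ?U $ i $ l * snd k $ l\<bar> \<le> r * \<delta>" by (simp add: \<delta>_def mult.assoc)
      moreover have "snd (gmul \<theta> k) $ i = (\<Sum>l\<in>UNIV. ?U $ i $ l * snd k $ l) + snd \<theta> $ i"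
        by (simp add: gmul_def matrix_vector_mult_def)
      ultimately show ?thesis
        using U3[of i] abs_triangle_ineq[of "\<Sum>l\<in>UNIV. ?U $ i $ l * snd k $ l" "snd \<theta> $ i"]
        by (simp add: algebra_simps)
    qed
    show "gmul \<theta> k \<in> foelner N"
      unfolding fo box_set_def using t1 t2 t3 t4 by auto
  qed
qed

lemma foelner_measure:
  assumes c: "0 < c"
  shows "emeasure (prior c) (foelner N :: ('d::{finite,wellorder} affine) set) < \<infinity>"
    and "0 < N \<Longrightarrow> 0 < emeasure (prior c) (foelner N :: ('d affine) set)"
proof -
  have eq: "emeasure (prior c) (foelner N :: ('d affine) set) = ennreal (c * (\<Prod>j\<in>(UNIV :: 'd set).
     (2 * exp (3 * real N * real (coord_no j))) ^ card {..<j} * (2 * real N)) *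
     (2 * exp (3 * real N * (real CARD('d) + 1))) ^ CARD('d))"
    unfolding foelner_def using c by (intro emeasure_prior_box) auto
  show "emeasure (prior c) (foelner N :: ('d affine) set) < \<infinity>" unfolding eq by simp
  show "0 < emeasure (prior c) (foelner N :: ('d affine) set)" if "0 < N"
    unfolding eq ennreal_less_zero_iff using that c by (intro mult_pos_pos prod_pos zero_less_power) auto
qed

lemma foelner_limit:
  fixes k :: "'d::{finite,wellorder} affine"
  assumes k: "k \<in> Theta" and c: "0 < c"
  shows "1 \<le> liminf (\<lambda>N. emeasure (prior c) {\<theta> \<in> foelner N. gmul \<theta> k \<in> foelner N}
     / emeasure (prior c) (foelner N :: ('d affine) set))"
proof -
  obtain M where M: "0 < M"
    "\<And>N \<theta>. \<theta> \<in> box_set (real N - M) (\<lambda>j. exp (3 * real N * real (coord_no j)) * (1 - M * exp (- real N)))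
             (exp (3 * real N * (real CARD('d) + 1)) * (1 - M * exp (- real N)))
       \<Longrightarrow> \<theta> \<in> foelner N \<and> gmul \<theta> k \<in> foelner N"
    using foelner_shift[OF k] by blast
  define e where "e = (\<lambda>N. 1 - M * exp (- real N))"
  define q where "q = (\<lambda>N. (\<Prod>j\<in>(UNIV :: 'd set). e N ^ card {..<j} * (1 - M / real N)) * e N ^ CARD('d))"
  have "(\<lambda>N. exp (- real N)) \<longlonglongrightarrow> 0"
    by (rule filterlim_compose[OF exp_at_bot]) (simp add: filterlim_uminus_at_bot filterlim_real_sequentially)
  then have e: "e \<longlonglongrightarrow> 1 - M * 0" unfolding e_def by (intro tendsto_intros)
  have "(\<lambda>N. 1 - M / real N) \<longlonglongrightarrow> 1 - 0"
    by (intro tendsto_diff tendsto_const lim_const_over_n)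
  then have "q \<longlonglongrightarrow> (\<Prod>j\<in>(UNIV :: 'd set). (1 - M * 0) ^ card {..<j} * (1 - 0)) * (1 - M * 0) ^ CARD('d)"
    unfolding q_def using e by (intro tendsto_intros)
  then have "(\<lambda>N. ennreal (q N)) \<longlonglongrightarrow> ennreal 1" by (intro tendsto_ennrealI) simp
  then have "liminf (\<lambda>N. ennreal (q N)) = 1" by (intro lim_imp_Liminf) simp_all
  moreover have "liminf (\<lambda>N. ennreal (q N)) \<le> liminf (\<lambda>N. emeasure (prior c) {\<theta> \<in> foelner N. gmul \<theta> k \<in> foelner N}
     / emeasure (prior c) (foelner N :: ('d affine) set))"
  proof (rule Liminf_mono)
    have "eventually (\<lambda>N. 0 < e N) sequentially"
      using order_tendstoD(1)[OF e, of 0] by simp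
    moreover have "eventually (\<lambda>N. real N \<ge> M) sequentially"
      using filterlim_real_sequentially by (simp add: filterlim_at_top)
    ultimately show "\<forall>\<^sub>F N in sequentially. ennreal (q N) \<le> emeasure (prior c) {\<theta> \<in> foelner N. gmul \<theta> k \<in> foelner N}
     / emeasure (prior c) (foelner N :: ('d affine) set)"
    proof eventually_elim
      case (elim N)
      have N: "0 < real N" using elim M(1) by linarith
      let ?B = "box_set (real N - M) (\<lambda>j :: 'd. exp (3 * real N * real (coord_no j)) * e N) (exp (3 * real N * (real CARD('d) + 1)) * e N)"
      define v where "v = c * (\<Prod>j\<in>(UNIV :: 'd set). (2 * exp (3 * real N * real (coord_no j))) ^ card {..<j} * (2 * real N)) *
           (2 * exp (3 * real N * (real CARD('d) + 1))) ^ CARD('d)"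
      have v: "emeasure (prior c) (foelner N :: ('d affine) set) = ennreal v"
        unfolding foelner_def v_def using c by (intro emeasure_prior_box) auto
      have v0: "0 < v" unfolding v_def using c N by (intro mult_pos_pos prod_pos zero_less_power) auto
      have "emeasure (prior c) ?B = ennreal (c * (\<Prod>j\<in>(UNIV :: 'd set). (2 * (exp (3 * real N * real (coord_no j)) * e N)) ^ card {..<j} * (2 * (real N - M))) *
           (2 * (exp (3 * real N * (real CARD('d) + 1)) * e N)) ^ CARD('d))"
        using c elim by (intro emeasure_prior_box) auto
      also have "c * (\<Prod>j\<in>(UNIV :: 'd set). (2 * (exp (3 * real N * real (coord_no j)) * e N)) ^ card {..<j} * (2 * (real N - M))) *
           (2 * (exp (3 * real N * (real CARD('d) + 1)) * e N)) ^ CARD('d) = q N * v"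
      proof -
        have *: "(2 * (x * e N)) ^ p * (2 * (real N - M)) = ((2 * x) ^ p * (2 * real N)) * (e N ^ p * (1 - M / real N))" for x p
          using N by (simp add: power_mult_distrib field_simps)
        show ?thesis unfolding * prod.distrib[of _ "\<lambda>j. e N ^ card {..<j} * (1 - M / real N)"] v_def q_def
          by (simp only: power_mult_distrib mult_ac)
      qed
      finally have B: "emeasure (prior c) ?B = ennreal (q N * v)" .
      have "emeasure (prior c) ?B \<le> emeasure (prior c) {\<theta> \<in> foelner N. gmul \<theta> k \<in> foelner N}"
      proof (rule emeasure_mono)
        show "?B \<subseteq> {\<theta> \<in> foelner N. gmul \<theta> k \<in> foelner N}" using M(2)[of _ N] unfolding e_def by blast
        have "{\<theta> \<in> space borel. \<theta> \<in> foelner N \<and> gmul \<theta> k \<in> foelner N} \<in> sets borel" by measurable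
        then show "{\<theta> \<in> foelner N. gmul \<theta> k \<in> foelner N} \<in> sets (prior c)" by (simp add: sets_prior)
      qed
      then have "ennreal (q N * v) / ennreal v \<le> emeasure (prior c) {\<theta> \<in> foelner N. gmul \<theta> k \<in> foelner N} / ennreal v"
        unfolding B by (rule divide_right_mono_ennreal)
      moreover have "ennreal (q N * v) / ennreal v = ennreal (q N)"
        using v0 by (simp add: ennreal_mult'' ennreal_mult_divide_eq)
      ultimately show ?case unfolding v by simp
    qed
  qed
  ultimately show ?thesis by simp
qed

text \<open>
  The scaling constant \<open>C\<close> of a right translation is at least 1: on a Foelner box the ratio in
  \<open>foelner_limit\<close> is at most \<open>C\<close>.
\<close>

lemma prior_right_mult_le:
  fixes h :: "'d::{finite,wellorder} affine"
  assumes h: "h \<in> Theta" and c: "0 < c"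
  obtains C where "1 \<le> C" "C < \<infinity>"
    "\<And>f. f \<in> borel_measurable borel \<Longrightarrow> (\<integral>\<^sup>+\<theta>. f (gmul \<theta> h) \<partial>prior c) = C * (\<integral>\<^sup>+\<theta>. f \<theta> \<partial>prior c)"
proof -
  obtain C where C: "0 < C" "C < \<infinity>"
    "\<And>f. f \<in> borel_measurable borel \<Longrightarrow> (\<integral>\<^sup>+\<theta>. f (gmul \<theta> h) \<partial>prior c) = C * (\<integral>\<^sup>+\<theta>. f \<theta> \<partial>prior c)"
    using prior_right_mult[OF h c] by blast
  have "liminf (\<lambda>N. emeasure (prior c) {\<theta> \<in> foelner N. gmul \<theta> h \<in> foelner N}
     / emeasure (prior c) (foelner N :: ('d affine) set)) \<le> liminf (\<lambda>_. C)"
  proof (rule Liminf_mono, rule eventually_mono[OF eventually_gt_at_top[of 0]])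
    fix N :: nat assume N: "0 < N"
    let ?F = "foelner N :: ('d affine) set"
    have "emeasure (prior c) {\<theta> \<in> ?F. gmul \<theta> h \<in> ?F} \<le> (\<integral>\<^sup>+\<theta>. indicator ?F (gmul \<theta> h) \<partial>prior c)"
    proof -
      have m: "{\<theta> \<in> space borel. \<theta> \<in> ?F \<and> gmul \<theta> h \<in> ?F} \<in> sets borel" by measurable
      have "emeasure (prior c) {\<theta> \<in> ?F. gmul \<theta> h \<in> ?F} = (\<integral>\<^sup>+\<theta>. indicator {\<theta> \<in> ?F. gmul \<theta> h \<in> ?F} \<theta> \<partial>prior c)"
        using m by (simp add: sets_prior)
      also have "\<dots> \<le> (\<integral>\<^sup>+\<theta>. indicator ?F (gmul \<theta> h) \<partial>prior c)"
        by (intro nn_integral_mono) (auto split: split_indicator)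
      finally show ?thesis .
    qed
    also have "\<dots> = C * emeasure (prior c) ?F" by (subst C(3)) (simp_all add: sets_prior)
    finally have "emeasure (prior c) {\<theta> \<in> ?F. gmul \<theta> h \<in> ?F} / emeasure (prior c) ?F \<le> C * emeasure (prior c) ?F / emeasure (prior c) ?F"
      by (rule divide_right_mono_ennreal)
    also have "\<dots> = C" using foelner_measure[OF c, of N, where 'd = 'd] N by (simp add: ennreal_mult_divide_eq)
    finally show "emeasure (prior c) {\<theta> \<in> ?F. gmul \<theta> h \<in> ?F} / emeasure (prior c) ?F \<le> C" .
  qed
  also have "\<dots> = C" by (rule Liminf_const) simp
  finally have "1 \<le> C" using foelner_limit[OF h c] by (rule order_trans[rotated])
  then show thesis using C that by blast
qed

section \<open>The marginal density of the data under the prior\<close>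

definition evidence :: "real \<Rightarrow> ('d::{finite,wellorder}, 'n::finite) sample \<Rightarrow> ennreal" where
  "evidence c y = (\<integral>\<^sup>+\<theta>. ennreal (lik \<theta> y) \<partial>prior c)"

definition joint_evidence ::
  "real \<Rightarrow> ('d::{finite,wellorder}, 'n::finite) sample \<Rightarrow> ('d, 'm::finite) sample \<Rightarrow> ennreal" where
  "joint_evidence c y ys = (\<integral>\<^sup>+\<theta>. ennreal (lik \<theta> y) * ennreal (lik \<theta> ys) \<partial>prior c)"

lemma predictive_weight_eq: "predictive_weight c y ys = joint_evidence c y ys"
  unfolding predictive_weight_def joint_evidence_def
  by (rule nn_integral_cong_AE, rule AE_mp[OF AE_prior_Theta])
    (auto simp: ennreal_mult''[symmetric] mult.commute less_imp_le[OF iid_density_pos])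

lemma borel_measurable_evidence [measurable]:
  "evidence c \<in> borel_measurable (borel :: ('d::{finite,wellorder}, 'n::finite) sample measure)"
proof -
  interpret sigma_finite_measure "prior c :: 'd affine measure" by (rule sigma_finite_prior)
  show ?thesis unfolding evidence_def[abs_def] by measurable
qed

lemma borel_measurable_joint_evidence [measurable]:
  "(\<lambda>(y, ys). joint_evidence c y ys) \<in> borel_measurable
    ((borel :: ('d::{finite,wellorder}, 'n::finite) sample measure) \<Otimes>\<^sub>M (borel :: ('d, 'm::finite) sample measure))"
proof -
  interpret sigma_finite_measure "prior c :: 'd affine measure" by (rule sigma_finite_prior)
  show ?thesis unfolding joint_evidence_def[abs_def] by measurable
qed

lemma prior_nonzero:
  assumes c: "0 < c" and f [measurable]: "f \<in> borel_measurable borel"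
    and pos: "\<And>\<theta>. \<theta> \<in> Theta \<Longrightarrow> 0 < f \<theta>"
  shows "0 < (\<integral>\<^sup>+\<theta>. f \<theta> \<partial>(prior c :: ('d::{finite,wellorder} affine) measure))"
proof (rule ccontr)
  assume "\<not> 0 < (\<integral>\<^sup>+\<theta>. f \<theta> \<partial>prior c)"
  then have "(\<integral>\<^sup>+\<theta>. f \<theta> \<partial>prior c) = 0" by (simp add: not_less)
  then have "AE \<theta> in prior c. f \<theta> = 0" by (subst (asm) nn_integral_0_iff_AE) simp_all
  then have "AE \<theta> in prior c. \<theta> \<notin> (foelner 1 :: 'd affine set)"
    by eventually_elim (use pos foelner_Theta[of 1] in force)
  then have "emeasure (prior c) (foelner 1 :: 'd affine set) = 0"
    by (subst (asm) AE_iff_measurable[where N = "foelner 1"]) (auto simp: sets_prior)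
  then show False using foelner_measure(2)[OF c, of 1, where 'd = 'd] by simp
qed

lemma evidence_pos: "0 < c \<Longrightarrow> 0 < evidence c y"
  unfolding evidence_def by (rule prior_nonzero) (simp_all add: iid_density_pos)

lemma joint_evidence_pos: "0 < c \<Longrightarrow> 0 < joint_evidence c y ys"
  unfolding joint_evidence_def by (rule prior_nonzero) (simp_all add: iid_density_pos ennreal_zero_less_mult_iff)

lemma nn_integral_lik:
  fixes \<theta> :: "'d::{finite,wellorder} affine"
  shows "\<theta> \<in> Theta \<Longrightarrow> (\<integral>\<^sup>+ys. ennreal (lik \<theta> (ys :: ('d, 'm::finite) sample)) \<partial>lborel) = 1"
  by (simp add: nn_integral_iid_density)

lemma nn_integral_joint_evidence:
  fixes y :: "('d::{finite,wellorder}, 'n::finite) sample"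
  shows "(\<integral>\<^sup>+ys. joint_evidence c y (ys :: ('d, 'm::finite) sample) \<partial>lborel) = evidence c y"
proof -
  interpret sigma_finite_measure "prior c :: 'd affine measure" by (rule sigma_finite_prior)
  interpret pair_sigma_finite "prior c :: 'd affine measure" "lborel :: ('d, 'm) sample measure" ..
  have "(\<integral>\<^sup>+ys. joint_evidence c y (ys :: ('d, 'm) sample) \<partial>lborel)
     = (\<integral>\<^sup>+\<theta>. (\<integral>\<^sup>+ys. ennreal (lik \<theta> y) * ennreal (lik \<theta> (ys :: ('d, 'm) sample)) \<partial>lborel) \<partial>prior c)"
    unfolding joint_evidence_def by (rule Fubini') measurable
  also have "\<dots> = (\<integral>\<^sup>+\<theta>. ennreal (lik \<theta> y) * (\<integral>\<^sup>+ys. ennreal (lik \<theta> (ys :: ('d, 'm) sample)) \<partial>lborel) \<partial>prior c)"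
    by (intro nn_integral_cong nn_integral_cmult) measurable
  also have "\<dots> = evidence c y"
    unfolding evidence_def
    by (rule nn_integral_cong_AE, rule AE_mp[OF AE_prior_Theta]) (simp add: nn_integral_lik del: lik_Theta)
  finally show ?thesis .
qed

text \<open>
  The constant \<open>C\<close> is the same for all samples and in both equations, so it cancels in the predictive
  density.
\<close>

lemma evidence_act:
  fixes g :: "'d::{finite,wellorder} affine"
  assumes g: "g \<in> Theta" and c: "0 < c"
  shows "\<exists>C. 0 < C \<and> C < \<infinity> \<and>
    (\<forall>y :: ('d, 'n::finite) sample. evidence c (act_all g y) = C * evidence c y) \<and>
    (\<forall>(y :: ('d, 'n) sample) (ys :: ('d, 'm::finite) sample).
       joint_evidence c (act_all g y) (act_all g ys) = C * ennreal (1 / det (fst g) ^ CARD('m)) * joint_evidence c y ys)"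
proof -
  obtain K where K: "0 < K" "K < \<infinity>"
    "\<And>f. f \<in> borel_measurable borel \<Longrightarrow> (\<integral>\<^sup>+\<theta>. f (gmul g \<theta>) \<partial>prior c) = K * (\<integral>\<^sup>+\<theta>. f \<theta> \<partial>prior c)"
    using prior_left_mult[OF g c] by blast
  let ?D = "ennreal (1 / det (fst g) ^ CARD('n))" let ?E = "ennreal (1 / det (fst g) ^ CARD('m))"
  have d: "0 < det (fst g)" by (rule det_Theta_pos[OF g])
  have lik: "ennreal (lik (gmul g \<theta>) (act_all g y)) = ennreal (1 / det (fst g) ^ CARD('k)) * ennreal (lik \<theta> y)"
    if "\<theta> \<in> Theta" for \<theta> and y :: "('d, 'k::finite) sample"
    using that d by (simp add: gmul_Theta[OF g] iid_density_gmul[OF g] ennreal_mult''[symmetric] less_imp_le[OF iid_density_pos])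
  have cancel: "a = b / K" if "b = K * a" for a b
    using that K ennreal_mult_divide_eq[of K a] by (simp add: mult.commute[of K])
  show ?thesis
  proof (intro exI[of _ "?D / K"] conjI allI)
    show "0 < ?D / K" using d K by (simp add: ennreal_zero_less_divide)
    show "?D / K < \<infinity>" using K(1) by (auto simp: ennreal_divide_eq_top_iff less_top[symmetric])
    fix y :: "('d, 'n) sample"
    have "?D * evidence c y = (\<integral>\<^sup>+\<theta>. ennreal (lik (gmul g \<theta>) (act_all g y)) \<partial>prior c)"
      unfolding evidence_def
      by (subst nn_integral_cmult[symmetric], measurable)
        (rule nn_integral_cong_AE, rule AE_mp[OF AE_prior_Theta], simp add: lik del: lik_Theta)
    also have "\<dots> = K * evidence c (act_all g y)"
      unfolding evidence_def by (rule K(3)) measurable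
    finally show "evidence c (act_all g y) = ?D / K * evidence c y"
      by (drule_tac cancel) (simp add: ennreal_times_divide mult.commute)
    fix ys :: "('d, 'm) sample"
    have "?D * ?E * joint_evidence c y ys
       = (\<integral>\<^sup>+\<theta>. ennreal (lik (gmul g \<theta>) (act_all g y)) * ennreal (lik (gmul g \<theta>) (act_all g ys)) \<partial>prior c)"
      unfolding joint_evidence_def
      by (subst nn_integral_cmult[symmetric], measurable)
        (rule nn_integral_cong_AE, rule AE_mp[OF AE_prior_Theta], simp add: lik mult_ac del: lik_Theta)
    also have "\<dots> = K * joint_evidence c (act_all g y) (act_all g ys)"
      unfolding joint_evidence_def
      by (rule K(3)[where f = "\<lambda>\<theta>. ennreal (lik \<theta> (act_all g y)) * ennreal (lik \<theta> (act_all g ys))"]) measurable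
    finally show "joint_evidence c (act_all g y) (act_all g ys) = ?D / K * ?E * joint_evidence c y ys"
      by (drule_tac cancel) (simp add: ennreal_times_divide mult_ac)
  qed
qed

section \<open>Finiteness of the evidence\<close>

text \<open>
  The edge vectors of the simplex with base point \<open>o'\<close> and further vertices \<open>\<iota> j\<close>, as columns. A group
  element acts on this matrix by left multiplication with its linear part.
\<close>

definition frame :: "('d \<Rightarrow> 'n) \<Rightarrow> 'n \<Rightarrow> ('d::{finite,wellorder}, 'n::finite) sample \<Rightarrow> 'd sqmat" where
  "frame \<iota> o' y = (\<chi> r j. y $ \<iota> j $ r - y $ o' $ r)"

lemma frame_act: "frame \<iota> o' (act_all \<theta> y) = fst \<theta> ** frame \<iota> o' y"
  by (simp add: frame_def vec_eq_iff act_all_nth matrix_matrix_mult_def matrix_vector_mult_def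
      right_diff_distrib sum_subtractf)

lemma borel_measurable_frame [measurable]: "frame \<iota> o' \<in> borel_measurable borel"
  unfolding frame_def[abs_def] by measurable

lemma finite_det_shift_zeros:
  fixes A :: "((real, 'n::finite) vec, 'n) vec"
  shows "finite {t. det (A + t *\<^sub>R mat 1) = 0}"
proof -
  define p where "p = (\<Sum>f | f permutes (UNIV :: 'n set). [:of_int (sign f):] *
      (\<Prod>i\<in>UNIV. [:A $ i $ f i, if i = f i then 1 else 0:]))"
  have p: "poly p t = det (A + t *\<^sub>R mat 1)" for t
    by (auto simp: p_def det_def poly_sum poly_prod mat_def intro!: sum.cong prod.cong arg_cong2[where f = "(*)"])
  have lin: "linear (\<lambda>x. A *v x)" by (rule matrix_vector_mul_linear)
  obtain B where B: "B > 0" "\<And>x. norm (A *v x) \<le> B * norm x"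
    using linear_bounded_pos[OF lin] by (auto simp: mult.commute)
  (* The polynomial is nonzero since A cannot have eigenvalues beyond its norm bound B. *)
  have "det (A + (B + 1) *\<^sub>R mat 1) \<noteq> 0"
  proof -
    have "x = 0" if "(A + (B + 1) *\<^sub>R mat 1) *v x = 0" for x
    proof -
      have "A *v x = - ((B + 1) *\<^sub>R x)"
        using that by (simp add: matrix_vector_mult_add_rdistrib scaleR_matrix_vector_assoc[symmetric] eq_neg_iff_add_eq_0)
      then have "(B + 1) * norm x \<le> B * norm x" using B(2)[of x] B(1) by simp
      then show "x = 0" by (simp add: algebra_simps)
    qed
    then show ?thesis
      by (metis invertible_det_nz invertible_left_inverse matrix_left_invertible_ker)
  qed
  then have "p \<noteq> 0" using p[of "B + 1"] by auto
  then have "finite {t. poly p t = 0}" by (rule poly_roots_finite)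
  then show ?thesis by (simp add: p)
qed

text \<open>
  Moving the vertices along a fixed direction \<open>e\<close> adds a multiple of the unit matrix to the frame, and
  the determinant vanishes for finitely many multiples only. By translation invariance and Fubini's
  theorem, the set of samples with degenerate frame is a null set.
\<close>

lemma AE_frame_invertible:
  fixes \<iota> :: "'d::{finite,wellorder} \<Rightarrow> 'n::finite"
  assumes \<iota>: "inj \<iota>" and o': "o' \<notin> range \<iota>"
  shows "AE y in lborel. det (frame \<iota> o' y) \<noteq> 0"
proof -
  define e :: "('d, 'n) sample" where "e = (\<chi> i r. if i = \<iota> r then 1 else 0)"
  have fr: "frame \<iota> o' (y + t *\<^sub>R e) = frame \<iota> o' y + t *\<^sub>R mat 1" for y t
    using o' \<iota> by (auto simp: frame_def e_def vec_eq_iff mat_def inj_eq)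
  let ?N = "{y. det (frame \<iota> o' y) = 0}"
  have N [measurable]: "?N \<in> sets borel"
  proof -
    have "{y \<in> space borel. det (frame \<iota> o' y) = 0} \<in> sets borel" by measurable
    then show ?thesis by simp
  qed
  interpret subspace_lebesgue UNIV "lborel :: ('d, 'n) sample measure" by (rule subspace_lebesgue_lborel)
  have "emeasure lborel ?N = (\<integral>\<^sup>+t. indicator {0..1::real} t * emeasure lborel ?N \<partial>lborel)"
    by (subst nn_integral_multc) simp_all
  also have "\<dots> = (\<integral>\<^sup>+t. (\<integral>\<^sup>+y. indicator {0..1::real} t * indicator ?N (y + t *\<^sub>R e) \<partial>lborel) \<partial>lborel)"
    by (intro nn_integral_cong) (simp add: nn_integral_cmult translate)
  also have "\<dots> = (\<integral>\<^sup>+y. (\<integral>\<^sup>+t. indicator {0..1::real} t * indicator ?N (y + t *\<^sub>R e) \<partial>lborel) \<partial>lborel)"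
    by (rule lborel_pair.Fubini') measurable
  also have "\<dots> = (\<integral>\<^sup>+(y :: ('d, 'n) sample). 0 \<partial>lborel)"
  proof (rule nn_integral_cong)
    fix y :: "('d, 'n) sample"
    have "(\<integral>\<^sup>+t. indicator {0..1::real} t * indicator ?N (y + t *\<^sub>R e) \<partial>lborel)
        \<le> (\<integral>\<^sup>+t. indicator {t. det (frame \<iota> o' y + t *\<^sub>R mat 1) = 0} t \<partial>lborel)"
      by (intro nn_integral_mono) (auto simp: fr indicator_def)
    also have "\<dots> = 0"
      using finite_imp_null_set_lborel[OF finite_det_shift_zeros[of "frame \<iota> o' y"]]
      by (subst nn_integral_indicator) (auto simp: null_sets_def)
    finally show "(\<integral>\<^sup>+t. indicator {0..1::real} t * indicator ?N (y + t *\<^sub>R e) \<partial>lborel) = 0" by simp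
  qed
  finally have "emeasure lborel ?N = 0" by simp
  then show ?thesis by (intro AE_I'[of ?N]) (auto simp: null_sets_def)
qed

definition spread :: "('d \<Rightarrow> 'n) \<Rightarrow> 'n \<Rightarrow> real \<Rightarrow> ('d::{finite,wellorder}, 'n::finite) sample set" where
  "spread \<iota> o' R = {y. norm y \<le> R \<and> 1 \<le> R * \<bar>det (frame \<iota> o' y)\<bar>}"

lemma spread_borel [measurable]: "spread \<iota> o' R \<in> sets borel"
proof -
  have "{y \<in> space borel. norm y \<le> R \<and> 1 \<le> R * \<bar>det (frame \<iota> o' y)\<bar>} \<in> sets borel" by measurable
  then show ?thesis by (simp add: spread_def)
qed

text \<open>
  The prior mass of the parameters that move \<open>y\<close> into \<open>S\<close>.
\<close>

definition orbit_mass :: "real \<Rightarrow> ('d::{finite,wellorder}, 'n::finite) sample set \<Rightarrow> ('d, 'n) sample \<Rightarrow> ennreal" where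
  "orbit_mass c S y = (\<integral>\<^sup>+\<theta>. indicator Theta \<theta> * indicator S (act_all \<theta> y) \<partial>prior c)"

text \<open>
  The prior density is unbounded only where a diagonal entry tends to 0. If the determinant is at least
  \<open>e\<close> and all diagonal entries are at most \<open>r\<close>, then each of them is at least \<open>e / r\<^sup>d\<close>.
\<close>

lemma haar_density_bound:
  fixes \<theta> :: "'d::{finite,wellorder} affine"
  assumes \<theta>: "\<theta> \<in> Theta" and r: "1 \<le> r" "norm \<theta> \<le> r" and e: "0 < e" "e \<le> det (fst \<theta>)"
  shows "haar_density \<theta> \<le> (\<Prod>i\<in>UNIV. (e / r ^ CARD('d)) powr (- real (coord_no (i :: 'd))))"
proof -
  have U: "0 < fst \<theta> $ i $ i" for i using \<theta> by (simp add: Theta_iff)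
  have Ur: "fst \<theta> $ i $ i \<le> r" for i
  proof -
    have "fst \<theta> $ i $ i \<le> norm (fst \<theta>)" using entry_le_norm[of "fst \<theta>" i i] by simp
    also have "\<dots> \<le> norm \<theta>" using norm_fst_le[of "fst \<theta>" "snd \<theta>"] by simp
    finally show ?thesis using r by simp
  qed
  have low: "e / r ^ CARD('d) \<le> fst \<theta> $ i $ i" for i
  proof -
    have "e \<le> (\<Prod>j\<in>UNIV. fst \<theta> $ j $ j)" using e det_Theta[OF \<theta>] by simp
    also have "\<dots> = fst \<theta> $ i $ i * (\<Prod>j\<in>UNIV - {i}. fst \<theta> $ j $ j)" by (rule prod.remove) auto
    also have "\<dots> \<le> fst \<theta> $ i $ i * (\<Prod>j\<in>UNIV - {i}. r)"
      using U Ur by (intro mult_left_mono prod_mono) (auto intro: less_imp_le)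
    also have "\<dots> \<le> fst \<theta> $ i $ i * r ^ CARD('d)"
      using U[of i] r by (intro mult_left_mono) (auto intro!: power_increasing)
    finally show ?thesis using r by (simp add: field_simps)
  qed
  have "haar_density \<theta> = (\<Prod>i\<in>UNIV. (fst \<theta> $ i $ i) powr (- real (coord_no i)))"
    using \<theta> by (simp add: haar_density_def)
  also have "\<dots> \<le> (\<Prod>i\<in>UNIV. (e / r ^ CARD('d)) powr (- real (coord_no (i :: 'd))))"
    using e r low by (intro prod_mono conjI powr_mono2') (auto intro!: divide_pos_pos)
  finally show ?thesis .
qed

text \<open>
  For a sample with nondegenerate frame, the linear map \<open>\<theta> \<mapsto> \<theta> y\<close> is injective, so the parameters
  that move \<open>y\<close> into a bounded set are bounded; the frame condition keeps their determinant away from 0.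
\<close>

lemma orbit_mass_finite:
  fixes \<iota> :: "'d::{finite,wellorder} \<Rightarrow> 'n::finite"
  assumes y: "det (frame \<iota> o' y) \<noteq> 0" and R: "1 \<le> R" and c: "0 < c"
  shows "orbit_mass c (spread \<iota> o' R) y < \<infinity>"
proof -
  define L :: "'d affine \<Rightarrow> ('d, 'n) sample" where "L = (\<lambda>\<theta>. act_all \<theta> y)"
  have lin: "linear L"
    by (rule linearI) (auto simp: L_def vec_eq_iff act_all_nth matrix_vector_mult_def
        algebra_simps sum.distrib sum_distrib_left)
  have inv: "invertible (frame \<iota> o' y)" using y by (simp add: invertible_det_nz)
  have "\<theta> = 0" if "L \<theta> = 0" for \<theta>
  proof -
    have "fst \<theta> ** frame \<iota> o' y = 0 ** frame \<iota> o' y"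
      using that by (simp add: frame_act[symmetric] L_def) (simp add: frame_def vec_eq_iff matrix_matrix_mult_def)
    then have "fst \<theta> = 0" by (rule invertible_cancel_right[OF inv])
    moreover from this have "snd \<theta> = 0"
      using arg_cong[OF that, of "\<lambda>v. v $ o'"] by (simp add: L_def act_all_nth)
    ultimately show ?thesis by (simp add: prod_eq_iff)
  qed
  then have "inj L" using linear_injective_0[OF lin] by blast
  then obtain b where b: "b > 0" "\<And>x. b * norm x \<le> norm (L x)"
    using linear_inj_bounded_below_pos[OF lin] by blast
  define r where "r = max 1 (R / b)"
  define e where "e = 1 / (R * \<bar>det (frame \<iota> o' y)\<bar>)"
  define B where "B = (\<Prod>i\<in>UNIV. (e / r ^ CARD('d)) powr (- real (coord_no (i :: 'd))))"
  have e0: "0 < e" using R y by (simp add: e_def)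
  interpret subspace_lebesgue upper_affine "affine_lborel :: 'd affine measure" by (rule subspace_lebesgue_affine)
  have "orbit_mass c (spread \<iota> o' R) y
     = (\<integral>\<^sup>+\<theta>. ennreal (c * haar_density \<theta>) * (indicator Theta \<theta> * indicator (spread \<iota> o' R) (act_all \<theta> y)) \<partial>affine_lborel)"
    unfolding orbit_mass_def by (rule nn_integral_prior) measurable
  also have "\<dots> \<le> (\<integral>\<^sup>+\<theta>. ennreal (c * B) * indicator (ball (0 :: 'd affine) (r + 1)) \<theta> \<partial>affine_lborel)"
  proof (rule nn_integral_mono)
    fix \<theta> :: "'d affine"
    show "ennreal (c * haar_density \<theta>) * (indicator Theta \<theta> * indicator (spread \<iota> o' R) (act_all \<theta> y))
      \<le> ennreal (c * B) * indicator (ball 0 (r + 1)) \<theta>"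
    proof (cases "\<theta> \<in> Theta \<and> act_all \<theta> y \<in> spread \<iota> o' R")
      case True
      then have \<theta>: "\<theta> \<in> Theta" and n: "norm (L \<theta>) \<le> R" and d: "1 \<le> R * \<bar>det (fst \<theta> ** frame \<iota> o' y)\<bar>"
        by (auto simp: spread_def L_def frame_act)
      have "b * norm \<theta> \<le> R" using b(2)[of \<theta>] n by simp
      then have "norm \<theta> \<le> R / b" using b(1) by (simp add: field_simps)
      then have nr: "norm \<theta> \<le> r" by (simp add: r_def)
      have "e \<le> det (fst \<theta>)"
        using d det_Theta_pos[OF \<theta>] R y by (simp add: e_def det_mul abs_mult field_simps)
      then have "haar_density \<theta> \<le> B"
        unfolding B_def using \<theta> nr e0 by (intro haar_density_bound) (auto simp: r_def)
      then show ?thesis using c nr True by (simp add: ennreal_leI)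
    qed auto
  qed
  also have "\<dots> = ennreal (c * B) * emeasure affine_lborel (ball (0 :: 'd affine) (r + 1))"
    by (rule nn_integral_cmult_indicator) (simp only: sets_eq, simp)
  also have "\<dots> < \<infinity>" using finite_ball[of "r + 1"] by (simp add: ennreal_mult_less_top)
  finally show ?thesis .
qed

lemma borel_measurable_orbit_mass [measurable]:
  fixes S :: "('d::{finite,wellorder}, 'n::finite) sample set"
  assumes [measurable]: "S \<in> sets borel"
  shows "orbit_mass c S \<in> borel_measurable borel"
proof -
  interpret sigma_finite_measure "prior c :: 'd affine measure" by (rule sigma_finite_prior)
  show ?thesis unfolding orbit_mass_def[abs_def] by measurable
qed

text \<open>
  The orbit mass of \<open>\<theta> z\<close> is that of \<open>z\<close> after right translation by \<open>\<theta>\<close>.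
\<close>

lemma orbit_mass_act:
  fixes S :: "('d::{finite,wellorder}, 'n::finite) sample set"
  assumes [measurable]: "S \<in> sets borel" and \<theta>: "\<theta> \<in> Theta" and c: "0 < c"
  shows "orbit_mass c S z \<le> orbit_mass c S (act_all \<theta> z)"
proof -
  obtain C where C: "1 \<le> C" "C < \<infinity>"
    "\<And>f. f \<in> borel_measurable borel \<Longrightarrow> (\<integral>\<^sup>+h. f (gmul h \<theta>) \<partial>prior c) = C * (\<integral>\<^sup>+h. f h \<partial>prior c)"
    using prior_right_mult_le[OF \<theta> c] by blast
  have AE: "AE h in prior c. h \<in> (Theta :: 'd affine set)" by (rule AE_prior_Theta)
  have "orbit_mass c S (act_all \<theta> z) = (\<integral>\<^sup>+h. indicator Theta (gmul h \<theta>) * indicator S (act_all (gmul h \<theta>) z) \<partial>prior c)"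
    unfolding orbit_mass_def
    by (rule nn_integral_cong_AE, rule AE_mp[OF AE]) (simp add: act_all_gmul gmul_Theta \<theta>)
  also have "\<dots> = C * orbit_mass c S z"
    unfolding orbit_mass_def
    by (rule C(3)[where f = "\<lambda>h. indicator Theta h * indicator S (act_all h z)"]) measurable
  finally have "orbit_mass c S (act_all \<theta> z) = C * orbit_mass c S z" .
  moreover have "1 * orbit_mass c S z \<le> C * orbit_mass c S z" using C(1) by (rule mult_right_mono) simp
  ultimately show ?thesis by simp
qed

lemma ennreal_one_divide_mono:
  fixes a b :: ennreal
  assumes "a \<le> b" "0 < a"
  shows "1 / b \<le> 1 / a"
proof (cases "b = \<infinity>")
  case False
  then obtain s where s: "b = ennreal s" "0 \<le> s" by (cases b) auto
  moreover obtain r where r: "a = ennreal r" "0 \<le> r" using assms s by (cases a) (auto simp: top_unique)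
  moreover have "0 < r" "r \<le> s" using assms r s by auto
  moreover have "1 / ennreal x = ennreal (1 / x)" if "0 < x" for x
    using divide_ennreal[of 1 x] that by simp
  ultimately show ?thesis by (simp add: frac_le)
qed simp

lemma ennreal_divide_le_one:
  fixes a b :: ennreal
  assumes "a \<le> b" "0 < b"
  shows "a / b \<le> 1"
proof (cases "b = \<infinity>")
  case False
  have "a / b \<le> b / b" using assms(1) by (rule divide_right_mono_ennreal)
  also have "b / b = 1" using False assms(2) by (intro ennreal_divide_self) (auto simp: less_top)
  finally show ?thesis .
qed simp

text \<open>
  The evidence is integrated over the set with the weight \<open>1 / (I + 1)\<close>, where \<open>I\<close> is the orbit mass.
  After exchanging the integrals and substituting \<open>y = \<theta> z\<close>, the inner integral over \<open>\<theta>\<close> is at most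
  \<open>I(z) / (I(z) + 1)\<close>, by monotonicity of the orbit mass under the group.
\<close>

lemma AE_evidence_spread:
  fixes \<iota> :: "'d::{finite,wellorder} \<Rightarrow> 'n::finite"
  assumes c: "0 < c" and R: "1 \<le> R"
  shows "AE y in lborel. orbit_mass c (spread \<iota> o' R) y < \<infinity> \<longrightarrow> y \<in> spread \<iota> o' R \<longrightarrow> evidence c y < \<infinity>"
proof -
  let ?S = "spread \<iota> o' R" let ?I = "orbit_mass c ?S"
  define w :: "('d, 'n) sample \<Rightarrow> ennreal" where "w = (\<lambda>y. 1 / (?I y + 1))"
  have [measurable]: "w \<in> borel_measurable borel" unfolding w_def by measurable
  interpret sigma_finite_measure "prior c :: 'd affine measure" by (rule sigma_finite_prior)
  interpret P: pair_sigma_finite "prior c :: 'd affine measure" "lborel :: ('d, 'n) sample measure" ..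
  have gm [measurable]: "(\<lambda>z. ennreal (lik gunit z)) \<in> borel_measurable (borel :: ('d, 'n) sample measure)"
    by measurable
  have "(\<integral>\<^sup>+y. evidence c y * (indicator ?S y * w y) \<partial>lborel)
      = (\<integral>\<^sup>+y. (\<integral>\<^sup>+\<theta>. ennreal (lik \<theta> y) * (indicator ?S y * w y) \<partial>prior c) \<partial>lborel)"
    unfolding evidence_def by (intro nn_integral_cong nn_integral_multc[symmetric]) measurable
  also have "\<dots> = (\<integral>\<^sup>+\<theta>. (\<integral>\<^sup>+y. ennreal (lik \<theta> y) * (indicator ?S y * w y) \<partial>lborel) \<partial>prior c)"
    by (rule P.Fubini') measurable
  also have "\<dots> \<le> (\<integral>\<^sup>+\<theta>. (\<integral>\<^sup>+z. ennreal (lik gunit z) * (indicator Theta \<theta> * indicator ?S (act_all \<theta> z) * w z) \<partial>lborel) \<partial>prior c)"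
  proof (rule nn_integral_mono_AE, rule AE_mp[OF AE_prior_Theta], rule AE_I2, rule impI)
    fix \<theta> :: "'d affine" assume \<theta>: "\<theta> \<in> Theta"
    have "(\<integral>\<^sup>+y. ennreal (lik \<theta> y) * (indicator ?S y * w y) \<partial>lborel)
        = (\<integral>\<^sup>+z. ennreal (lik gunit z) * (indicator ?S (act_all \<theta> z) * w (act_all \<theta> z)) \<partial>lborel)"
      using nn_integral_iid_density_act[OF \<theta>, of "\<lambda>y. indicator ?S y * w y"] \<theta> by simp
    also have "\<dots> \<le> (\<integral>\<^sup>+z. ennreal (lik gunit z) * (indicator Theta \<theta> * indicator ?S (act_all \<theta> z) * w z) \<partial>lborel)"
    proof (intro nn_integral_mono mult_left_mono)
      fix z :: "('d, 'n) sample"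
      have "w (act_all \<theta> z) \<le> w z"
        unfolding w_def using orbit_mass_act[OF spread_borel \<theta> c]
        by (intro ennreal_one_divide_mono add_right_mono add_nonneg_pos) auto
      then show "indicator ?S (act_all \<theta> z) * w (act_all \<theta> z) \<le> indicator Theta \<theta> * indicator ?S (act_all \<theta> z) * w z"
        using \<theta> by (auto split: split_indicator)
    qed simp
    finally show "(\<integral>\<^sup>+y. ennreal (lik \<theta> y) * (indicator ?S y * w y) \<partial>lborel)
      \<le> (\<integral>\<^sup>+z. ennreal (lik gunit z) * (indicator Theta \<theta> * indicator ?S (act_all \<theta> z) * w z) \<partial>lborel)" .
  qed
  also have "\<dots> = (\<integral>\<^sup>+z. (\<integral>\<^sup>+\<theta>. ennreal (lik gunit z) * (indicator Theta \<theta> * indicator ?S (act_all \<theta> z) * w z) \<partial>prior c) \<partial>lborel)"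
    by (rule P.Fubini'[symmetric]) measurable
  also have "\<dots> = (\<integral>\<^sup>+z. ennreal (lik gunit z) * (?I z * w z) \<partial>lborel)"
    unfolding orbit_mass_def
    by (intro nn_integral_cong, subst nn_integral_cmult, measurable, subst nn_integral_multc, measurable)
  also have "\<dots> \<le> (\<integral>\<^sup>+z. ennreal (lik gunit (z :: ('d, 'n) sample)) * 1 \<partial>lborel)"
  proof (intro nn_integral_mono mult_left_mono)
    fix z
    have "?I z * w z = ?I z / (?I z + 1)" by (simp add: w_def ennreal_times_divide)
    also have "\<dots> \<le> 1" by (rule ennreal_divide_le_one) (auto intro: add_nonneg_pos)
    finally show "?I z * w z \<le> 1" .
  qed simp
  also have "\<dots> = 1" using nn_integral_lik[OF gunit_Theta, where 'm = 'n] by simp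
  finally have "(\<integral>\<^sup>+y. evidence c y * (indicator ?S y * w y) \<partial>lborel) \<noteq> \<infinity>" by (auto simp: top_unique)
  then have "AE y in lborel. evidence c y * (indicator ?S y * w y) \<noteq> \<infinity>"
    by (intro nn_integral_PInf_AE) measurable
  then show ?thesis
  proof eventually_elim
    case (elim y)
    show ?case
    proof (intro impI)
      assume y: "?I y < \<infinity>" "y \<in> ?S"
      then have "w y \<noteq> 0" by (auto simp: w_def ennreal_divide_eq_0_iff less_top)
      then show "evidence c y < \<infinity>" using elim y by (auto simp: ennreal_mult_eq_top_iff less_top)
    qed
  qed
qed

lemma AE_evidence_finite:
  assumes c: "0 < c" and card: "CARD('d::{finite,wellorder}) < CARD('n::finite)"
  shows "AE y in (lborel :: ('d, 'n) sample measure). evidence c y < \<infinity>"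
proof -
  obtain f :: "'d \<Rightarrow> 'n" where f: "inj f"
    using card card_le_inj[of "UNIV :: 'd set" "UNIV :: 'n set"] by auto
  have "range f \<noteq> UNIV"
    using card card_image[OF f] by auto
  then obtain o' where o': "o' \<notin> range f" by auto
  have "AE y in (lborel :: ('d, 'n) sample measure). \<forall>N::nat.
     orbit_mass c (spread f o' (real (Suc N))) y < \<infinity> \<longrightarrow> y \<in> spread f o' (real (Suc N)) \<longrightarrow> evidence c y < \<infinity>"
    unfolding AE_all_countable using c by (intro allI AE_evidence_spread) auto
  then show ?thesis
    using AE_frame_invertible[OF f o']
  proof eventually_elim
    case (elim y)
    let ?D = "\<bar>det (frame f o' y)\<bar>"
    obtain N where N: "max (norm y) (1 / ?D) < real N" using reals_Archimedean2[of "max (norm y) (1 / ?D)"] by (elim exE)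
    have N': "norm y < real N" "1 / ?D < real N" using N by (simp_all only: max_less_iff_conj)
    have D: "0 < ?D" using elim(2) by (simp only: zero_less_abs_iff not_False_eq_True)
    have "1 < real N * ?D" using N'(2) by (simp only: pos_divide_less_eq[OF D])
    also have "\<dots> \<le> real (Suc N) * ?D" by (intro mult_right_mono) auto
    finally have "y \<in> spread f o' (real (Suc N))" using N'(1) by (simp add: spread_def)
    moreover have "orbit_mass c (spread f o' (real (Suc N))) y < \<infinity>"
      using elim(2) c by (intro orbit_mass_finite) auto
    ultimately show ?case using elim(1) by blast
  qed
qed

section \<open>The Kullback--Leibler divergence\<close>

lemma borel_measurable_ext_ln [measurable]: "ext_ln \<in> borel_measurable borel"
  unfolding ext_ln_def[abs_def] by measurable

lemma ext_ln_ennreal: "0 < s \<Longrightarrow> ext_ln (ennreal s) = ereal (ln s)"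
  by (simp add: ext_ln_def)

text \<open>
  The inequality \<open>ln (s e) \<le> s e - 1\<close>, with all negative parts moved to the other side so that it can
  be integrated without integrability assumptions.
\<close>

lemma ennreal_log_le:
  fixes s e :: real
  assumes s: "0 < s" and e: "0 < e"
  shows "ennreal (ln s) + ennreal (ln e) + 1 \<le> ennreal (- ln s) + ennreal (- ln e) + ennreal s * ennreal e"
proof -
  have *: "ennreal x = ennreal (max 0 x)" for x :: real by (simp add: max_def ennreal_neg)
  have "ln (s * e) \<le> s * e - 1" using s e by (intro ln_le_minus_one) simp
  then have "max 0 (ln s) + max 0 (ln e) + 1 \<le> max 0 (- ln s) + max 0 (- ln e) + s * e"
  proof -
    have id: "max 0 x = x + max 0 (- x)" for x :: real by simp
    have "ln (s * e) = ln s + ln e" using s e by (simp add: ln_mult)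
    then show ?thesis using \<open>ln (s * e) \<le> s * e - 1\<close> id[of "ln s"] id[of "ln e"] by linarith
  qed
  then have "ennreal (max 0 (ln s) + max 0 (ln e) + 1) \<le> ennreal (max 0 (- ln s) + max 0 (- ln e) + s * e)"
    by (rule ennreal_leI)
  then show ?thesis
    using s e unfolding *[of "ln s"] *[of "ln e"] *[of "- ln s"] *[of "- ln e"]
    by (simp add: ennreal_plus ennreal_mult del: ennreal_plus[symmetric])
qed

text \<open>
  The case of a density \<open>r\<close>: \<open>ennreal_log_le\<close> is integrated with \<open>s = r\<close> and \<open>e = E\<close>. Where \<open>r\<close>
  vanishes, the term with \<open>- ln r\<close> is infinite.
\<close>

lemma KL_variational_aux:
  assumes "prob_space \<mu>" "prob_space \<nu>" and sets: "sets \<nu> = sets \<mu>" and ac: "absolutely_continuous \<mu> \<nu>"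
    and E [measurable]: "E \<in> borel_measurable \<mu>" and E0: "\<And>x. 0 \<le> E x" and Epos: "AE x in \<mu>. 0 < E x"
  shows "(\<integral>\<^sup>+x. e2ennreal (ext_ln (RN_deriv \<mu> \<nu> x)) \<partial>\<mu>) + (\<integral>\<^sup>+x. ennreal (ln (E x)) \<partial>\<mu>) + 1
    \<le> (\<integral>\<^sup>+x. e2ennreal (- ext_ln (RN_deriv \<mu> \<nu> x)) \<partial>\<mu>) + (\<integral>\<^sup>+x. ennreal (- ln (E x)) \<partial>\<mu>) + (\<integral>\<^sup>+x. ennreal (E x) \<partial>\<nu>)"
    and "(\<integral>\<^sup>+x. e2ennreal (ext_ln (RN_deriv \<mu> \<nu> x)) \<partial>\<mu>) \<le> 1"
proof -
  interpret \<mu>: prob_space \<mu> by fact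
  interpret \<nu>: prob_space \<nu> by fact
  let ?r = "RN_deriv \<mu> \<nu>"
  have \<nu>: "density \<mu> ?r = \<nu>" by (rule \<mu>.density_RN_deriv[OF ac sets])
  have int: "(\<integral>\<^sup>+x. ?r x \<partial>\<mu>) = 1"
  proof -
    have "(\<integral>\<^sup>+x. ?r x \<partial>\<mu>) = emeasure (density \<mu> ?r) (space \<mu>)"
      by (simp add: emeasure_density cong: nn_integral_cong)
    also have "\<dots> = emeasure \<nu> (space \<nu>)" by (simp only: \<nu> sets_eq_imp_space_eq[OF sets])
    finally show ?thesis by (simp add: \<nu>.emeasure_space_1)
  qed
  then have fin: "AE x in \<mu>. ?r x \<noteq> \<infinity>" by (intro nn_integral_PInf_AE) auto
  have "(\<integral>\<^sup>+x. e2ennreal (ext_ln (?r x)) \<partial>\<mu>) \<le> (\<integral>\<^sup>+x. ?r x \<partial>\<mu>)"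
  proof (rule nn_integral_mono_AE, use fin in eventually_elim)
    case (elim x)
    show ?case
    proof (cases "?r x = 0")
      case False
      then obtain s where s: "?r x = ennreal s" "0 < s" using elim by (cases "?r x") auto
      have "ln s \<le> s" using ln_le_minus_one[OF s(2)] by simp
      then show ?thesis using s by (simp add: ext_ln_ennreal ennreal_leI)
    qed (simp add: ext_ln_def e2ennreal_neg)
  qed
  then show "(\<integral>\<^sup>+x. e2ennreal (ext_ln (?r x)) \<partial>\<mu>) \<le> 1" by (simp add: int)
  have "(\<integral>\<^sup>+x. e2ennreal (ext_ln (?r x)) + ennreal (ln (E x)) + 1 \<partial>\<mu>)
      \<le> (\<integral>\<^sup>+x. e2ennreal (- ext_ln (?r x)) + ennreal (- ln (E x)) + ?r x * ennreal (E x) \<partial>\<mu>)"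
  proof (rule nn_integral_mono_AE, use fin Epos in eventually_elim)
    case (elim x)
    show ?case
    proof (cases "?r x = 0")
      case False
      then obtain s where s: "?r x = ennreal s" "0 < s" using elim by (cases "?r x") auto
      show ?thesis using ennreal_log_le[OF s(2) elim(2)] s by (simp add: ext_ln_ennreal)
    qed (simp add: ext_ln_def e2ennreal_neg)
  qed
  moreover have "(\<integral>\<^sup>+x. ?r x * ennreal (E x) \<partial>\<mu>) = (\<integral>\<^sup>+x. ennreal (E x) \<partial>\<nu>)"
    using nn_integral_density[of ?r \<mu> "\<lambda>x. ennreal (E x)"] by (simp add: \<nu>)
  ultimately show "(\<integral>\<^sup>+x. e2ennreal (ext_ln (?r x)) \<partial>\<mu>) + (\<integral>\<^sup>+x. ennreal (ln (E x)) \<partial>\<mu>) + 1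
    \<le> (\<integral>\<^sup>+x. e2ennreal (- ext_ln (?r x)) \<partial>\<mu>) + (\<integral>\<^sup>+x. ennreal (- ln (E x)) \<partial>\<mu>) + (\<integral>\<^sup>+x. ennreal (E x) \<partial>\<nu>)"
    by (simp add: nn_integral_add \<mu>.emeasure_space_1)
qed

lemma KL_eq:
  assumes "absolutely_continuous \<mu> \<nu>"
    and p: "(\<integral>\<^sup>+x. e2ennreal (ext_ln (RN_deriv \<mu> \<nu> x)) \<partial>\<mu>) = ennreal p" "0 \<le> p"
  shows "KL \<mu> \<nu> = enn2ereal (\<integral>\<^sup>+x. e2ennreal (- ext_ln (RN_deriv \<mu> \<nu> x)) \<partial>\<mu>) - ereal p"
  using assms by (simp add: KL_def ext_integral_def enn2ereal_ennreal ereal_minus_diff_eq)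

lemma KL_nonneg:
  assumes \<mu>: "prob_space \<mu>" and \<nu>: "prob_space \<nu>" and sets: "sets \<nu> = sets \<mu>"
  shows "0 \<le> KL \<mu> \<nu>"
proof (cases "absolutely_continuous \<mu> \<nu>")
  case True
  let ?p = "\<integral>\<^sup>+x. e2ennreal (ext_ln (RN_deriv \<mu> \<nu> x)) \<partial>\<mu>"
  let ?n = "\<integral>\<^sup>+x. e2ennreal (- ext_ln (RN_deriv \<mu> \<nu> x)) \<partial>\<mu>"
  have 1: "?p + 1 \<le> ?n + 1" and 2: "?p \<le> 1"
    using KL_variational_aux[OF \<mu> \<nu> sets True, of "\<lambda>_. 1"]
    by (simp_all add: prob_space.emeasure_space_1[OF \<mu>] prob_space.emeasure_space_1[OF \<nu>])
  obtain p where p: "?p = ennreal p" "0 \<le> p" using 2 by (cases ?p) (auto simp: top_unique)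
  have "ennreal p \<le> ?n" using 1 p by (simp add: add.commute[of _ 1] ennreal_add_left_cancel_le)
  then have "enn2ereal (ennreal p) \<le> enn2ereal ?n" by (simp add: less_eq_ennreal.rep_eq)
  then show ?thesis unfolding KL_eq[OF True p]
    using p(2) by (simp add: enn2ereal_ennreal ereal_diff_positive)
qed (simp add: KL_def)

lemma KL_plus:
  assumes "absolutely_continuous \<mu> \<nu>"
    and p: "(\<integral>\<^sup>+x. e2ennreal (ext_ln (RN_deriv \<mu> \<nu> x)) \<partial>\<mu>) \<le> 1"
    and nn: "0 \<le> KL \<mu> \<nu>"
  shows "e2ennreal (KL \<mu> \<nu>) + (\<integral>\<^sup>+x. e2ennreal (ext_ln (RN_deriv \<mu> \<nu> x)) \<partial>\<mu>)
    = (\<integral>\<^sup>+x. e2ennreal (- ext_ln (RN_deriv \<mu> \<nu> x)) \<partial>\<mu>)"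
proof -
  let ?p = "\<integral>\<^sup>+x. e2ennreal (ext_ln (RN_deriv \<mu> \<nu> x)) \<partial>\<mu>"
  let ?n = "\<integral>\<^sup>+x. e2ennreal (- ext_ln (RN_deriv \<mu> \<nu> x)) \<partial>\<mu>"
  obtain p where p: "?p = ennreal p" "0 \<le> p" using p by (cases ?p) (auto simp: top_unique)
  note KL = KL_eq[OF assms(1) p]
  show ?thesis
  proof (cases ?n)
    case (real n)
    then have "KL \<mu> \<nu> = ereal (n - p)" unfolding KL by (simp add: enn2ereal_ennreal)
    then show ?thesis using nn p(2) real by (simp add: p(1) ennreal_plus[symmetric] del: ennreal_plus)
  next
    case top
    then show ?thesis unfolding KL p(1) by simp
  qed
qed

text \<open>
  Gibbs' variational inequality. In contrast to a density of a kernel, its right-hand side is visibly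
  measurable in the distribution \<open>\<nu>\<close>, which is what makes it useful for an arbitrary procedure.
\<close>

lemma KL_variational:
  assumes \<mu>: "prob_space \<mu>" and \<nu>: "prob_space \<nu>" and sets: "sets \<nu> = sets \<mu>"
    and E [measurable]: "E \<in> borel_measurable \<mu>" and E0: "\<And>x. 0 \<le> E x" and Epos: "AE x in \<mu>. 0 < E x"
  shows "(\<integral>\<^sup>+x. ennreal (ln (E x)) \<partial>\<mu>) + 1
    \<le> e2ennreal (KL \<mu> \<nu>) + (\<integral>\<^sup>+x. ennreal (- ln (E x)) \<partial>\<mu>) + (\<integral>\<^sup>+x. ennreal (E x) \<partial>\<nu>)"
proof (cases "absolutely_continuous \<mu> \<nu>")
  case True
  let ?p = "\<integral>\<^sup>+x. e2ennreal (ext_ln (RN_deriv \<mu> \<nu> x)) \<partial>\<mu>"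
  note aux = KL_variational_aux[OF \<mu> \<nu> sets True E E0 Epos]
  have "?p + ((\<integral>\<^sup>+x. ennreal (ln (E x)) \<partial>\<mu>) + 1)
    \<le> ?p + (e2ennreal (KL \<mu> \<nu>) + (\<integral>\<^sup>+x. ennreal (- ln (E x)) \<partial>\<mu>) + (\<integral>\<^sup>+x. ennreal (E x) \<partial>\<nu>))"
    using aux(1) unfolding KL_plus[OF True aux(2) KL_nonneg[OF \<mu> \<nu> sets], symmetric] by (simp add: add_ac)
  moreover have "?p \<noteq> \<infinity>" using aux(2) by (auto simp: top_unique)
  ultimately show ?thesis by (simp add: ennreal_add_left_cancel_le)
qed (simp add: KL_def)

lemma KL_density_eq:
  assumes \<mu>: "prob_space \<mu>" and E [measurable]: "E \<in> borel_measurable \<mu>" and Epos: "AE x in \<mu>. 0 < E x"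
    and \<nu>: "prob_space \<nu>" "\<nu> = density \<mu> (\<lambda>x. ennreal (inverse (E x)))"
  shows "e2ennreal (KL \<mu> \<nu>) + (\<integral>\<^sup>+x. ennreal (- ln (E x)) \<partial>\<mu>) = (\<integral>\<^sup>+x. ennreal (ln (E x)) \<partial>\<mu>)"
    and "(\<integral>\<^sup>+x. ennreal (- ln (E x)) \<partial>\<mu>) \<le> 1"
proof -
  interpret \<mu>: prob_space \<mu> by fact
  have sets: "sets \<nu> = sets \<mu>" by (simp add: \<nu>(2))
  have ac: "absolutely_continuous \<mu> \<nu>" unfolding \<nu>(2) by (rule absolutely_continuousI_density) measurable
  have "AE x in \<mu>. RN_deriv \<mu> \<nu> x = ennreal (inverse (E x))"
  proof -
    have "AE x in \<mu>. ennreal (inverse (E x)) = RN_deriv \<mu> \<nu> x"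
      by (rule \<mu>.RN_deriv_unique[OF _ \<nu>(2)[symmetric]]) measurable
    then show ?thesis by eventually_elim (rule sym)
  qed
  then have r: "AE x in \<mu>. ext_ln (RN_deriv \<mu> \<nu> x) = ereal (- ln (E x))"
    using Epos by eventually_elim (simp add: ext_ln_ennreal ln_inverse)
  have pos: "(\<integral>\<^sup>+x. e2ennreal (ext_ln (RN_deriv \<mu> \<nu> x)) \<partial>\<mu>) = (\<integral>\<^sup>+x. ennreal (- ln (E x)) \<partial>\<mu>)"
    by (rule nn_integral_cong_AE, use r in eventually_elim) simp
  have neg: "(\<integral>\<^sup>+x. e2ennreal (- ext_ln (RN_deriv \<mu> \<nu> x)) \<partial>\<mu>) = (\<integral>\<^sup>+x. ennreal (ln (E x)) \<partial>\<mu>)"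
    by (rule nn_integral_cong_AE, use r in eventually_elim) simp
  note aux = KL_variational_aux(2)[OF \<mu> \<nu>(1) sets ac, of "\<lambda>_. 1"]
  show "(\<integral>\<^sup>+x. ennreal (- ln (E x)) \<partial>\<mu>) \<le> 1" using aux by (simp add: pos)
  show "e2ennreal (KL \<mu> \<nu>) + (\<integral>\<^sup>+x. ennreal (- ln (E x)) \<partial>\<mu>) = (\<integral>\<^sup>+x. ennreal (ln (E x)) \<partial>\<mu>)"
    using KL_plus[OF ac _ KL_nonneg[OF \<mu> \<nu>(1) sets]] aux by (simp add: pos neg)
qed

section \<open>The posterior predictive distribution\<close>

definition pred_density ::
  "real \<Rightarrow> ('d::{finite,wellorder}, 'n::finite) sample \<Rightarrow> ('d, 'm::finite) sample \<Rightarrow> ennreal" where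
  "pred_density c y ys = joint_evidence c y ys / evidence c y"

lemma borel_measurable_pred_density [measurable]:
  "(\<lambda>(y, ys). pred_density c y ys) \<in> borel_measurable
    ((borel :: ('d::{finite,wellorder}, 'n::finite) sample measure) \<Otimes>\<^sub>M (borel :: ('d, 'm::finite) sample measure))"
  unfolding pred_density_def by measurable

lemma nn_integral_pred_density:
  fixes y :: "('d::{finite,wellorder}, 'n::finite) sample"
  assumes c: "0 < c" and y: "evidence c y < \<infinity>"
  shows "(\<integral>\<^sup>+ys. pred_density c y (ys :: ('d, 'm::finite) sample) \<partial>lborel) = 1"
proof -
  have [measurable]: "joint_evidence c y \<in> borel_measurable (borel :: ('d, 'm) sample measure)"
    using borel_measurable_joint_evidence by measurable
  have "(\<integral>\<^sup>+ys. pred_density c y (ys :: ('d, 'm) sample) \<partial>lborel) = evidence c y / evidence c y"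
    unfolding pred_density_def by (simp add: nn_integral_divide nn_integral_joint_evidence)
  also have "\<dots> = 1" using y evidence_pos[OF c, of y] by (intro ennreal_divide_self) auto
  finally show ?thesis .
qed

lemma posterior_predictive_eq:
  fixes y :: "('d::{finite,wellorder}, 'n::finite) sample"
  assumes c: "0 < c"
  shows "(posterior_predictive c y :: ('d, 'm::finite) sample measure option)
     = (if evidence c y < \<infinity> then Some (density lborel (pred_density c y)) else None)"
  using evidence_pos[OF c, of y]
  by (simp add: posterior_predictive_def Let_def predictive_weight_eq nn_integral_joint_evidence pred_density_def[abs_def])

lemma prob_space_pred:
  fixes y :: "('d::{finite,wellorder}, 'n::finite) sample"
  assumes "0 < c" "evidence c y < \<infinity>"
  shows "prob_space (density lborel (pred_density c y :: ('d, 'm::finite) sample \<Rightarrow> ennreal))"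
  by (rule prob_spaceI) (simp add: emeasure_density nn_integral_pred_density[OF assms])

lemma dom_posterior_predictive:
  "0 < c \<Longrightarrow> dom (posterior_predictive c :: ('d::{finite,wellorder}, 'n::finite, 'm::finite) procedure) = {y. evidence c y < \<infinity>}"
  by (auto simp: dom_def posterior_predictive_eq)

lemma predictive_procedure_posterior:
  assumes c: "0 < c" and card: "CARD('d::{finite,wellorder}) < CARD('n::finite)"
  shows "predictive_procedure (posterior_predictive c :: ('d, 'n, 'm::finite) procedure)"
proof -
  let ?q = "posterior_predictive c :: ('d, 'n, 'm) procedure"
  let ?D = "{y :: ('d, 'n) sample. evidence c y < \<infinity>}"
  have "AE y in lborel. y \<in> dom ?q"
    using AE_evidence_finite[OF c card] by (simp add: dom_posterior_predictive[OF c])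
  moreover have "(\<lambda>y. the (?q y)) \<in> restrict_space borel ?D \<rightarrow>\<^sub>M prob_algebra borel"
  proof (rule measurable_prob_algebraI)
    fix y :: "('d, 'n) sample" assume "y \<in> space (restrict_space borel ?D)"
    then show "prob_space (the (?q y))"
      by (simp add: space_restrict_space posterior_predictive_eq[OF c] prob_space_pred[OF c])
  next
    show "(\<lambda>y. the (?q y)) \<in> restrict_space borel ?D \<rightarrow>\<^sub>M subprob_algebra borel"
    proof (rule measurable_subprob_algebra)
      fix y :: "('d, 'n) sample" assume "y \<in> space (restrict_space borel ?D)"
      then have y: "evidence c y < \<infinity>" by (simp add: space_restrict_space)
      show "subprob_space (the (?q y))"
        using y by (simp add: posterior_predictive_eq[OF c] prob_space_imp_subprob_space prob_space_pred[OF c])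
      show "sets (the (?q y)) = sets borel" using y by (simp add: posterior_predictive_eq[OF c])
    next
      fix A :: "('d, 'm) sample set" assume [measurable]: "A \<in> sets borel"
      have "(\<lambda>y. \<integral>\<^sup>+ys. pred_density c y ys * indicator A ys \<partial>lborel) \<in> borel_measurable (borel :: ('d, 'n) sample measure)"
        by measurable
      then have "(\<lambda>y. \<integral>\<^sup>+ys. pred_density c y ys * indicator A ys \<partial>lborel) \<in> borel_measurable (restrict_space borel ?D)"
        by (rule measurable_restrict_space1)
      then show "(\<lambda>y. emeasure (the (?q y)) A) \<in> borel_measurable (restrict_space borel ?D)"
        by (subst measurable_cong[where g = "\<lambda>y. \<integral>\<^sup>+ys. pred_density c y ys * indicator A ys \<partial>lborel"])
          (simp_all add: space_restrict_space posterior_predictive_eq[OF c] emeasure_density)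
    qed
  qed
  ultimately show ?thesis by (simp add: predictive_procedure_def dom_posterior_predictive[OF c])
qed

lemma ennreal_divide_cancel_common:
  fixes k a b :: ennreal
  assumes "0 < k" "k < \<infinity>"
  shows "(k * a) / (k * b) = a / b"
proof -
  obtain r where r: "k = ennreal r" "0 < r" using assms by (cases k) auto
  show ?thesis
  proof (cases "b = 0 \<or> b = \<infinity>")
    case True
    then show ?thesis using r
      by (auto simp: ennreal_mult_top divide_ennreal_def ennreal_mult_eq_top_iff ennreal_top_mult ennreal_mult_top)
  next
    case False
    then have "inverse (k * b) = inverse k * inverse b"
      using assms by (intro ennreal_inverse_mult) (auto simp: less_top)
    then have "(k * a) / (k * b) = (k * inverse k) * (a * inverse b)"
      by (simp add: divide_ennreal_def mult_ac)
    also have "k * inverse k = 1" using r by (simp add: inverse_ennreal ennreal_mult''[symmetric])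
    finally show ?thesis by (simp add: divide_ennreal_def)
  qed
qed

lemma pred_density_act:
  fixes y :: "('d::{finite,wellorder}, 'n::finite) sample" and ys :: "('d, 'm::finite) sample"
  assumes g: "g \<in> Theta" and c: "0 < c"
  shows "pred_density c (act_all g y) (act_all g ys) = ennreal (1 / det (fst g) ^ CARD('m)) * pred_density c y ys"
proof -
  obtain C where C: "0 < C" "C < \<infinity>" "evidence c (act_all g y) = C * evidence c y"
    "joint_evidence c (act_all g y) (act_all g ys) = C * ennreal (1 / det (fst g) ^ CARD('m)) * joint_evidence c y ys"
    using evidence_act[OF g c, where 'n = 'n and 'm = 'm] by (elim exE conjE) simp
  show ?thesis
    unfolding pred_density_def C(3,4) mult.assoc ennreal_divide_cancel_common[OF C(1,2)]
    by (rule ennreal_times_divide[symmetric])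
qed

lemma act_all_image_borel:
  fixes A :: "('d::{finite,wellorder}, 'k::finite) sample set"
  assumes g: "g \<in> Theta" and A: "A \<in> sets borel"
  shows "act_all g ` A \<in> sets borel"
proof -
  let ?B = "matrix_inv (fst g)"
  define h :: "('d, 'k) sample \<Rightarrow> ('d, 'k) sample" where "h = (\<lambda>y. \<chi> i. ?B *v (y $ i - snd g))"
  have eq: "fst g ** ?B = mat 1" by (rule matrix_inv_right[OF Theta_invertible[OF g]])
  have gh: "act_all g (h y) = y" for y
    by (subst vec_eq_iff) (simp add: h_def act_all_nth matrix_vector_mul_assoc eq)
  have hg: "h (act_all g y) = y" for y by (rule injD[OF act_all_inj[OF g] gh])
  have "act_all g ` A = h -` A" using gh hg by (auto simp: image_iff) (metis gh)
  moreover have "h \<in> borel_measurable borel" unfolding h_def by measurable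
  ultimately show ?thesis using A by (simp add: measurable_sets_borel)
qed

lemma invariant_posterior:
  assumes c: "0 < c"
  shows "invariant_procedure (posterior_predictive c :: ('d::{finite,wellorder}, 'n::finite, 'm::finite) procedure)"
  unfolding invariant_procedure_def
proof (intro ballI conjI)
  let ?q = "posterior_predictive c :: ('d, 'n, 'm) procedure"
  fix g :: "'d affine" and y :: "('d, 'n) sample"
  assume "g \<in> carrier G_N" and "y \<in> dom ?q"
  then have g: "g \<in> Theta" and y: "evidence c y < \<infinity>"
    by (simp_all add: G_N_def dom_posterior_predictive[OF c])
  obtain C where C: "0 < C" "C < \<infinity>" "evidence c (act_all g y) = C * evidence c y"
    using evidence_act[OF g c, where 'n = 'n and 'm = 'm] by (elim exE conjE) simp
  have gy: "evidence c (act_all g y) < \<infinity>" using C y by (simp add: ennreal_mult_less_top)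
  then show "act_all g y \<in> dom ?q" by (simp add: dom_posterior_predictive[OF c])
  fix A :: "('d, 'm) sample set" assume A [measurable]: "A \<in> sets borel"
  have gA [measurable]: "act_all g ` A \<in> sets borel" by (rule act_all_image_borel[OF g A])
  have d: "0 < det (fst g)" by (rule det_Theta_pos[OF g])
  have "emeasure (the (?q (act_all g y))) (act_all g ` A)
      = (\<integral>\<^sup>+ys. pred_density c (act_all g y) ys * indicator (act_all g ` A) ys \<partial>lborel)"
    using gy by (simp add: posterior_predictive_eq[OF c] emeasure_density)
  also have "\<dots> = (\<integral>\<^sup>+ys. pred_density c (act_all g y) (act_all g ys) * indicator (act_all g ` A) (act_all g ys) \<partial>lborel)
      * ennreal (det (fst g) ^ CARD('m))"
    by (rule nn_integral_act_all_det[OF g, symmetric]) measurable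
  also have "\<dots> = (\<integral>\<^sup>+ys. pred_density c (act_all g y) (act_all g ys) * indicator (act_all g ` A) (act_all g ys)
      * ennreal (det (fst g) ^ CARD('m)) \<partial>lborel)"
    by (rule nn_integral_multc[symmetric]) measurable
  also have "\<dots> = (\<integral>\<^sup>+ys. pred_density c y ys * indicator A ys \<partial>lborel)"
  proof (rule nn_integral_cong)
    fix ys :: "('d, 'm) sample"
    have "indicator (act_all g ` A) (act_all g ys) = (indicator A ys :: ennreal)"
      by (simp add: indicator_def inj_image_mem_iff[OF act_all_inj[OF g]])
    moreover have one: "ennreal (1 / det (fst g) ^ CARD('m)) * ennreal (det (fst g) ^ CARD('m)) = 1"
      using d by (simp add: ennreal_mult''[symmetric])
    have "ennreal (1 / det (fst g) ^ CARD('m)) * pred_density c y ys * indicator A ys * ennreal (det (fst g) ^ CARD('m))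
       = (ennreal (1 / det (fst g) ^ CARD('m)) * ennreal (det (fst g) ^ CARD('m))) * (pred_density c y ys * indicator A ys)"
      by (simp only: mult_ac)
    then have "ennreal (1 / det (fst g) ^ CARD('m)) * pred_density c y ys * indicator A ys * ennreal (det (fst g) ^ CARD('m))
       = pred_density c y ys * indicator A ys"
      by (simp only: one mult_1)
    ultimately show "pred_density c (act_all g y) (act_all g ys) * indicator (act_all g ` A) (act_all g ys)
      * ennreal (det (fst g) ^ CARD('m)) = pred_density c y ys * indicator A ys"
      by (simp only: pred_density_act[OF g c])
  qed
  also have "\<dots> = emeasure (the (?q y)) A"
    using y by (simp add: posterior_predictive_eq[OF c] emeasure_density)
  finally show "emeasure (the (?q y)) A = emeasure (the (?q (act_all g y))) (act_all g ` A)" ..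
qed

section \<open>The risk of the posterior predictive\<close>

lemma cond_law_eq: "\<theta> \<in> Theta \<Longrightarrow> cond_law \<theta> y = data_law \<theta>"
  by (simp add: cond_law_def data_law_def cond_density_def joint_density_def less_imp_neq[OF iid_density_pos, symmetric])

lemma data_law_eq: "\<theta> \<in> Theta \<Longrightarrow> data_law \<theta> = density lborel (\<lambda>y. ennreal (lik \<theta> y))"
  by (simp add: data_law_def)

lemma prob_space_data_law: "\<theta> \<in> Theta \<Longrightarrow> prob_space (data_law \<theta>)"
  by (rule prob_spaceI) (simp add: data_law_eq emeasure_density nn_integral_lik del: lik_Theta)

lemma nn_integral_data_law:
  assumes "\<theta> \<in> Theta" and [measurable]: "f \<in> borel_measurable borel"
  shows "(\<integral>\<^sup>+y. f y \<partial>data_law \<theta>) = (\<integral>\<^sup>+y. ennreal (lik \<theta> y) * f y \<partial>lborel)"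
  unfolding data_law_eq[OF assms(1)] by (rule nn_integral_density) measurable

lemma sets_data_law [simp, measurable_cong]: "sets (data_law \<theta>) = sets borel"
  by (simp add: data_law_def)

text \<open>
  The density ratio of \<open>p\<^sub>\<theta>\<close> and the posterior predictive. Where the latter is infinite or zero the value
  is 0, and so \<open>ratio * pred_density \<le> lik\<close> holds at every point; a procedure may charge null sets.
\<close>

definition ratio ::
  "real \<Rightarrow> 'd::{finite,wellorder} affine \<Rightarrow> ('d, 'n::finite) sample \<Rightarrow> ('d, 'm::finite) sample \<Rightarrow> real" where
  "ratio c \<theta> y ys = enn2real (ennreal (lik \<theta> ys) / pred_density c y ys)"

lemma ratio_nonneg [simp]: "0 \<le> ratio c \<theta> y ys"
  by (simp add: ratio_def)

lemma borel_measurable_pred_density_raw [measurable (raw)]: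
  fixes f :: "'x \<Rightarrow> ('d::{finite,wellorder}, 'n::finite) sample" and g :: "'x \<Rightarrow> ('d, 'm::finite) sample"
  assumes "f \<in> borel_measurable M" "g \<in> borel_measurable M"
  shows "(\<lambda>x. pred_density c (f x) (g x)) \<in> borel_measurable M"
  using measurable_compose[OF measurable_Pair[OF assms] borel_measurable_pred_density] by simp

lemma borel_measurable_ratio [measurable (raw)]:
  fixes f :: "'x \<Rightarrow> ('d::{finite,wellorder}, 'n::finite) sample" and g :: "'x \<Rightarrow> ('d, 'm::finite) sample"
  assumes [measurable]: "t \<in> borel_measurable M" "f \<in> borel_measurable M" "g \<in> borel_measurable M"
  shows "(\<lambda>x. ratio c (t x) (f x) (g x)) \<in> borel_measurable M"
  unfolding ratio_def by measurable

text \<open>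
  The integrals of the positive and of the negative part of the logarithm of the ratio. Their
  difference is the divergence of the posterior predictive from \<open>p\<^sub>\<theta>\<close>
  (\<open>KL_posterior_predictive\<close>). The argument of type \<open>'m itself\<close> records the number of future points.
\<close>

definition log_pos :: "'m::finite itself \<Rightarrow> real \<Rightarrow> 'd::{finite,wellorder} affine \<Rightarrow> ('d, 'n::finite) sample \<Rightarrow> ennreal" where
  "log_pos (_ :: 'm itself) c \<theta> y = (\<integral>\<^sup>+ys. ennreal (lik \<theta> ys) * ennreal (ln (ratio c \<theta> y (ys :: ('d, 'm) sample))) \<partial>lborel)"

definition log_neg :: "'m::finite itself \<Rightarrow> real \<Rightarrow> 'd::{finite,wellorder} affine \<Rightarrow> ('d, 'n::finite) sample \<Rightarrow> ennreal" where
  "log_neg (_ :: 'm itself) c \<theta> y = (\<integral>\<^sup>+ys. ennreal (lik \<theta> ys) * ennreal (- ln (ratio c \<theta> y (ys :: ('d, 'm) sample))) \<partial>lborel)"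

definition loss :: "'m::finite itself \<Rightarrow> real \<Rightarrow> 'd::{finite,wellorder} affine \<Rightarrow> ('d, 'n::finite) sample \<Rightarrow> ennreal" where
  "loss (_ :: 'm itself) c \<theta> y = log_pos TYPE('m) c \<theta> y - log_neg TYPE('m) c \<theta> y"

lemma borel_measurable_log_pos [measurable (raw)]:
  fixes f :: "'x \<Rightarrow> ('d::{finite,wellorder}, 'n::finite) sample"
  assumes [measurable]: "t \<in> borel_measurable M" "f \<in> borel_measurable M"
  shows "(\<lambda>x. log_pos TYPE('m::finite) c (t x) (f x)) \<in> borel_measurable M"
  unfolding log_pos_def by measurable

lemma borel_measurable_log_neg [measurable (raw)]:
  fixes f :: "'x \<Rightarrow> ('d::{finite,wellorder}, 'n::finite) sample"
  assumes [measurable]: "t \<in> borel_measurable M" "f \<in> borel_measurable M"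
  shows "(\<lambda>x. log_neg TYPE('m::finite) c (t x) (f x)) \<in> borel_measurable M"
  unfolding log_neg_def by measurable

lemma borel_measurable_loss [measurable (raw)]:
  fixes f :: "'x \<Rightarrow> ('d::{finite,wellorder}, 'n::finite) sample"
  assumes [measurable]: "t \<in> borel_measurable M" "f \<in> borel_measurable M"
  shows "(\<lambda>x. loss TYPE('m::finite) c (t x) (f x)) \<in> borel_measurable M"
  unfolding loss_def by measurable

lemma AE_ratio_pos:
  fixes y :: "('d::{finite,wellorder}, 'n::finite) sample"
  assumes \<theta>: "\<theta> \<in> Theta" and c: "0 < c" and y: "evidence c y < \<infinity>"
  shows "AE ys in lborel. 0 < ratio c \<theta> y (ys :: ('d, 'm::finite) sample) \<and>
    ennreal (lik \<theta> ys) * ennreal (inverse (ratio c \<theta> y ys)) = pred_density c y ys"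
proof -
  have "AE ys in lborel. pred_density c y (ys :: ('d, 'm) sample) \<noteq> \<infinity>"
    using nn_integral_pred_density[OF c y, where 'm = 'm] by (intro nn_integral_PInf_AE) auto
  then show ?thesis
  proof eventually_elim
    case (elim ys)
    have "0 < pred_density c y ys"
      using joint_evidence_pos[OF c, of y ys] y by (simp add: pred_density_def ennreal_zero_less_divide)
    then obtain r where r: "pred_density c y ys = ennreal r" "0 < r"
      using elim by (cases "pred_density c y ys") auto
    have l: "0 < iid_density \<theta> ys" by (rule iid_density_pos[OF \<theta>])
    have "ratio c \<theta> y ys = iid_density \<theta> ys / r"
      using l r \<theta> by (simp add: ratio_def divide_ennreal)
    then show ?case using l r \<theta> by (simp add: ennreal_mult''[symmetric])
  qed
qed

lemma KL_posterior_predictive: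
  fixes y :: "('d::{finite,wellorder}, 'n::finite) sample"
  assumes \<theta>: "\<theta> \<in> Theta" and c: "0 < c" and y: "evidence c y < \<infinity>"
  defines "\<nu> \<equiv> density lborel (pred_density c y :: ('d, 'm::finite) sample \<Rightarrow> ennreal)"
  shows "e2ennreal (KL (data_law \<theta>) \<nu>) = loss TYPE('m) c \<theta> y" and "log_neg TYPE('m) c \<theta> y \<le> 1"
    and "loss TYPE('m) c \<theta> y + log_neg TYPE('m) c \<theta> y = log_pos TYPE('m) c \<theta> y"
proof -
  let ?\<mu> = "data_law \<theta> :: ('d, 'm) sample measure"
  let ?E = "\<lambda>ys :: ('d, 'm) sample. ratio c \<theta> y ys"
  have E [measurable]: "?E \<in> borel_measurable ?\<mu>" by measurable
  have pos: "AE ys in ?\<mu>. 0 < ?E ys"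
    unfolding data_law_eq[OF \<theta>] using AE_ratio_pos[OF \<theta> c y]
    by (subst AE_density) auto
  have \<nu>: "\<nu> = density ?\<mu> (\<lambda>ys. ennreal (inverse (?E ys)))"
    unfolding \<nu>_def data_law_eq[OF \<theta>]
    by (subst density_density_eq, measurable, rule density_cong, measurable)
      (use AE_ratio_pos[OF \<theta> c y] in \<open>eventually_elim, simp\<close>)
  have "prob_space \<nu>" unfolding \<nu>_def by (rule prob_space_pred[OF c y])
  note KL = KL_density_eq[OF prob_space_data_law[OF \<theta>] E pos this \<nu>]
  have p: "(\<integral>\<^sup>+ys. ennreal (ln (?E ys)) \<partial>?\<mu>) = log_pos TYPE('m) c \<theta> y"
    and n: "(\<integral>\<^sup>+ys. ennreal (- ln (?E ys)) \<partial>?\<mu>) = log_neg TYPE('m) c \<theta> y"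
    unfolding log_pos_def log_neg_def by (rule nn_integral_data_law[OF \<theta>], measurable)+
  show n1: "log_neg TYPE('m) c \<theta> y \<le> 1" using KL(2) by (simp add: n)
  have sum: "e2ennreal (KL ?\<mu> \<nu>) + log_neg TYPE('m) c \<theta> y = log_pos TYPE('m) c \<theta> y" using KL(1) by (simp add: n p)
  have "log_neg TYPE('m) c \<theta> y \<noteq> \<infinity>" using n1 by (auto simp: top_unique)
  then show "e2ennreal (KL ?\<mu> \<nu>) = loss TYPE('m) c \<theta> y"
    unfolding loss_def sum[symmetric] by (simp add: ennreal_add_diff_cancel_right)
  then show "loss TYPE('m) c \<theta> y + log_neg TYPE('m) c \<theta> y = log_pos TYPE('m) c \<theta> y" using sum by simp
qed

lemma ratio_act:
  assumes \<theta>: "\<theta> \<in> Theta" and c: "0 < c"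
  shows "ratio c \<theta> (act_all \<theta> y) (act_all \<theta> (zs :: ('d::{finite,wellorder}, 'm::finite) sample)) = ratio c gunit y zs"
proof -
  have d: "0 < det (fst \<theta>)" by (rule det_Theta_pos[OF \<theta>])
  let ?k = "ennreal (1 / det (fst \<theta>) ^ CARD('m))"
  have "ennreal (lik \<theta> (act_all \<theta> zs)) = ?k * ennreal (lik gunit zs)"
    using d \<theta> by (simp add: iid_density_act[OF \<theta>] ennreal_mult''[symmetric] less_imp_le[OF iid_density_gunit_pos])
  moreover have "0 < ?k" "?k < \<infinity>" using d by auto
  ultimately show ?thesis
    unfolding ratio_def by (simp only: pred_density_act[OF \<theta> c] ennreal_divide_cancel_common)
qed

lemma log_act:
  fixes z :: "('d::{finite,wellorder}, 'n::finite) sample"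
  assumes \<theta>: "\<theta> \<in> Theta" and c: "0 < c"
  shows "log_pos TYPE('m::finite) c \<theta> (act_all \<theta> z) = log_pos TYPE('m) c gunit z" "log_neg TYPE('m) c \<theta> (act_all \<theta> z) = log_neg TYPE('m) c gunit z"
proof -
  have *: "(\<integral>\<^sup>+(ys :: ('d, 'm) sample). ennreal (lik \<theta> ys) * f (ratio c \<theta> (act_all \<theta> z) ys) \<partial>lborel)
     = (\<integral>\<^sup>+zs. ennreal (lik gunit zs) * f (ratio c gunit z (zs :: ('d, 'm) sample)) \<partial>lborel)"
    if [measurable]: "f \<in> borel_measurable borel" for f :: "real \<Rightarrow> ennreal"
    using nn_integral_iid_density_act[OF \<theta>, of "\<lambda>ys :: ('d, 'm) sample. f (ratio c \<theta> (act_all \<theta> z) ys)"] \<theta>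
    by (simp add: ratio_act[OF \<theta> c])
  show "log_pos TYPE('m) c \<theta> (act_all \<theta> z) = log_pos TYPE('m) c gunit z"
    unfolding log_pos_def by (rule *[of "\<lambda>x. ennreal (ln x)"]) measurable
  show "log_neg TYPE('m) c \<theta> (act_all \<theta> z) = log_neg TYPE('m) c gunit z"
    unfolding log_neg_def by (rule *[of "\<lambda>x. ennreal (- ln x)"]) measurable
qed

lemma loss_act:
  assumes "\<theta> \<in> Theta" "0 < c"
  shows "loss TYPE('m::finite) c \<theta> (act_all \<theta> z) = loss TYPE('m) c gunit z"
  by (simp only: loss_def log_act[OF assms])

definition risk ::
  "(('d::{finite,wellorder}, 'n::finite) sample \<Rightarrow> ('d, 'm::finite) sample measure) \<Rightarrow> 'd affine \<Rightarrow> ennreal" where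
  "risk Q \<theta> = (\<integral>\<^sup>+y. e2ennreal (KL (data_law \<theta>) (Q y)) \<partial>data_law \<theta>)"

text \<open>
  By equivariance the divergence at \<open>y = \<theta> z\<close> is the divergence at \<open>z\<close> for the unit parameter. Hence
  the risk does not depend on the parameter.
\<close>

lemma risk_posterior_predictive:
  fixes \<theta> :: "'d::{finite,wellorder} affine"
  assumes \<theta>: "\<theta> \<in> Theta" and c: "0 < c" and card: "CARD('d) < CARD('n::finite)"
  shows "risk (\<lambda>y :: ('d, 'n) sample. the (posterior_predictive c y) :: ('d, 'm::finite) sample measure) \<theta>
    = (\<integral>\<^sup>+z. ennreal (lik gunit z) * loss TYPE('m) c gunit (z :: ('d, 'n) sample) \<partial>lborel)"
proof -
  have fin: "AE y in data_law \<theta>. evidence c (y :: ('d, 'n) sample) < \<infinity>"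
    unfolding data_law_eq[OF \<theta>] using AE_evidence_finite[OF c card] by (subst AE_density) auto
  have "risk (\<lambda>y :: ('d, 'n) sample. the (posterior_predictive c y) :: ('d, 'm) sample measure) \<theta>
     = (\<integral>\<^sup>+y. loss TYPE('m) c \<theta> (y :: ('d, 'n) sample) \<partial>data_law \<theta>)"
    unfolding risk_def
    by (rule nn_integral_cong_AE, use fin in eventually_elim)
      (simp add: posterior_predictive_eq[OF c] KL_posterior_predictive(1)[OF \<theta> c])
  also have "\<dots> = (\<integral>\<^sup>+y. ennreal (lik \<theta> y) * loss TYPE('m) c \<theta> (y :: ('d, 'n) sample) \<partial>lborel)"
    by (rule nn_integral_data_law[OF \<theta>]) measurable
  also have "\<dots> = (\<integral>\<^sup>+z. ennreal (lik gunit z) * loss TYPE('m) c \<theta> (act_all \<theta> (z :: ('d, 'n) sample)) \<partial>lborel)"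
    using nn_integral_iid_density_act[OF \<theta>, of "\<lambda>y :: ('d, 'n) sample. loss TYPE('m) c \<theta> y"] \<theta> by simp
  finally show ?thesis by (simp only: loss_act[OF \<theta> c])
qed

section \<open>The minimax lower bound\<close>

text \<open>
  Where the evidence is infinite, the value is 0, so as a weight it removes the samples for which the
  posterior is improper.
\<close>

definition posterior_prob ::
  "real \<Rightarrow> 'd::{finite,wellorder} affine set \<Rightarrow> ('d, 'n::finite) sample \<Rightarrow> ennreal" where
  "posterior_prob c F y = (\<integral>\<^sup>+\<theta>. indicator F \<theta> * ennreal (lik \<theta> y) \<partial>prior c) / evidence c y"

lemma borel_measurable_posterior_prob [measurable]:
  fixes F :: "'d::{finite,wellorder} affine set"
  assumes [measurable]: "F \<in> sets borel"
  shows "posterior_prob c F \<in> borel_measurable (borel :: ('d, 'n::finite) sample measure)"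
proof -
  interpret sigma_finite_measure "prior c :: 'd affine measure" by (rule sigma_finite_prior)
  show ?thesis unfolding posterior_prob_def[abs_def] by measurable
qed

lemma posterior_prob_le_1:
  assumes c: "0 < c"
  shows "posterior_prob c F y \<le> 1"
  unfolding posterior_prob_def
proof (rule ennreal_divide_le_one[OF _ evidence_pos[OF c]])
  show "(\<integral>\<^sup>+\<theta>. indicator F \<theta> * ennreal (lik \<theta> y) \<partial>prior c) \<le> evidence c y"
    unfolding evidence_def by (intro nn_integral_mono) (auto split: split_indicator)
qed

lemma posterior_prob_infinite: "\<not> evidence c y < \<infinity> \<Longrightarrow> posterior_prob c F y = 0"
  by (simp add: posterior_prob_def less_top[symmetric])

lemma ennreal_times_divide_le: "x * (z / x) \<le> (z :: ennreal)"
proof (cases "x = 0 \<or> x = \<infinity>")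
  case False
  then have "z * x / x = z" by (intro ennreal_mult_divide_eq) (auto simp: less_top)
  then show ?thesis by (simp add: ennreal_times_divide mult.commute)
qed auto

lemma ennreal_le_diff_add: "a \<le> (a - b) + (b :: ennreal)"
proof (cases "b \<le> a")
  case True
  then show ?thesis by (simp add: diff_add_cancel_ennreal)
next
  case False
  then have "a \<le> b" by simp
  also have "b \<le> (a - b) + b" by simp
  finally show ?thesis .
qed

text \<open>
  The left-hand side averages over \<open>\<theta>\<close> uniform on \<open>F\<close> and \<open>y\<close> drawn from \<open>p\<^sub>\<theta>\<close>. The posterior
  probability of \<open>F\<close> as a weight makes the kernel term integrate to at most 1: after integration over
  \<open>\<theta>\<close>, the density ratio leaves \<open>posterior_prob c F y * evidence c y\<close>, which is the integral of the
  likelihood over \<open>F\<close>, and integrating it over \<open>y\<close> yields the prior mass of \<open>F\<close>.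
\<close>

lemma bayes_risk_bound:
  fixes F :: "'d::{finite,wellorder} affine set"
    and Q :: "('d, 'n::finite) sample \<Rightarrow> ('d, 'm::finite) sample measure"
  assumes c: "0 < c" and Q: "Q \<in> borel \<rightarrow>\<^sub>M prob_algebra borel"
    and \<rho>: "\<And>\<theta>. \<theta> \<in> Theta \<Longrightarrow> risk Q \<theta> \<le> \<rho>"
    and F [measurable]: "F \<in> sets borel" and FT: "F \<subseteq> Theta"
    and F0: "0 < emeasure (prior c) F" and F1: "emeasure (prior c) F < \<infinity>"
  shows "(\<integral>\<^sup>+\<theta>. indicator F \<theta> / emeasure (prior c) F *
      (\<integral>\<^sup>+y. ennreal (lik \<theta> y) * (posterior_prob c F y * (loss TYPE('m) c \<theta> (y :: ('d, 'n) sample) + 1)) \<partial>lborel) \<partial>prior c) \<le> \<rho> + 1"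
proof -
  let ?P = "prior c :: 'd affine measure" let ?Y = "lborel :: ('d, 'n) sample measure"
  let ?m = "emeasure ?P F"
  interpret P: sigma_finite_measure ?P by (rule sigma_finite_prior)
  interpret PY: pair_sigma_finite ?P ?Y ..
  let ?v = "posterior_prob c F :: ('d, 'n) sample \<Rightarrow> ennreal"
  have Qs: "Q \<in> borel \<rightarrow>\<^sub>M subprob_algebra borel" by (rule measurable_prob_algebraD[OF Q])
  have Qp: "prob_space (Q y)" "sets (Q y) = sets borel" for y
    using measurable_space[OF Q, of y] by (auto simp: space_prob_algebra)
  define B where "B = (\<lambda>p. \<integral>\<^sup>+ys. ennreal (ratio c (fst p) (snd p) ys) \<partial>Q (snd p :: ('d, 'n) sample))"
  have B [measurable]: "B \<in> borel_measurable (?P \<Otimes>\<^sub>M ?Y)"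
    unfolding B_def
  proof (rule nn_integral_measurable_subprob_algebra2)
    show "(\<lambda>p. Q (snd p)) \<in> ?P \<Otimes>\<^sub>M ?Y \<rightarrow>\<^sub>M subprob_algebra borel"
      by (rule measurable_compose[OF _ Qs]) measurable
  qed measurable
  let ?pos = "\<lambda>p. log_pos TYPE('m) c (fst p) (snd p :: ('d, 'n) sample)"
  let ?neg = "\<lambda>p. log_neg TYPE('m) c (fst p) (snd p :: ('d, 'n) sample)"
  let ?loss = "\<lambda>p. loss TYPE('m) c (fst p) (snd p :: ('d, 'n) sample)"
  (* A jointly measurable minorant of the divergence of the procedure from the model. *)
  define l where "l = (\<lambda>p. if B p < \<infinity> then (?pos p + 1) - (?neg p + B p) else 0)"
  have l [measurable]: "l \<in> borel_measurable (?P \<Otimes>\<^sub>M ?Y)" unfolding l_def by measurable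
  define w where "w = (\<lambda>p. indicator F (fst p) / ?m * (ennreal (lik (fst p) (snd p)) * ?v (snd p)))"
  let ?J = "\<lambda>f. \<integral>\<^sup>+p. w p * f p \<partial>(?P \<Otimes>\<^sub>M ?Y)"
  let ?I = "\<lambda>\<theta> f. \<integral>\<^sup>+y. ennreal (lik \<theta> y) * (?v y * f (\<theta>, y)) \<partial>lborel"
  have w [measurable]: "w \<in> borel_measurable (?P \<Otimes>\<^sub>M ?Y)" unfolding w_def by measurable
  have w0: "w p = 0 \<or> (fst p \<in> Theta \<and> evidence c (snd p) < \<infinity>)" for p
    using FT posterior_prob_infinite[of c "snd p" F] by (auto simp: w_def split: split_indicator)
  have iter: "?J f
     = (\<integral>\<^sup>+\<theta>. indicator F \<theta> / ?m * ?I \<theta> f \<partial>?P)"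
    if [measurable]: "f \<in> borel_measurable (?P \<Otimes>\<^sub>M ?Y)" for f
  proof -
    have "?J f = (\<integral>\<^sup>+\<theta>. (\<integral>\<^sup>+y. w (\<theta>, y) * f (\<theta>, y) \<partial>lborel) \<partial>?P)"
      by (rule lborel.nn_integral_fst[symmetric]) measurable
    also have "\<dots> = (\<integral>\<^sup>+\<theta>. (\<integral>\<^sup>+y. indicator F \<theta> / ?m * (ennreal (lik \<theta> y) * (?v y * f (\<theta>, y))) \<partial>lborel) \<partial>?P)"
      by (simp add: w_def mult.assoc)
    also have "\<dots> = (\<integral>\<^sup>+\<theta>. indicator F \<theta> / ?m * ?I \<theta> f \<partial>?P)"
    proof (rule nn_integral_cong)
      fix \<theta>
      have [measurable]: "(\<lambda>y. f (\<theta>, y)) \<in> borel_measurable ?Y" by measurable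
      show "(\<integral>\<^sup>+y. indicator F \<theta> / ?m * (ennreal (lik \<theta> y) * (?v y * f (\<theta>, y))) \<partial>lborel)
        = indicator F \<theta> / ?m * ?I \<theta> f"
        by (rule nn_integral_cmult) measurable
    qed
    finally show ?thesis .
  qed
  have mass: "(\<integral>\<^sup>+\<theta>. indicator F \<theta> / ?m * x \<partial>?P) = x" for x
  proof -
    have "(\<integral>\<^sup>+\<theta>. indicator F \<theta> / ?m * x \<partial>?P) = ?m / ?m * x"
      by (simp add: nn_integral_multc nn_integral_divide sets_prior)
    also have "?m / ?m = 1" using F0 F1 by (intro ennreal_divide_self) auto
    finally show ?thesis by simp
  qed
  have sub: "?J f \<le> x"
    if [measurable]: "f \<in> borel_measurable (?P \<Otimes>\<^sub>M ?Y)"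
      and bd: "\<And>\<theta>. \<theta> \<in> Theta \<Longrightarrow> ?I \<theta> f \<le> x" for f x
  proof -
    have "(\<integral>\<^sup>+\<theta>. indicator F \<theta> / ?m * ?I \<theta> f \<partial>?P)
      \<le> (\<integral>\<^sup>+\<theta>. indicator F \<theta> / ?m * x \<partial>?P)"
    proof (rule nn_integral_mono)
      fix \<theta>
      show "indicator F \<theta> / ?m * ?I \<theta> f \<le> indicator F \<theta> / ?m * x"
        using FT bd[of \<theta>] by (cases "\<theta> \<in> F") (auto intro!: mult_left_mono)
    qed
    then show ?thesis unfolding iter[OF that(1)] mass .
  qed
  have wl: "?J l \<le> \<rho>"
  proof (rule sub[OF l])
    fix \<theta> :: "'d affine" assume \<theta>: "\<theta> \<in> Theta"
    have [measurable]: "(\<lambda>y. l (\<theta>, y)) \<in> borel_measurable borel"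
    proof -
      have "(\<lambda>y. l (\<theta>, y)) \<in> borel_measurable ?Y" by measurable
      then show ?thesis by simp
    qed
    have "?I \<theta> l = (\<integral>\<^sup>+y. ?v y * l (\<theta>, y) \<partial>data_law \<theta>)"
      by (rule nn_integral_data_law[OF \<theta>, symmetric]) measurable
    also have "\<dots> \<le> risk Q \<theta>"
      unfolding risk_def
    proof (rule nn_integral_mono)
      fix y :: "('d, 'n) sample"
      show "?v y * l (\<theta>, y) \<le> e2ennreal (KL (data_law \<theta>) (Q y))"
      proof (cases "evidence c y < \<infinity> \<and> B (\<theta>, y) < \<infinity>")
        case True
        then have y: "evidence c y < \<infinity>" by simp
        let ?\<mu> = "data_law \<theta> :: ('d, 'm) sample measure"
        let ?E = "\<lambda>ys :: ('d, 'm) sample. ratio c \<theta> y ys"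
        have E: "?E \<in> borel_measurable ?\<mu>" by measurable
        have pos: "AE ys in ?\<mu>. 0 < ?E ys"
          unfolding data_law_eq[OF \<theta>] using AE_ratio_pos[OF \<theta> c y] by (subst AE_density) auto
        have "(\<integral>\<^sup>+ys. ennreal (ln (?E ys)) \<partial>?\<mu>) + 1
          \<le> e2ennreal (KL ?\<mu> (Q y)) + (\<integral>\<^sup>+ys. ennreal (- ln (?E ys)) \<partial>?\<mu>) + (\<integral>\<^sup>+ys. ennreal (?E ys) \<partial>Q y)"
          using Qp[of y] by (intro KL_variational[OF prob_space_data_law[OF \<theta>] _ _ E _ pos]) auto
        moreover have "(\<integral>\<^sup>+ys. ennreal (ln (?E ys)) \<partial>?\<mu>) = log_pos TYPE('m) c \<theta> y"
          "(\<integral>\<^sup>+ys. ennreal (- ln (?E ys)) \<partial>?\<mu>) = log_neg TYPE('m) c \<theta> y"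
          unfolding log_pos_def log_neg_def by (rule nn_integral_data_law[OF \<theta>], measurable)+
        ultimately have "log_pos TYPE('m) c \<theta> y + 1 \<le> (log_neg TYPE('m) c \<theta> y + B (\<theta>, y)) + e2ennreal (KL ?\<mu> (Q y))"
          by (simp add: B_def add_ac)
        then have "l (\<theta>, y) \<le> e2ennreal (KL ?\<mu> (Q y))"
          using True KL_posterior_predictive(2)[OF \<theta> c y, where 'm = 'm]
          by (auto simp: l_def ennreal_minus_le_iff top_unique less_top)
        then have "?v y * l (\<theta>, y) \<le> 1 * e2ennreal (KL ?\<mu> (Q y))"
          by (intro mult_mono posterior_prob_le_1[OF c]) auto
        then show ?thesis by simp
      next
        case False
        then show ?thesis using posterior_prob_infinite[of c y F] by (auto simp: l_def)
      qed
    qed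
    also have "\<dots> \<le> \<rho>" by (rule \<rho>[OF \<theta>])
    finally show "?I \<theta> l \<le> \<rho>" .
  qed
  have wneg: "?J ?neg \<le> 1"
  proof (rule sub)
    fix \<theta> :: "'d affine" assume \<theta>: "\<theta> \<in> Theta"
    have "?I \<theta> ?neg \<le> (\<integral>\<^sup>+y. ennreal (lik \<theta> (y :: ('d, 'n) sample)) \<partial>lborel)"
    proof (rule nn_integral_mono)
      fix y :: "('d, 'n) sample"
      have "?v y * ?neg (\<theta>, y) \<le> 1 * 1"
      proof (cases "evidence c y < \<infinity>")
        case True
        then show ?thesis
          using KL_posterior_predictive(2)[OF \<theta> c True, where 'm = 'm] posterior_prob_le_1[OF c, of F y]
          by (intro mult_mono) auto
      qed (simp add: posterior_prob_infinite)
      then have "ennreal (lik \<theta> y) * (?v y * ?neg (\<theta>, y)) \<le> ennreal (lik \<theta> y) * 1"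
        by (intro mult_left_mono) auto
      then show "ennreal (lik \<theta> y) * (?v y * ?neg (\<theta>, y)) \<le> ennreal (lik \<theta> y)" by simp
    qed
    also have "\<dots> = 1" by (rule nn_integral_lik[OF \<theta>])
    finally show "?I \<theta> ?neg \<le> 1" .
  qed measurable
  have wB: "?J B \<le> 1"
  proof -
    have "?J B = (\<integral>\<^sup>+y. (\<integral>\<^sup>+\<theta>. w (\<theta>, y) * B (\<theta>, y) \<partial>?P) \<partial>lborel)"
      by (rule PY.nn_integral_snd[symmetric]) measurable
    also have "\<dots> \<le> (\<integral>\<^sup>+y. (\<integral>\<^sup>+\<theta>. indicator F \<theta> * ennreal (lik \<theta> (y :: ('d, 'n) sample)) \<partial>?P) / ?m \<partial>lborel)"
    proof (rule nn_integral_mono)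
      fix y :: "('d, 'n) sample"
      interpret Qy: prob_space "Q y" by (rule Qp)
      have [measurable_cong]: "sets (Q y) = sets borel" by (rule Qp)
      interpret PQ: pair_sigma_finite ?P "Q y" ..
      have "(\<integral>\<^sup>+\<theta>. w (\<theta>, y) * B (\<theta>, y) \<partial>?P)
          = (\<integral>\<^sup>+\<theta>. (\<integral>\<^sup>+ys. w (\<theta>, y) * ennreal (ratio c \<theta> y ys) \<partial>Q y) \<partial>?P)"
        unfolding B_def by (simp add: nn_integral_cmult)
      also have "\<dots> = (\<integral>\<^sup>+ys. (\<integral>\<^sup>+\<theta>. w (\<theta>, y) * ennreal (ratio c \<theta> y ys) \<partial>?P) \<partial>Q y)"
        unfolding w_def by (rule PQ.Fubini'[symmetric]) measurable
      also have "\<dots> \<le> (\<integral>\<^sup>+ys. ?v y / ?m * evidence c y \<partial>Q y)"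
      proof (rule nn_integral_mono)
        fix ys :: "('d, 'm) sample"
        have "(\<integral>\<^sup>+\<theta>. w (\<theta>, y) * ennreal (ratio c \<theta> y ys) \<partial>?P)
            \<le> (\<integral>\<^sup>+\<theta>. (?v y / ?m) * (ennreal (lik \<theta> y) * ennreal (lik \<theta> ys) * (1 / pred_density c y ys)) \<partial>?P)"
        proof (rule nn_integral_mono)
          fix \<theta> :: "'d affine"
          have "ennreal (ratio c \<theta> y ys) \<le> ennreal (lik \<theta> ys) * (1 / pred_density c y ys)"
            by (simp add: ratio_def ennreal_enn2real_if ennreal_times_divide)
          then have "w (\<theta>, y) * ennreal (ratio c \<theta> y ys)
             \<le> (1 / ?m * (ennreal (lik \<theta> y) * ?v y)) * (ennreal (lik \<theta> ys) * (1 / pred_density c y ys))"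
            unfolding w_def by (intro mult_mono) (auto split: split_indicator)
          also have "\<dots> = (?v y * (1 / ?m)) * (ennreal (lik \<theta> y) * ennreal (lik \<theta> ys) * (1 / pred_density c y ys))"
            by (simp only: mult_ac)
          also have "?v y * (1 / ?m) = ?v y / ?m" by (simp add: ennreal_times_divide)
          finally show "w (\<theta>, y) * ennreal (ratio c \<theta> y ys)
             \<le> (?v y / ?m) * (ennreal (lik \<theta> y) * ennreal (lik \<theta> ys) * (1 / pred_density c y ys))" .
        qed
        also have "\<dots> = (?v y / ?m) * (joint_evidence c y ys * (1 / pred_density c y ys))"
          unfolding joint_evidence_def by (subst nn_integral_cmult, measurable, subst nn_integral_multc, measurable)
        also have "\<dots> \<le> (?v y / ?m) * evidence c y"
        proof (cases "evidence c y < \<infinity>")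
          case True
          have e0: "evidence c y \<noteq> 0" using evidence_pos[OF c, of y] by simp
          let ?W = "joint_evidence c y ys" let ?Z = "evidence c y"
          have W: "?W = ?Z * pred_density c y ys"
            using True e0 ennreal_mult_divide_eq[of ?Z ?W]
            by (simp add: pred_density_def ennreal_times_divide mult.commute)
          have "?W * (1 / pred_density c y ys) = ?Z * (pred_density c y ys * (1 / pred_density c y ys))"
            unfolding W by (simp only: mult.assoc)
          also have "\<dots> \<le> ?Z * 1" by (intro mult_left_mono ennreal_times_divide_le) auto
          finally show ?thesis by (intro mult_left_mono) auto
        qed (simp add: posterior_prob_infinite)
        finally show "(\<integral>\<^sup>+\<theta>. w (\<theta>, y) * ennreal (ratio c \<theta> y ys) \<partial>?P) \<le> ?v y / ?m * evidence c y" .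
      qed
      also have "\<dots> = ?v y / ?m * evidence c y" by (simp add: Qy.emeasure_space_1)
      also have "\<dots> = evidence c y * ?v y / ?m" by (simp add: ennreal_times_divide mult.commute)
      also have "\<dots> \<le> (\<integral>\<^sup>+\<theta>. indicator F \<theta> * ennreal (lik \<theta> y) \<partial>?P) / ?m"
        unfolding posterior_prob_def by (intro divide_right_mono_ennreal ennreal_times_divide_le)
      finally show "(\<integral>\<^sup>+\<theta>. w (\<theta>, y) * B (\<theta>, y) \<partial>?P) \<le> (\<integral>\<^sup>+\<theta>. indicator F \<theta> * ennreal (lik \<theta> y) \<partial>?P) / ?m" .
    qed
    also have "\<dots> = (\<integral>\<^sup>+y. (\<integral>\<^sup>+\<theta>. indicator F \<theta> * ennreal (lik \<theta> (y :: ('d, 'n) sample)) \<partial>?P) \<partial>lborel) / ?m"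
      by (rule nn_integral_divide) measurable
    also have "(\<integral>\<^sup>+y. (\<integral>\<^sup>+\<theta>. indicator F \<theta> * ennreal (lik \<theta> (y :: ('d, 'n) sample)) \<partial>?P) \<partial>lborel)
       = (\<integral>\<^sup>+\<theta>. (\<integral>\<^sup>+y. indicator F \<theta> * ennreal (lik \<theta> (y :: ('d, 'n) sample)) \<partial>lborel) \<partial>?P)"
      by (rule PY.Fubini') measurable
    also have "\<dots> = (\<integral>\<^sup>+\<theta>. indicator F \<theta> \<partial>?P)"
    proof (rule nn_integral_cong)
      fix \<theta>
      show "(\<integral>\<^sup>+y. indicator F \<theta> * ennreal (lik \<theta> (y :: ('d, 'n) sample)) \<partial>lborel) = indicator F \<theta>"
        using FT nn_integral_lik[of \<theta>, where 'm = 'n] by (cases "\<theta> \<in> F") (auto simp del: lik_Theta)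
    qed
    also have "\<dots> = ?m" by (simp add: sets_prior)
    also have "?m / ?m = 1" using F0 F1 by (intro ennreal_divide_self) auto
    finally show ?thesis .
  qed
  have "?J (\<lambda>p. ?loss p + 1) + ?J ?neg
    = (\<integral>\<^sup>+p. w p * (?loss p + 1) + w p * ?neg p \<partial>(?P \<Otimes>\<^sub>M ?Y))"
    by (rule nn_integral_add[symmetric]) measurable
  also have "\<dots> \<le> (\<integral>\<^sup>+p. w p * l p + w p * ?neg p + w p * B p \<partial>(?P \<Otimes>\<^sub>M ?Y))"
  proof (rule nn_integral_mono)
    fix p :: "'d affine \<times> ('d, 'n) sample"
    show "w p * (?loss p + 1) + w p * ?neg p \<le> w p * l p + w p * ?neg p + w p * B p"
    proof (cases "w p = 0")
      case False
      then have p: "fst p \<in> Theta" "evidence c (snd p) < \<infinity>" using w0[of p] by auto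
      have eq: "?loss p + ?neg p = ?pos p" by (rule KL_posterior_predictive(3)[OF p(1) c p(2)])
      have "?pos p + 1 \<le> l p + (?neg p + B p)"
      proof (cases "B p < \<infinity>")
        case True
        then show ?thesis
          using ennreal_le_diff_add[of "?pos p + 1" "?neg p + B p"] by (simp add: l_def)
      next
        case False
        then have "B p = \<infinity>" by (simp add: less_top[symmetric])
        then show ?thesis by simp
      qed
      then have "w p * (?pos p + 1) \<le> w p * (l p + (?neg p + B p))" by (rule mult_left_mono) simp
      then show ?thesis unfolding eq[symmetric] by (simp add: distrib_left add_ac)
    qed simp
  qed
  also have "\<dots> = ?J l + ?J ?neg + ?J B"
    by (subst nn_integral_add, measurable, subst nn_integral_add, measurable)
  also have "\<dots> \<le> \<rho> + ?J ?neg + 1"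
    using wl wB by (intro add_mono) auto
  finally have "?J ?neg + ?J (\<lambda>p. ?loss p + 1)
    \<le> ?J ?neg + (\<rho> + 1)"
    by (simp add: add_ac)
  moreover have "?J ?neg \<noteq> \<infinity>" using wneg by (auto simp: top_unique)
  ultimately have "?J (\<lambda>p. ?loss p + 1) \<le> \<rho> + 1"
    by (simp only: ennreal_add_left_cancel_le) simp
  moreover have "?J (\<lambda>p. ?loss p + 1) = (\<integral>\<^sup>+\<theta>. indicator F \<theta> / ?m *
      (\<integral>\<^sup>+y. ennreal (lik \<theta> y) * (?v y * (loss TYPE('m) c \<theta> y + 1)) \<partial>lborel) \<partial>?P)"
    using iter[of "\<lambda>p. ?loss p + 1"] by simp
  ultimately show ?thesis by simp
qed

text \<open>
  Substituting \<open>\<theta> k\<close> for the parameter produces the same constants in the numerator and in the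
  evidence.
\<close>

lemma posterior_prob_act:
  fixes F :: "'d::{finite,wellorder} affine set" and z :: "('d, 'n::finite) sample"
  assumes \<theta>: "\<theta> \<in> Theta" and c: "0 < c" and F [measurable]: "F \<in> sets borel"
  shows "posterior_prob c F (act_all \<theta> z)
    = (\<integral>\<^sup>+k. indicator F (gmul \<theta> k) * ennreal (lik k z) \<partial>prior c) / evidence c z"
proof -
  obtain K where K: "0 < K" "K < \<infinity>"
    "\<And>f. f \<in> borel_measurable borel \<Longrightarrow> (\<integral>\<^sup>+k. f (gmul \<theta> k) \<partial>prior c) = K * (\<integral>\<^sup>+k. f k \<partial>prior c)"
    using prior_left_mult[OF \<theta> c] by blast
  let ?D = "ennreal (1 / det (fst \<theta>) ^ CARD('n))"
  have d: "0 < det (fst \<theta>)" by (rule det_Theta_pos[OF \<theta>])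
  have D: "0 < ?D" "?D < \<infinity>" using d by auto
  have lik: "ennreal (lik (gmul \<theta> k) (act_all \<theta> z)) = ?D * ennreal (lik k z)" if "k \<in> Theta" for k
    using that d by (simp add: gmul_Theta[OF \<theta>] iid_density_gmul[OF \<theta>] ennreal_mult''[symmetric] less_imp_le[OF iid_density_pos])
  have scale: "K * (\<integral>\<^sup>+k. g k * ennreal (lik k (act_all \<theta> z)) \<partial>prior c)
      = ?D * (\<integral>\<^sup>+k. g (gmul \<theta> k) * ennreal (lik k z) \<partial>prior c)"
    if [measurable]: "g \<in> borel_measurable borel" for g :: "'d affine \<Rightarrow> ennreal"
  proof -
    have "K * (\<integral>\<^sup>+k. g k * ennreal (lik k (act_all \<theta> z)) \<partial>prior c)
       = (\<integral>\<^sup>+k. g (gmul \<theta> k) * ennreal (lik (gmul \<theta> k) (act_all \<theta> z)) \<partial>prior c)"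
      by (rule K(3)[where f = "\<lambda>k. g k * ennreal (lik k (act_all \<theta> z))", symmetric]) measurable
    also have "\<dots> = (\<integral>\<^sup>+k. ?D * (g (gmul \<theta> k) * ennreal (lik k z)) \<partial>prior c)"
      by (rule nn_integral_cong_AE, rule AE_mp[OF AE_prior_Theta]) (simp add: lik mult_ac del: lik_Theta)
    also have "\<dots> = ?D * (\<integral>\<^sup>+k. g (gmul \<theta> k) * ennreal (lik k z) \<partial>prior c)"
      by (rule nn_integral_cmult) measurable
    finally show ?thesis .
  qed
  have "posterior_prob c F (act_all \<theta> z)
     = (K * (\<integral>\<^sup>+k. indicator F k * ennreal (lik k (act_all \<theta> z)) \<partial>prior c)) / (K * (\<integral>\<^sup>+k. 1 * ennreal (lik k (act_all \<theta> z)) \<partial>prior c))"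
    unfolding posterior_prob_def evidence_def ennreal_divide_cancel_common[OF K(1,2)] by simp
  also have "\<dots> = (\<integral>\<^sup>+k. indicator F (gmul \<theta> k) * ennreal (lik k z) \<partial>prior c) / (\<integral>\<^sup>+k. 1 * ennreal (lik k z) \<partial>prior c)"
    using scale[of "indicator F"] scale[of "\<lambda>_. 1"] ennreal_divide_cancel_common[OF D] by simp
  finally show ?thesis by (simp add: evidence_def)
qed

text \<open>
  The preceding bound in the coordinates \<open>y = \<theta> z\<close>, with the integral over \<open>\<theta>\<close> carried out first.
\<close>

lemma bayes_risk_bound_orbit:
  fixes F :: "'d::{finite,wellorder} affine set"
    and Q :: "('d, 'n::finite) sample \<Rightarrow> ('d, 'm::finite) sample measure"
  assumes c: "0 < c" and Q: "Q \<in> borel \<rightarrow>\<^sub>M prob_algebra borel"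
    and \<rho>: "\<And>\<theta>. \<theta> \<in> Theta \<Longrightarrow> risk Q \<theta> \<le> \<rho>"
    and F [measurable]: "F \<in> sets borel" and FT: "F \<subseteq> Theta"
    and F0: "0 < emeasure (prior c) F" and F1: "emeasure (prior c) F < \<infinity>"
  shows "(\<integral>\<^sup>+z. (\<integral>\<^sup>+k. ennreal (lik gunit z) * (loss TYPE('m) c gunit z + 1) / evidence c z * ennreal (lik k (z :: ('d, 'n) sample)) *
      (emeasure (prior c) {\<theta> \<in> F. gmul \<theta> k \<in> F} / emeasure (prior c) F) \<partial>prior c) \<partial>lborel) \<le> \<rho> + 1"
proof -
  let ?P = "prior c :: 'd affine measure" let ?Y = "lborel :: ('d, 'n) sample measure"
  let ?m = "emeasure ?P F"
  interpret P: sigma_finite_measure ?P by (rule sigma_finite_prior)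
  interpret PY: pair_sigma_finite ?P ?Y ..
  interpret PP: pair_sigma_finite ?P ?P ..
  define H where "H = (\<lambda>z :: ('d, 'n) sample. ennreal (lik gunit z) * (loss TYPE('m) c gunit z + 1) / evidence c z)"
  have [measurable]: "H \<in> borel_measurable borel" unfolding H_def by measurable
  have "(\<integral>\<^sup>+z. (\<integral>\<^sup>+k. H z * ennreal (lik k z) * (emeasure ?P {\<theta> \<in> F. gmul \<theta> k \<in> F} / ?m) \<partial>?P) \<partial>?Y)
      = (\<integral>\<^sup>+z. (\<integral>\<^sup>+k. (\<integral>\<^sup>+\<theta>. indicator F \<theta> / ?m * (H z * (indicator F (gmul \<theta> k) * ennreal (lik k z))) \<partial>?P) \<partial>?P) \<partial>?Y)"
  proof (intro nn_integral_cong)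
    fix z :: "('d, 'n) sample" and k :: "'d affine"
    have "{\<theta> \<in> space borel. \<theta> \<in> F \<and> gmul \<theta> k \<in> F} \<in> sets borel" by measurable
    then have "emeasure ?P {\<theta> \<in> F. gmul \<theta> k \<in> F} = (\<integral>\<^sup>+\<theta>. indicator {\<theta> \<in> F. gmul \<theta> k \<in> F} \<theta> \<partial>?P)"
      by (simp add: sets_prior)
    also have "\<dots> = (\<integral>\<^sup>+\<theta>. indicator F \<theta> * indicator F (gmul \<theta> k) \<partial>?P)"
      by (intro nn_integral_cong) (auto split: split_indicator)
    finally have "H z * ennreal (lik k z) * (emeasure ?P {\<theta> \<in> F. gmul \<theta> k \<in> F} / ?m)
       = (\<integral>\<^sup>+\<theta>. H z * ennreal (lik k z) * (indicator F \<theta> * indicator F (gmul \<theta> k) / ?m) \<partial>?P)"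
      by (simp add: nn_integral_cmult nn_integral_divide)
    also have "\<dots> = (\<integral>\<^sup>+\<theta>. indicator F \<theta> / ?m * (H z * (indicator F (gmul \<theta> k) * ennreal (lik k z))) \<partial>?P)"
      by (intro nn_integral_cong) (auto simp: mult_ac split: split_indicator)
    finally show "H z * ennreal (lik k z) * (emeasure ?P {\<theta> \<in> F. gmul \<theta> k \<in> F} / ?m)
       = (\<integral>\<^sup>+\<theta>. indicator F \<theta> / ?m * (H z * (indicator F (gmul \<theta> k) * ennreal (lik k z))) \<partial>?P)" .
  qed
  also have "\<dots> = (\<integral>\<^sup>+z. (\<integral>\<^sup>+\<theta>. (\<integral>\<^sup>+k. indicator F \<theta> / ?m * (H z * (indicator F (gmul \<theta> k) * ennreal (lik k z))) \<partial>?P) \<partial>?P) \<partial>?Y)"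
    by (intro nn_integral_cong PP.Fubini') measurable
  also have "\<dots> = (\<integral>\<^sup>+\<theta>. (\<integral>\<^sup>+z. (\<integral>\<^sup>+k. indicator F \<theta> / ?m * (H z * (indicator F (gmul \<theta> k) * ennreal (lik k z))) \<partial>?P) \<partial>?Y) \<partial>?P)"
    by (rule PY.Fubini') measurable
  also have "\<dots> = (\<integral>\<^sup>+\<theta>. indicator F \<theta> / ?m *
      (\<integral>\<^sup>+y. ennreal (lik \<theta> y) * (posterior_prob c F y * (loss TYPE('m) c \<theta> (y :: ('d, 'n) sample) + 1)) \<partial>lborel) \<partial>?P)"
  proof (rule nn_integral_cong)
    fix \<theta> :: "'d affine"
    show "(\<integral>\<^sup>+z. (\<integral>\<^sup>+k. indicator F \<theta> / ?m * (H z * (indicator F (gmul \<theta> k) * ennreal (lik k z))) \<partial>?P) \<partial>?Y)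
       = indicator F \<theta> / ?m *
      (\<integral>\<^sup>+y. ennreal (lik \<theta> y) * (posterior_prob c F y * (loss TYPE('m) c \<theta> (y :: ('d, 'n) sample) + 1)) \<partial>lborel)"
    proof (cases "\<theta> \<in> F")
      case True
      then have \<theta>: "\<theta> \<in> Theta" using FT by auto
      have "(\<integral>\<^sup>+y. ennreal (lik \<theta> y) * (posterior_prob c F y * (loss TYPE('m) c \<theta> (y :: ('d, 'n) sample) + 1)) \<partial>lborel)
         = (\<integral>\<^sup>+z. ennreal (lik gunit z) * (posterior_prob c F (act_all \<theta> z) * (loss TYPE('m) c \<theta> (act_all \<theta> (z :: ('d, 'n) sample)) + 1)) \<partial>lborel)"
        using nn_integral_iid_density_act[OF \<theta>, of "\<lambda>y :: ('d, 'n) sample. posterior_prob c F y * (loss TYPE('m) c \<theta> y + 1)"] \<theta> by simp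
      also have "\<dots> = (\<integral>\<^sup>+z. H z * (\<integral>\<^sup>+k. indicator F (gmul \<theta> k) * ennreal (lik k (z :: ('d, 'n) sample)) \<partial>?P) \<partial>lborel)"
        unfolding loss_act[OF \<theta> c] posterior_prob_act[OF \<theta> c F] H_def
        by (simp add: ennreal_times_divide mult_ac divide_ennreal_def)
      finally have eq: "(\<integral>\<^sup>+y. ennreal (lik \<theta> y) * (posterior_prob c F y * (loss TYPE('m) c \<theta> (y :: ('d, 'n) sample) + 1)) \<partial>lborel)
         = (\<integral>\<^sup>+z. H z * (\<integral>\<^sup>+k. indicator F (gmul \<theta> k) * ennreal (lik k (z :: ('d, 'n) sample)) \<partial>?P) \<partial>lborel)" .
      show ?thesis unfolding eq
        by (subst nn_integral_cmult[symmetric], measurable)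
          (intro nn_integral_cong, subst nn_integral_cmult, measurable, subst nn_integral_cmult, measurable)
    qed simp
  qed
  also have "\<dots> \<le> \<rho> + 1" by (rule bayes_risk_bound[OF c Q \<rho> F FT F0 F1])
  finally show ?thesis unfolding H_def .
qed

lemma le_liminf_mult:
  fixes x :: ennreal
  assumes g: "1 \<le> liminf g"
  shows "x \<le> liminf (\<lambda>N. x * g N)"
  unfolding le_Liminf_iff
proof (intro allI impI)
  fix y assume y: "y < x"
  have ev: "\<forall>\<^sub>F N in sequentially. t < g N" if "t < 1" for t
    using g that unfolding le_Liminf_iff by blast
  show "\<forall>\<^sub>F N in sequentially. y < x * g N"
  proof (cases x)
    case (real r)
    obtain s where s: "y = ennreal s" "0 \<le> s" using y real by (cases y) auto
    have sr: "s < r" using y real s by (simp add: ennreal_less_iff)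
    then have r0: "0 < r" using s by simp
    have "ennreal (s / r) < ennreal 1" using sr r0 by (intro ennreal_lessI) auto
    from ev[OF this[unfolded ennreal_1]] show ?thesis
    proof eventually_elim
      case (elim N)
      have "y = x * ennreal (s / r)" using real s r0 by (simp add: ennreal_mult''[symmetric])
      also have "\<dots> < x * g N" using real r0 elim by (intro ennreal_mult_strict_left_mono) auto
      finally show ?case .
    qed
  next
    case top
    have "(0 :: ennreal) < 1" by simp
    from ev[OF this] show ?thesis
      by eventually_elim (use y top in \<open>auto simp: ennreal_top_mult\<close>)
  qed
qed

text \<open>
  Fatou's lemma along the Foelner boxes, first in \<open>k\<close> and then in \<open>z\<close>.
\<close>

lemma risk_lower_bound:
  fixes Q :: "('d::{finite,wellorder}, 'n::finite) sample \<Rightarrow> ('d, 'm::finite) sample measure"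
  assumes c: "0 < c" and card: "CARD('d) < CARD('n)" and Q: "Q \<in> borel \<rightarrow>\<^sub>M prob_algebra borel"
    and \<rho>: "\<And>\<theta>. \<theta> \<in> Theta \<Longrightarrow> risk Q \<theta> \<le> \<rho>"
  shows "(\<integral>\<^sup>+z. ennreal (lik gunit z) * loss TYPE('m) c gunit (z :: ('d, 'n) sample) \<partial>lborel) \<le> \<rho>"
proof -
  let ?P = "prior c :: 'd affine measure" let ?Y = "lborel :: ('d, 'n) sample measure"
  interpret P: sigma_finite_measure ?P by (rule sigma_finite_prior)
  interpret PP: pair_sigma_finite ?P ?P ..
  define H where "H = (\<lambda>z :: ('d, 'n) sample. ennreal (lik gunit z) * (loss TYPE('m) c gunit z + 1) / evidence c z)"
  have Hm [measurable]: "H \<in> borel_measurable borel" unfolding H_def by measurable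
  define g where "g = (\<lambda>N (k :: 'd affine). emeasure ?P {\<theta> \<in> foelner N. gmul \<theta> k \<in> foelner N} / emeasure ?P (foelner N))"
  have gm [measurable]: "g N \<in> borel_measurable borel" for N
  proof -
    have eq: "g N k = (\<integral>\<^sup>+\<theta>. indicator (foelner N) \<theta> * indicator (foelner N) (gmul \<theta> k) \<partial>?P) / emeasure ?P (foelner N)" for k
    proof -
      have "{\<theta> \<in> space borel. \<theta> \<in> foelner N \<and> gmul \<theta> k \<in> foelner N} \<in> sets borel" by measurable
      then have "emeasure ?P {\<theta> \<in> foelner N. gmul \<theta> k \<in> foelner N} = (\<integral>\<^sup>+\<theta>. indicator {\<theta> \<in> foelner N. gmul \<theta> k \<in> foelner N} \<theta> \<partial>?P)"
        by (simp add: sets_prior)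
      also have "\<dots> = (\<integral>\<^sup>+\<theta>. indicator (foelner N) \<theta> * indicator (foelner N) (gmul \<theta> k) \<partial>?P)"
        by (intro nn_integral_cong) (auto split: split_indicator)
      finally show ?thesis by (simp add: g_def)
    qed
    show ?thesis unfolding eq[abs_def] by measurable
  qed
  have bound: "(\<integral>\<^sup>+z. (\<integral>\<^sup>+k. H z * ennreal (lik k z) * g N k \<partial>?P) \<partial>?Y) \<le> \<rho> + 1" if "0 < N" for N
    unfolding H_def g_def
    by (rule bayes_risk_bound_orbit[OF c Q \<rho> foelner_borel foelner_Theta foelner_measure(2)[OF c that] foelner_measure(1)[OF c]])
  have "(\<integral>\<^sup>+z. ennreal (lik gunit z) * (loss TYPE('m) c gunit (z :: ('d, 'n) sample) + 1) \<partial>lborel)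
      = (\<integral>\<^sup>+z. (\<integral>\<^sup>+k. H z * ennreal (lik k z) \<partial>?P) \<partial>?Y)"
  proof (rule nn_integral_cong_AE, use AE_evidence_finite[OF c card] in eventually_elim)
    case (elim z)
    have "(\<integral>\<^sup>+k. H z * ennreal (lik k z) \<partial>?P) = H z * evidence c z"
      unfolding evidence_def by (rule nn_integral_cmult) measurable
    also have "\<dots> = ennreal (lik gunit z) * (loss TYPE('m) c gunit z + 1) * (evidence c z / evidence c z)"
      unfolding H_def by (simp add: divide_ennreal_def mult_ac)
    also have "evidence c z / evidence c z = 1"
      using elim evidence_pos[OF c, of z] by (intro ennreal_divide_self) auto
    finally show ?case by simp
  qed
  also have "\<dots> \<le> (\<integral>\<^sup>+z. (\<integral>\<^sup>+k. liminf (\<lambda>N. H z * ennreal (lik k z) * g N k) \<partial>?P) \<partial>?Y)"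
  proof (rule nn_integral_mono)
    fix z :: "('d, 'n) sample"
    show "(\<integral>\<^sup>+k. H z * ennreal (lik k z) \<partial>?P) \<le> (\<integral>\<^sup>+k. liminf (\<lambda>N. H z * ennreal (lik k z) * g N k) \<partial>?P)"
    proof (rule nn_integral_mono_AE, rule AE_mp[OF AE_prior_Theta], rule AE_I2, rule impI)
      fix k :: "'d affine" assume k: "k \<in> Theta"
      show "H z * ennreal (lik k z) \<le> liminf (\<lambda>N. H z * ennreal (lik k z) * g N k)"
      proof (rule le_liminf_mult)
        show "1 \<le> liminf (\<lambda>N. g N k)" unfolding g_def by (rule foelner_limit[OF k c])
      qed
    qed
  qed
  also have "\<dots> \<le> (\<integral>\<^sup>+z. liminf (\<lambda>N. \<integral>\<^sup>+k. H z * ennreal (lik k z) * g N k \<partial>?P) \<partial>?Y)"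
    by (intro nn_integral_mono nn_integral_liminf) measurable
  also have "\<dots> \<le> liminf (\<lambda>N. \<integral>\<^sup>+z. (\<integral>\<^sup>+k. H z * ennreal (lik k z) * g N k \<partial>?P) \<partial>?Y)"
    by (rule nn_integral_liminf) measurable
  also have "\<dots> \<le> liminf (\<lambda>_ :: nat. \<rho> + 1)"
    by (rule Liminf_mono, rule eventually_mono[OF eventually_gt_at_top[of 0]]) (rule bound)
  also have "\<dots> = \<rho> + 1" by (rule Liminf_const) simp
  finally have "(\<integral>\<^sup>+z. ennreal (lik gunit z) * (loss TYPE('m) c gunit (z :: ('d, 'n) sample) + 1) \<partial>lborel) \<le> \<rho> + 1" .
  moreover have "(\<integral>\<^sup>+z. ennreal (lik gunit z) * (loss TYPE('m) c gunit (z :: ('d, 'n) sample) + 1) \<partial>lborel)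
     = (\<integral>\<^sup>+z. ennreal (lik gunit z) * loss TYPE('m) c gunit (z :: ('d, 'n) sample) \<partial>lborel) + (\<integral>\<^sup>+z. ennreal (lik gunit (z :: ('d, 'n) sample)) \<partial>lborel)"
    by (subst nn_integral_add[symmetric], measurable) (simp add: distrib_left)
  moreover have "(\<integral>\<^sup>+z. ennreal (lik gunit (z :: ('d, 'n) sample)) \<partial>lborel) = 1" by (rule nn_integral_lik) simp
  ultimately have "1 + (\<integral>\<^sup>+z. ennreal (lik gunit z) * loss TYPE('m) c gunit (z :: ('d, 'n) sample) \<partial>lborel) \<le> 1 + \<rho>"
    by (simp only: add.commute[of _ 1])
  then show ?thesis by (simp add: ennreal_add_left_cancel_le)
qed

section \<open>Optimality\<close>

text \<open>
  The domain of a procedure need not be a Borel set. It contains one of full measure, on which the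
  procedure agrees with a kernel that is defined everywhere.
\<close>

lemma measurable_extension:
  fixes q :: "('d::finite, 'n::finite, 'm::finite) procedure"
  assumes q: "predictive_procedure q"
  shows "\<exists>Q. Q \<in> borel \<rightarrow>\<^sub>M prob_algebra borel \<and> (AE y in lborel. y \<in> dom q \<and> the (q y) = Q y)"
proof -
  have AE: "AE y in lborel. y \<in> dom q" and q: "(\<lambda>y. the (q y)) \<in> restrict_space borel (dom q) \<rightarrow>\<^sub>M prob_algebra borel"
    using assms by (auto simp: predictive_procedure_def)
  obtain N where N: "{y \<in> space lborel. y \<notin> dom q} \<subseteq> N" "emeasure lborel N = 0" "N \<in> sets lborel"
    using AE by (rule AE_E)
  define D where "D = - N"
  have D: "D \<in> sets borel" "D \<subseteq> dom q" using N by (auto simp: D_def)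
  have "(\<lambda>y. the (q y)) \<in> restrict_space (restrict_space borel (dom q)) D \<rightarrow>\<^sub>M prob_algebra borel"
    by (rule measurable_restrict_space1[OF q])
  moreover have "measurable (restrict_space (restrict_space borel (dom q)) D) (prob_algebra borel)
      = (measurable (restrict_space borel D) (prob_algebra borel) :: ((real^'d^'n) \<Rightarrow> (real^'d^'m) measure) set)"
    using D(2) by (intro measurable_cong_sets refl) (simp add: sets_restrict_restrict_space Int_absorb1)
  ultimately have qD: "(\<lambda>y. the (q y)) \<in> restrict_space borel D \<rightarrow>\<^sub>M prob_algebra borel" by simp
  define p :: "(real^'d^'m) measure" where "p = return borel 0"
  define Q where "Q = (\<lambda>y. if y \<in> D then the (q y) else p)"
  have p: "p \<in> space (prob_algebra borel)"
    unfolding p_def by (simp add: space_prob_algebra prob_space_return)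
  have "Q \<in> borel \<rightarrow>\<^sub>M prob_algebra borel"
    unfolding Q_def
    by (subst measurable_If_restrict_space_iff) (use D qD p in \<open>auto intro: measurable_restrict_space1\<close>)
  moreover have "AE y in lborel. y \<in> dom q \<and> the (q y) = Q y"
    by (rule AE_I[OF _ N(2,3)]) (use D in \<open>auto simp: Q_def D_def\<close>)
  ultimately show ?thesis by blast
qed

lemma expected_log_ratio_eq_risk:
  fixes q :: "('d::{finite,wellorder}, 'n::finite, 'm::finite) procedure"
  assumes \<theta>: "\<theta> \<in> Theta" and Q: "Q \<in> borel \<rightarrow>\<^sub>M prob_algebra borel"
    and AE: "AE y in lborel. y \<in> dom q \<and> the (q y) = Q y"
  shows "expected_log_ratio q \<theta> = - enn2ereal (risk Q \<theta>)"
proof -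
  have AE': "AE y in data_law \<theta>. the (q y) = Q y"
    unfolding data_law_eq[OF \<theta>] using AE by (subst AE_density) auto
  have Qp: "prob_space (Q y)" "sets (Q y) = sets borel" for y
    using measurable_space[OF Q, of y] by (auto simp: space_prob_algebra)
  have nn: "0 \<le> KL (data_law \<theta>) (Q y)" for y
    using Qp[of y] by (intro KL_nonneg prob_space_data_law[OF \<theta>]) auto
  have "(\<integral>\<^sup>+y. e2ennreal (- KL (cond_law \<theta> y) (the (q y))) \<partial>data_law \<theta>) = (\<integral>\<^sup>+(y :: ('d, 'n) sample). 0 \<partial>data_law \<theta>)"
    by (rule nn_integral_cong_AE, use AE' in eventually_elim) (simp add: cond_law_eq[OF \<theta>] nn e2ennreal_neg)
  moreover have "(\<integral>\<^sup>+y. e2ennreal (- (- KL (cond_law \<theta> y) (the (q y)))) \<partial>data_law \<theta>) = risk Q \<theta>"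
    unfolding risk_def by (rule nn_integral_cong_AE, use AE' in eventually_elim) (simp add: cond_law_eq[OF \<theta>])
  ultimately show ?thesis by (simp add: expected_log_ratio_def ext_integral_def zero_ennreal.rep_eq)
qed

theorem corollary3p5:
  fixes c :: real
  assumes "CARD('d::{finite,wellorder}) < CARD('n::finite)"
    and "0 < c"
  shows "optimal_procedure (posterior_predictive c :: ('d, 'n, 'm::finite) procedure)
       \<and> invariant_procedure (posterior_predictive c :: ('d, 'n, 'm) procedure)"
proof
  note card = assms(1) and c = assms(2)
  let ?p = "posterior_predictive c :: ('d, 'n, 'm) procedure"
  let ?R = "\<integral>\<^sup>+z. ennreal (lik gunit z) * loss TYPE('m) c gunit (z :: ('d, 'n) sample) \<partial>lborel"
  have flip: "y \<le> - x" if "x \<le> - y" for x y :: ereal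
    using that ereal_minus_le_minus[of "- y" x] by simp
  show "invariant_procedure ?p" by (rule invariant_posterior[OF c])
  have pp: "predictive_procedure ?p" by (rule predictive_procedure_posterior[OF c card])
  have p_risk: "expected_log_ratio ?p \<theta> = - enn2ereal ?R" if \<theta>: "\<theta> \<in> Theta" for \<theta>
  proof -
    obtain Q where Q: "Q \<in> borel \<rightarrow>\<^sub>M prob_algebra borel" "AE y in lborel. y \<in> dom ?p \<and> the (?p y) = Q y"
      using measurable_extension[OF pp] by (elim exE conjE)
    have eq: "AE y in data_law \<theta>. the (?p y) = Q y"
      unfolding data_law_eq[OF \<theta>] using Q(2) by (subst AE_density) auto
    have "risk Q \<theta> = risk (\<lambda>y. the (?p y)) \<theta>"
      unfolding risk_def by (rule nn_integral_cong_AE, use eq in eventually_elim) simp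
    also have "\<dots> = ?R" by (rule risk_posterior_predictive[OF \<theta> c card])
    finally show ?thesis by (simp only: expected_log_ratio_eq_risk[OF \<theta> Q])
  qed
  have "worst_case q \<le> worst_case ?p" if q: "predictive_procedure q" for q :: "('d, 'n, 'm) procedure"
  proof -
    obtain Q where Q: "Q \<in> borel \<rightarrow>\<^sub>M prob_algebra borel" "AE y in lborel. y \<in> dom q \<and> the (q y) = Q y"
      using measurable_extension[OF q] by (elim exE conjE)
    have le: "worst_case q \<le> - enn2ereal (risk Q \<theta>)" if "\<theta> \<in> Theta" for \<theta>
    proof -
      have "worst_case q \<le> expected_log_ratio q \<theta>" unfolding worst_case_def using that by (rule INF_lower)
      then show ?thesis by (simp only: expected_log_ratio_eq_risk[OF that Q])
    qed
    have "risk Q \<theta> \<le> e2ennreal (- worst_case q)" if "\<theta> \<in> Theta" for \<theta>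
    proof -
      have "enn2ereal (risk Q \<theta>) \<le> - worst_case q"
        by (rule flip[OF le[OF that]])
      then have "e2ennreal (enn2ereal (risk Q \<theta>)) \<le> e2ennreal (- worst_case q)" by (rule e2ennreal_mono)
      then show ?thesis by simp
    qed
    then have "?R \<le> e2ennreal (- worst_case q)" by (rule risk_lower_bound[OF c card Q(1)])
    then have "enn2ereal ?R \<le> enn2ereal (e2ennreal (- worst_case q))" by (simp add: less_eq_ennreal.rep_eq)
    also have "\<dots> = - worst_case q"
    proof (rule enn2ereal_e2ennreal)
      have "worst_case q \<le> - enn2ereal (risk Q gunit)" by (rule le) simp
      also have "\<dots> \<le> 0" by simp
      finally show "0 \<le> - worst_case q" by simp
    qed
    finally have "worst_case q \<le> - enn2ereal ?R" by (rule flip)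
    also have "\<dots> \<le> worst_case ?p" unfolding worst_case_def by (rule INF_greatest) (simp add: p_risk)
    finally show ?thesis .
  qed
  then show "optimal_procedure ?p"
    unfolding optimal_procedure_def is_arg_max_def using pp by (auto simp: not_less)
qed

end
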